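(* Assume Hypotheses (H1)-(H4) of the context hold. Given a nonempty open set $A\subset\operatorname{supp}\mu$, let $\Delta\subset A$ be the reference set associated to $A$ as constructed in the context. Then there exist $C_9\ge1$, $\gamma_2>0$ and $\theta_1\in(0,1)$ such that for all $n\ge1$ $$m^*\otimes\mathbb P\left\{(x,\omega): |Y_n^\Delta(x,\omega)|\le\theta_1n\right\}\le C_9e^{-\gamma_2n}.$$
   Context: **Setting.** $M$ is a smooth compact $k$-dimensional manifold with Lebesgue (volume) measure $m$; $|x-y|$, $d$ and $\mathrm{dist}$ denote distance on $M$, $\|\cdot\|$ the operator norm, $B_\delta(x)$ the ball of radius $\delta$ about $x$, $r(B)$ the radius of a ball $B$, and $X\Subset Y$ means that the closure of $X$ is contained in the interior of $Y$. Fix $\sigma>0$, let $\nu$ be normalized Lebesgue measure on $[-\sigma,\sigma]^k$, $\Omega=([-\sigma,\sigma]^k)^{\mathbb N}$, $\mathbb P=\nu^{\otimes\mathbb N}$ (product $\sigma$-algebra), $\omega=(\omega_i)_{i\ge0}$, and $\theta(\{\omega_i\}_{i\ge 0})=\{\omega_{i+1}\}_{i\ge 0}$. Given $g:M\times[-\sigma,\sigma]^k\to M$, put $f_\omega(x)=g(x,\omega_0)$ and $f^n_\omega=f_{\theta^{n-1}\omega}\circ\cdots\circ f_\omega$; $df_\omega(x)=d_xg(x,\omega_0)$ is the derivative in $x$. The iterations define a Markov process on $M$. **(H1)** $g$ is continuous and, for each $\omega_0$, $g(\cdot,\omega_0)$ is $C^{1+\beta}$, $\beta>0$, outside a critical set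 $\mathcal C_{\omega_0}\subset M$ where this map is not differentiable or the derivative is not invertible. For all $x\in M$, $g(x,\cdot):[-\sigma,\sigma]^k\to M$ is a diffeomorphism onto its image, and $(x,\omega_0)\mapsto\det d_{\omega_0}g(x,\omega_0)$ is Hölder continuous. In particular there are $c_1,c_2>0$ with $c_1\ge|\det(d_{\omega_0}g(x,\omega_0))|\ge c_2>0$ for all $(x,\omega_0)$. **(H2)** For all $\omega_0$, $\mathcal C_{\omega_0}$ is closed with zero Lebesgue measure, and there are constants $B>1$, $\alpha>0$ (and $\beta$ as in (H1)), such that for all $\omega_0\in[-\sigma,\sigma]^k$: (1) for all $x\in M\setminus\mathcal C_{\omega_0}$ and $0\ne v\in T_xM$, $\frac1B\mathrm{dist}(x,\mathcal C_{\omega_0})^\alpha\le\frac{|d_xg(x,\omega_0)v|}{|v|}\le B\,\mathrm{dist}(x,\mathcal C_{\omega_0})^{-\alpha}$; (2) for all $x,y\in M\setminus\mathcal C_{\omega_0}$ with $|x-y|\le\mathrm{dist}(x,\mathcal C_{\omega_0})/2$, both $\big|\log\|d_xg(x,\omega_0)^{-1}\|-\log\|d_xg(y,\omega_0)^{-1}\|\big|$ and $\big|\log|\det d_xg(x,\omega_0)|-\log|\det d_xg(y,\omega_0)|\big|$ are at most $\frac{B}{\mathrm{dist}(x,\mathcal C_{\omega_0})^\alpha}|x-y|^\beta$. Furthermore $\omega_0\mapsto\mathcal C_{\omega_0}$ is upper semi-continuous in the Hausdorff topology. **(H3)** The Markov process associated to $f^n_\omega$ admits an ergodic stationary measure $\mu$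 with $\lambda=-\int_{M\times\Omega}\log\|df_\omega(x)^{-1}\|\,d\mu(x)\,d\mathbb P(\omega)>0$. **(H4)** Let $m^*=m|_{\operatorname{supp}(\mu)}$. There is $C_1>0$ such that for all $\delta>0$ small enough $m^*\otimes\mathbb P\{(x,\omega):\mathrm{dist}(x,\mathcal C_{\omega_0})\le\delta\}\le C_1\delta$. **Hyperbolic times.** For $r\in(0,1)$, $\mathrm{dist}_r(x,\mathcal C_{\omega_0})=1$ if $\mathrm{dist}(x,\mathcal C_{\omega_0})>r$ and $=\mathrm{dist}(x,\mathcal C_{\omega_0})$ otherwise. Fix $b>0$ with $b<\frac12\min\{1,\alpha^{-1}\beta\}$. For $\eta\in(0,1)$, $r>0$, $n$ is an $(\eta,r)$-hyperbolic time for $(x,\omega)$ if for every $0\le k<n$: $\prod_{i=k}^{n-1}\|df_{\theta^i\omega}(f^i_\omega(x))^{-1}\|<\eta^{n-k}$ and $\mathrm{dist}_r(f^k_\omega(x),\mathcal C_{\omega_k})>\eta^{b(n-k)}$. Let $H_n(x,\omega,\eta,r)$ be the set of $(\eta,r)$-hyperbolic times of $(x,\omega)$ in $\{1,\dots,n\}$. **Choice of $\eta_0,r_0,\delta_0$.** Fix $\eta_0\in(0,1)$, $r_0>0$ such that for some $\theta_0\in(0,1)$, $C_7\ge1$, $\gamma_1>0$ one has $m^*\otimes\mathbb P\{|H_n(x,\omega,\eta_0,r_0)|\le\theta_0n\}\le C_7e^{-\gamma_1n}$ for all $n\ge0$ (such constants exist under (H1)-(H4)). Fix $\delta_0>0$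 small enough that, for some $C_6>0$, whenever $n$ is an $(\eta_0,r_0)$-hyperbolic time for $(x,\omega)$ and $0<\delta\le\delta_0$, there is an open neighborhood $V_n^\delta(x,\omega)\subset B_{\delta\eta_0^{n/2}}(x)$ of $x$ mapped diffeomorphically by $f^n_\omega$ onto $B_\delta(f^n_\omega(x))$, with, for all $z,y\in V^\delta_n(x,\omega)$, $|f^{n-k}_\omega(z)-f^{n-k}_\omega(y)|\le\eta_0^{k/2}|f^n_\omega(z)-f^n_\omega(y)|$ for $1\le k\le n$ and $\big|\log\frac{|\det df^n_\omega(z)|}{|\det df^n_\omega(y)|}\big|\le C_6|f^n_\omega(z)-f^n_\omega(y)|^\beta$ (such $\delta_0$ exists). **Reference set.** Given the open set $A\subset\operatorname{supp}\mu$, choose (this is possible by ergodicity) $(\bar x,\bar\omega)\in M\times\Omega$, $N\in\mathbb N$ and $\delta_1,\delta_2>0$ such that $\{f^i_{\bar\omega}(\bar x)\}_{i=0}^N$ is $\frac{\delta_0}2$-dense in $\operatorname{supp}\mu$, stays bounded away from the critical set, and $B_{\delta_2}(f^N_{\bar\omega}(\bar x))\Subset f^{N-j}_{\theta^j(\bar\omega)}(B_{\delta_1}(f^j_{\bar\omega}(\bar x)))\Subset A$ for all $j\le N$. The reference set is $\Delta=B_{\delta_2}(f^N_{\bar\omega}(\bar x))$. For a ball $B$ and $\iota>0$ let $$\mathcal E_\Delta(B)=\Big\{\omega:\exists\, i\le N,\ \exists\,\tilde B\subset B:\ f^i_\omega(\tilde B)\Supset\Delta\ \text{and}\ \inf_{j\le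 i}\inf_{x\in\tilde B}d(f^j_\omega(x),\mathcal C_{\omega_j})>\iota\Big\}.$$ Fix $\iota,\rho>0$ such that $\mathbb P(\mathcal E_\Delta(B))>\rho$ for every ball $B\subset\operatorname{supp}\mu$ with $r(B)\ge\delta_0$ (such constants exist by the choice of $\Delta$ and (H1)-(H2)). **Young times.** Define $N$-sparse hyperbolic times: $\tau_1^N(x,\omega)$ is the smallest $(\eta_0,r_0)$-hyperbolic time for $(x,\omega)$, and for $i>1$, $\tau_i^N(x,\omega)$ is the smallest $(\eta_0,r_0)$-hyperbolic time $n>\tau^N_{i-1}(x,\omega)+N$ (with value $\infty$ if none exists). Let $\mathcal T^N_n(x,\omega)=\{1,\dots,n\}\cap\{\tau^N_i(x,\omega)\}_{i\ge1}$ and $$Y_n^\Delta(x,\omega)=\{i\in\mathcal T_n^N(x,\omega):\theta^i\omega\in\mathcal E_\Delta(B_{\delta_0}(f^i_\omega(x)))\}.$$ *)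

theory Defs
  imports "HOL-Probability.Probability"
begin

section \<open>Compact Riemannian manifolds\<close>

text \<open>
  The manifold is the whole type \<open>'a\<close>, whose metric is the distance of the manifold;
  \<open>real ^ 'k\<close> is the model space, so that \<open>k = CARD('k)\<close>. A chart is a pair of its domain and its
  coordinate map, and \<open>gram c x\<close> is the matrix of the Riemannian metric at the point \<open>x\<close> in the chart \<open>c\<close>.
\<close>

type_synonym ('a, 'k) chart = "'a set \<times> ('a \<Rightarrow> real ^ 'k)"

record ('a, 'k::finite) manifold =
  charts :: "('a, 'k) chart set"
  gram :: "('a, 'k) chart \<Rightarrow> 'a \<Rightarrow> real ^ 'k ^ 'k"

abbreviation chart_inv :: "('a, 'k::finite) chart \<Rightarrow> real ^ 'k \<Rightarrow> 'a" where
  "chart_inv c \<equiv> inv_into (fst c) (snd c)"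

text \<open>\<open>Ck_on n S f\<close>: \<open>f\<close> is of class \<open>C\<^sup>n\<close> on the open set \<open>S\<close> of a Euclidean space.\<close>

primrec Ck_on :: "nat \<Rightarrow> 'v::euclidean_space set \<Rightarrow> ('v \<Rightarrow> 'w::real_normed_vector) \<Rightarrow> bool" where
  "Ck_on 0 S f \<longleftrightarrow> continuous_on S f"
| "Ck_on (Suc n) S f \<longleftrightarrow>
     (\<forall>x\<in>S. f differentiable (at x)) \<and> (\<forall>v. Ck_on n S (\<lambda>x. frechet_derivative f (at x) v))"

definition smooth_on :: "'v::euclidean_space set \<Rightarrow> ('v \<Rightarrow> 'w::real_normed_vector) \<Rightarrow> bool" where
  "smooth_on S f \<longleftrightarrow> (\<forall>n. Ck_on n S f)"

definition smooth_atlas :: "('a::metric_space, 'k::finite) manifold \<Rightarrow> bool" where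
  "smooth_atlas M \<longleftrightarrow>
     (\<Union>c\<in>charts M. fst c) = UNIV \<and>
     (\<forall>c\<in>charts M. open (fst c) \<and> open (snd c ` fst c) \<and>
        homeomorphism (fst c) (snd c ` fst c) (snd c) (chart_inv c)) \<and>
     (\<forall>c\<in>charts M. \<forall>d\<in>charts M. smooth_on (snd c ` (fst c \<inter> fst d)) (snd d \<circ> chart_inv c))"

definition riemannian_metric :: "('a::metric_space, 'k::finite) manifold \<Rightarrow> bool" where
  "riemannian_metric M \<longleftrightarrow>
     (\<forall>c\<in>charts M. smooth_on (snd c ` fst c) (\<lambda>p. gram M c (chart_inv c p)) \<and>
        (\<forall>x\<in>fst c. transpose (gram M c x) = gram M c x \<and>
                    (\<forall>v. v \<noteq> 0 \<longrightarrow> v \<bullet> (gram M c x *v v) > 0))) \<and>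
     (\<forall>c\<in>charts M. \<forall>d\<in>charts M. \<forall>x\<in>fst c \<inter> fst d.
        let J = matrix (frechet_derivative (snd d \<circ> chart_inv c) (at (snd c x)))
        in gram M c x = transpose J ** gram M d x ** J)"

text \<open>
  A tangent vector at \<open>x\<close> is represented by its coordinates in the chart \<open>chart_at M x\<close>. The tangent
  norm and everything derived from it below do not depend on which chart around \<open>x\<close> is selected.
\<close>

definition chart_at :: "('a, 'k::finite) manifold \<Rightarrow> 'a \<Rightarrow> ('a, 'k) chart" where
  "chart_at M x = (SOME c. c \<in> charts M \<and> x \<in> fst c)"

definition gram_at :: "('a, 'k::finite) manifold \<Rightarrow> 'a \<Rightarrow> real ^ 'k ^ 'k" where
  "gram_at M x = gram M (chart_at M x) x"

definition tnorm :: "('a, 'k::finite) manifold \<Rightarrow> 'a \<Rightarrow> real ^ 'k \<Rightarrow> real" where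
  "tnorm M x v = sqrt (v \<bullet> (gram_at M x *v v))"

definition piecewise_C1_path :: "('a::metric_space, 'k::finite) manifold \<Rightarrow> (real \<Rightarrow> 'a) \<Rightarrow> bool" where
  "piecewise_C1_path M \<gamma> \<longleftrightarrow> continuous_on {0..1} \<gamma> \<and>
     (\<forall>c\<in>charts M. \<forall>a b. 0 \<le> a \<and> a \<le> b \<and> b \<le> 1 \<and> \<gamma> ` {a..b} \<subseteq> fst c \<longrightarrow>
        (snd c \<circ> \<gamma>) piecewise_C1_differentiable_on {a..b})"

definition path_length :: "('a, 'k::finite) manifold \<Rightarrow> (real \<Rightarrow> 'a) \<Rightarrow> ennreal" where
  "path_length M \<gamma> =
     (\<integral>\<^sup>+t\<in>{0..1}. ennreal (tnorm M (\<gamma> t)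
         (vector_derivative (snd (chart_at M (\<gamma> t)) \<circ> \<gamma>) (at t))) \<partial>lborel)"

definition paths_between :: "('a::metric_space, 'k::finite) manifold \<Rightarrow> 'a \<Rightarrow> 'a \<Rightarrow> (real \<Rightarrow> 'a) set" where
  "paths_between M x y = {\<gamma>. piecewise_C1_path M \<gamma> \<and> \<gamma> 0 = x \<and> \<gamma> 1 = y}"

text \<open>
  Connectedness is not required: the distance is the geodesic one inside each component, and its
  values between different components are not prescribed.
\<close>

definition compact_riemannian_manifold :: "('a::metric_space, 'k::finite) manifold \<Rightarrow> bool" where
  "compact_riemannian_manifold M \<longleftrightarrow>
     compact (UNIV :: 'a set) \<and> smooth_atlas M \<and> riemannian_metric M \<and>
     (\<forall>x y. paths_between M x y \<noteq> {} \<longrightarrow>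
        ennreal (dist x y) = (INF \<gamma>\<in>paths_between M x y. path_length M \<gamma>))"

definition riemannian_volume :: "('a::metric_space, 'k::finite) manifold \<Rightarrow> 'a measure \<Rightarrow> bool" where
  "riemannian_volume M m \<longleftrightarrow> sets m = sets borel \<and>
     (\<forall>c\<in>charts M. \<forall>S\<in>sets borel. S \<subseteq> fst c \<longrightarrow>
        emeasure m S =
          (\<integral>\<^sup>+p\<in>snd c ` S. ennreal (sqrt (det (gram M c (chart_inv c p)))) \<partial>lborel))"


section \<open>Differentiation of self-maps of the manifold\<close>

definition coord_rep :: "('a, 'k::finite) manifold \<Rightarrow> ('a \<Rightarrow> 'a) \<Rightarrow> 'a \<Rightarrow> real ^ 'k \<Rightarrow> real ^ 'k" where
  "coord_rep M f x = snd (chart_at M (f x)) \<circ> f \<circ> chart_inv (chart_at M x)"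

abbreviation coord :: "('a, 'k::finite) manifold \<Rightarrow> 'a \<Rightarrow> real ^ 'k" where
  "coord M x \<equiv> snd (chart_at M x) x"

definition mdifferentiable :: "('a::metric_space, 'k::finite) manifold \<Rightarrow> ('a \<Rightarrow> 'a) \<Rightarrow> 'a \<Rightarrow> bool" where
  "mdifferentiable M f x \<longleftrightarrow> isCont f x \<and> coord_rep M f x differentiable (at (coord M x))"

definition mderiv :: "('a, 'k::finite) manifold \<Rightarrow> ('a \<Rightarrow> 'a) \<Rightarrow> 'a \<Rightarrow> real ^ 'k \<Rightarrow> real ^ 'k" where
  "mderiv M f x = frechet_derivative (coord_rep M f x) (at (coord M x))"

text \<open>Differentiable with invertible derivative.\<close>

definition regular_at :: "('a::metric_space, 'k::finite) manifold \<Rightarrow> ('a \<Rightarrow> 'a) \<Rightarrow> 'a \<Rightarrow> bool" where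
  "regular_at M f x \<longleftrightarrow> mdifferentiable M f x \<and> bij (mderiv M f x)"

text \<open>
  The operator norm of the inverse of the derivative of \<open>f\<close> at \<open>x\<close>, which is a map from the tangent
  space at \<open>f x\<close> to the one at \<open>x\<close>. The value 0 at the points where the derivative
  does not exist or is not invertible keeps the function measurable; these points never matter.
\<close>

definition inv_deriv_norm :: "('a::metric_space, 'k::finite) manifold \<Rightarrow> ('a \<Rightarrow> 'a) \<Rightarrow> 'a \<Rightarrow> real" where
  "inv_deriv_norm M f x =
     (if regular_at M f x
      then (SUP v\<in>- {0}. tnorm M x (inv (mderiv M f x) v) / tnorm M (f x) v)
      else 0)"

text \<open>
  The absolute value of the determinant of the derivative, with respect to orthonormal bases of the
  two tangent spaces.
\<close>

definition jac :: "('a, 'k::finite) manifold \<Rightarrow> ('a \<Rightarrow> 'a) \<Rightarrow> 'a \<Rightarrow> real" where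
  "jac M f x =
     \<bar>det (matrix (mderiv M f x))\<bar> * sqrt (det (gram_at M (f x))) / sqrt (det (gram_at M x))"

definition C1_at :: "('a::metric_space, 'k::finite) manifold \<Rightarrow> ('a \<Rightarrow> 'a) \<Rightarrow> 'a \<Rightarrow> bool" where
  "C1_at M f x \<longleftrightarrow> isCont f x \<and>
     (\<exists>\<epsilon>>0. \<exists>F' :: real ^ 'k \<Rightarrow> (real ^ 'k) \<Rightarrow>\<^sub>L (real ^ 'k).
        (\<forall>p\<in>ball (coord M x) \<epsilon>. (coord_rep M f x has_derivative blinfun_apply (F' p)) (at p)) \<and>
        continuous_on (ball (coord M x) \<epsilon>) F')"

text \<open>
  \<open>f\<close> is of class \<open>C\<^sup>1\<^sup>+\<^sup>\<beta>\<close> near \<open>x\<close>. The exponent is capped at 1, since a Hoelder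
  condition with exponent larger than 1 on the derivative does not survive a change of charts.
\<close>

definition C1_holder_at :: "('a::metric_space, 'k::finite) manifold \<Rightarrow> real \<Rightarrow> ('a \<Rightarrow> 'a) \<Rightarrow> 'a \<Rightarrow> bool" where
  "C1_holder_at M \<beta> f x \<longleftrightarrow> isCont f x \<and>
     (\<exists>\<epsilon>>0. \<exists>K. \<exists>F' :: real ^ 'k \<Rightarrow> (real ^ 'k) \<Rightarrow>\<^sub>L (real ^ 'k).
        (\<forall>p\<in>ball (coord M x) \<epsilon>. (coord_rep M f x has_derivative blinfun_apply (F' p)) (at p)) \<and>
        (\<forall>p\<in>ball (coord M x) \<epsilon>. \<forall>q\<in>ball (coord M x) \<epsilon>.
           norm (F' p - F' q) \<le> K * dist p q powr min 1 \<beta>))"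

definition diffeo_onto :: "('a::metric_space, 'k::finite) manifold \<Rightarrow> ('a \<Rightarrow> 'a) \<Rightarrow> 'a set \<Rightarrow> 'a set \<Rightarrow> bool" where
  "diffeo_onto M f V W \<longleftrightarrow> bij_betw f V W \<and> (\<forall>x\<in>V. C1_at M f x \<and> regular_at M f x)"


section \<open>The random dynamical system\<close>

definition noise_cube :: "real \<Rightarrow> (real ^ 'k::finite) set" where
  "noise_cube \<sigma> = cbox (\<chi> i. - \<sigma>) (\<chi> i. \<sigma>)"

definition noise :: "real \<Rightarrow> (real ^ 'k::finite) measure" where
  "noise \<sigma> = uniform_measure (restrict_space lborel (noise_cube \<sigma>)) (noise_cube \<sigma>)"

text \<open>The measure \<open>\<P>\<close>; its space is \<open>\<Omega>\<close>, the set of sequences in the cube.\<close>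

definition noise_seq :: "real \<Rightarrow> (nat \<Rightarrow> real ^ 'k::finite) measure" where
  "noise_seq \<sigma> = (\<Pi>\<^sub>M i\<in>UNIV. noise \<sigma>)"

definition shift :: "(nat \<Rightarrow> 'b) \<Rightarrow> nat \<Rightarrow> 'b" where
  "shift \<omega> = (\<lambda>i. \<omega> (Suc i))"

definition rmap :: "('a \<Rightarrow> 'b \<Rightarrow> 'a) \<Rightarrow> (nat \<Rightarrow> 'b) \<Rightarrow> 'a \<Rightarrow> 'a" where
  "rmap g \<omega> x = g x (\<omega> 0)"

primrec rmap_iter :: "('a \<Rightarrow> 'b \<Rightarrow> 'a) \<Rightarrow> nat \<Rightarrow> (nat \<Rightarrow> 'b) \<Rightarrow> 'a \<Rightarrow> 'a" where
  "rmap_iter g 0 \<omega> = id"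
| "rmap_iter g (Suc n) \<omega> = rmap g ((shift ^^ n) \<omega>) \<circ> rmap_iter g n \<omega>"

text \<open>
  The distance to a critical set. The distance to the empty set is 1 by convention, so that (H2)
  then asks for uniform bounds, whereas \<open>infdist x {} = 0\<close> would rule out maps
  without critical points.
\<close>

definition crit_dist :: "'a::metric_space \<Rightarrow> 'a set \<Rightarrow> real" where
  "crit_dist x S = (if S = {} then 1 else infdist x S)"

definition msupp :: "'a::topological_space measure \<Rightarrow> 'a set" where
  "msupp \<mu> = {x. \<forall>U. open U \<longrightarrow> x \<in> U \<longrightarrow> emeasure \<mu> U > 0}"

definition compactly_inside :: "'a::topological_space set \<Rightarrow> 'a set \<Rightarrow> bool" (infix "\<Subset>" 50) where
  "X \<Subset> Y \<longleftrightarrow> closure X \<subseteq> interior Y"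

text \<open>The derivative of \<open>g x\<close> at a noise value \<open>w\<close>; one-sided on the boundary of the cube.\<close>

definition noise_rep :: "('a, 'k::finite) manifold \<Rightarrow> ('a \<Rightarrow> real ^ 'k \<Rightarrow> 'a) \<Rightarrow> 'a \<Rightarrow> real ^ 'k \<Rightarrow> real ^ 'k \<Rightarrow> real ^ 'k" where
  "noise_rep M g x w = snd (chart_at M (g x w)) \<circ> g x"

definition noise_jac :: "('a, 'k::finite) manifold \<Rightarrow> real \<Rightarrow> ('a \<Rightarrow> real ^ 'k \<Rightarrow> 'a) \<Rightarrow> 'a \<Rightarrow> real ^ 'k \<Rightarrow> real" where
  "noise_jac M \<sigma> g x w =
     \<bar>det (matrix (frechet_derivative (noise_rep M g x w) (at w within noise_cube \<sigma>)))\<bar>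
       * sqrt (det (gram_at M (g x w)))"

text \<open>
  Injective of class \<open>C\<^sup>1\<close> with invertible derivative: on the compact cube this makes
  \<open>g x\<close> a diffeomorphism onto its image.
\<close>

definition noise_diffeo :: "('a::metric_space, 'k::finite) manifold \<Rightarrow> real \<Rightarrow> ('a \<Rightarrow> real ^ 'k \<Rightarrow> 'a) \<Rightarrow> 'a \<Rightarrow> bool" where
  "noise_diffeo M \<sigma> g x \<longleftrightarrow>
     inj_on (g x) (noise_cube \<sigma>) \<and> continuous_on (noise_cube \<sigma>) (g x) \<and>
     (\<forall>w\<in>noise_cube \<sigma>. \<exists>\<epsilon>>0. \<exists>F' :: real ^ 'k \<Rightarrow> (real ^ 'k) \<Rightarrow>\<^sub>L (real ^ 'k).
        (\<forall>p\<in>noise_cube \<sigma> \<inter> ball w \<epsilon>.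
           (noise_rep M g x w has_derivative blinfun_apply (F' p)) (at p within noise_cube \<sigma>)) \<and>
        continuous_on (noise_cube \<sigma> \<inter> ball w \<epsilon>) F' \<and> bij (blinfun_apply (F' w)))"


section \<open>The standing hypotheses\<close>

text \<open>
  \<open>C w\<close> is the critical set of \<open>g(\<sqdot>, w)\<close>. The determinant of the derivative in the
  noise variable enters only through its absolute value, since a sign would need an orientation.
\<close>

definition H1 :: "('a::metric_space, 'k::finite) manifold \<Rightarrow> real \<Rightarrow> ('a \<Rightarrow> real ^ 'k \<Rightarrow> 'a) \<Rightarrow> (real ^ 'k \<Rightarrow> 'a set)
    \<Rightarrow> real \<Rightarrow> bool" where
  "H1 M \<sigma> g C \<beta> \<longleftrightarrow> \<beta> > 0 \<and>
     continuous_on (UNIV \<times> noise_cube \<sigma>) (\<lambda>(x, w). g x w) \<and>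
     (\<forall>w\<in>noise_cube \<sigma>.
        C w = {x. \<not> regular_at M (\<lambda>y. g y w) x} \<and>
        (\<forall>x\<in>- C w. C1_holder_at M \<beta> (\<lambda>y. g y w) x)) \<and>
     (\<forall>x. noise_diffeo M \<sigma> g x) \<and>
     (\<exists>K \<gamma>. \<gamma> > 0 \<and>
        (\<forall>x y. \<forall>w\<in>noise_cube \<sigma>. \<forall>w'\<in>noise_cube \<sigma>.
           \<bar>noise_jac M \<sigma> g x w - noise_jac M \<sigma> g y w'\<bar> \<le> K * dist (x, w) (y, w') powr \<gamma>)) \<and>
     (\<exists>c\<^sub>1 c\<^sub>2. c\<^sub>1 > 0 \<and> c\<^sub>2 > 0 \<and>
        (\<forall>x. \<forall>w\<in>noise_cube \<sigma>. c\<^sub>1 \<ge> noise_jac M \<sigma> g x w \<and> noise_jac M \<sigma> g x w \<ge> c\<^sub>2))"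

definition H2 :: "('a::metric_space, 'k::finite) manifold \<Rightarrow> 'a measure \<Rightarrow> real \<Rightarrow> ('a \<Rightarrow> real ^ 'k \<Rightarrow> 'a)
    \<Rightarrow> (real ^ 'k \<Rightarrow> 'a set) \<Rightarrow> real \<Rightarrow> real \<Rightarrow> real \<Rightarrow> bool" where
  "H2 M m \<sigma> g C B \<alpha> \<beta> \<longleftrightarrow> B > 1 \<and> \<alpha> > 0 \<and>
     (\<forall>w\<in>noise_cube \<sigma>.
        closed (C w) \<and> C w \<in> null_sets m \<and>
        (\<forall>x\<in>- C w. \<forall>v. v \<noteq> 0 \<longrightarrow>
           (1 / B) * crit_dist x (C w) powr \<alpha>
             \<le> tnorm M (g x w) (mderiv M (\<lambda>y. g y w) x v) / tnorm M x v \<and>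
           tnorm M (g x w) (mderiv M (\<lambda>y. g y w) x v) / tnorm M x v
             \<le> B * crit_dist x (C w) powr (- \<alpha>)) \<and>
        (\<forall>x\<in>- C w. \<forall>y\<in>- C w. dist x y \<le> crit_dist x (C w) / 2 \<longrightarrow>
           \<bar>ln (inv_deriv_norm M (\<lambda>z. g z w) x) - ln (inv_deriv_norm M (\<lambda>z. g z w) y)\<bar>
             \<le> B / crit_dist x (C w) powr \<alpha> * dist x y powr \<beta> \<and>
           \<bar>ln (jac M (\<lambda>z. g z w) x) - ln (jac M (\<lambda>z. g z w) y)\<bar>
             \<le> B / crit_dist x (C w) powr \<alpha> * dist x y powr \<beta>)) \<and>
     (\<forall>w\<in>noise_cube \<sigma>. \<forall>\<epsilon>>0. \<exists>\<delta>>0. \<forall>w'\<in>noise_cube \<sigma>.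
        dist w' w < \<delta> \<longrightarrow> C w' \<subseteq> (\<Union>y\<in>C w. ball y \<epsilon>))"

definition transition :: "real \<Rightarrow> ('a::metric_space \<Rightarrow> real ^ 'k::finite \<Rightarrow> 'a) \<Rightarrow> 'a \<Rightarrow> 'a measure" where
  "transition \<sigma> g x = distr (noise \<sigma>) borel (g x)"

definition stationary :: "real \<Rightarrow> ('a::metric_space \<Rightarrow> real ^ 'k::finite \<Rightarrow> 'a) \<Rightarrow> 'a measure \<Rightarrow> bool" where
  "stationary \<sigma> g \<mu> \<longleftrightarrow> sets \<mu> = sets borel \<and> prob_space \<mu> \<and>
     (\<forall>S\<in>sets borel. emeasure \<mu> S = (\<integral>\<^sup>+x. emeasure (transition \<sigma> g x) S \<partial>\<mu>))"

definition ergodic_stationary :: "real \<Rightarrow> ('a::metric_space \<Rightarrow> real ^ 'k::finite \<Rightarrow> 'a) \<Rightarrow> 'a measure \<Rightarrow> bool" where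
  "ergodic_stationary \<sigma> g \<mu> \<longleftrightarrow> stationary \<sigma> g \<mu> \<and>
     (\<forall>S\<in>sets borel. (AE x in \<mu>. emeasure (transition \<sigma> g x) S = indicator S x) \<longrightarrow>
        emeasure \<mu> S = 0 \<or> emeasure \<mu> S = 1)"

definition H3 :: "('a::metric_space, 'k::finite) manifold \<Rightarrow> real \<Rightarrow> ('a \<Rightarrow> real ^ 'k \<Rightarrow> 'a) \<Rightarrow> 'a measure \<Rightarrow> bool" where
  "H3 M \<sigma> g \<mu> \<longleftrightarrow> ergodic_stationary \<sigma> g \<mu> \<and>
     integrable (\<mu> \<Otimes>\<^sub>M noise_seq \<sigma>) (\<lambda>(x, \<omega>). ln (inv_deriv_norm M (rmap g \<omega>) x)) \<and>
     - (\<integral>(x, \<omega>). ln (inv_deriv_norm M (rmap g \<omega>) x) \<partial>(\<mu> \<Otimes>\<^sub>M noise_seq \<sigma>)) > 0"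

text \<open>
  The measure \<open>m\<^sup>* \<otimes> \<P>\<close>. Upper bounds on it are stated with its outer measure: this is the
  measure itself on measurable sets, whereas \<open>emeasure\<close> would be 0 on a set
  that failed to be measurable.
\<close>

definition ref_measure :: "'a::metric_space measure \<Rightarrow> 'a measure \<Rightarrow> real \<Rightarrow> ('a \<times> (nat \<Rightarrow> real ^ 'k::finite)) measure" where
  "ref_measure m \<mu> \<sigma> = restrict_space m (msupp \<mu>) \<Otimes>\<^sub>M noise_seq \<sigma>"

definition H4 :: "'a::metric_space measure \<Rightarrow> 'a measure \<Rightarrow> real \<Rightarrow> (real ^ 'k::finite \<Rightarrow> 'a set) \<Rightarrow> bool" where
  "H4 m \<mu> \<sigma> C \<longleftrightarrow>
     (\<exists>C\<^sub>1>0. \<exists>\<delta>'>0. \<forall>\<delta>. 0 < \<delta> \<and> \<delta> < \<delta>' \<longrightarrow>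
        outer_measure_of (ref_measure m \<mu> \<sigma>)
          {(x, \<omega>). x \<in> msupp \<mu> \<and> \<omega> \<in> space (noise_seq \<sigma>) \<and> crit_dist x (C (\<omega> 0)) \<le> \<delta>}
        \<le> ennreal (C\<^sub>1 * \<delta>))"


section \<open>Hyperbolic times\<close>

definition trunc_dist :: "real \<Rightarrow> 'a::metric_space \<Rightarrow> 'a set \<Rightarrow> real" where
  "trunc_dist r x S = (if crit_dist x S > r then 1 else crit_dist x S)"

text \<open>Times are positive: for \<open>n = 0\<close> the defining condition would be void.\<close>

definition hyperbolic_time :: "('a::metric_space, 'k::finite) manifold \<Rightarrow> ('a \<Rightarrow> real ^ 'k \<Rightarrow> 'a) \<Rightarrow> (real ^ 'k \<Rightarrow> 'a set)
    \<Rightarrow> real \<Rightarrow> real \<Rightarrow> real \<Rightarrow> 'a \<Rightarrow> (nat \<Rightarrow> real ^ 'k) \<Rightarrow> nat \<Rightarrow> bool" where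
  "hyperbolic_time M g C b \<eta> r x \<omega> n \<longleftrightarrow> 0 < n \<and>
     (\<forall>k<n. (\<Prod>i=k..<n. inv_deriv_norm M (rmap g ((shift ^^ i) \<omega>)) (rmap_iter g i \<omega> x)) < \<eta> ^ (n - k) \<and>
             trunc_dist r (rmap_iter g k \<omega> x) (C (\<omega> k)) > \<eta> powr (b * real (n - k)))"

definition hyperbolic_times :: "('a::metric_space, 'k::finite) manifold \<Rightarrow> ('a \<Rightarrow> real ^ 'k \<Rightarrow> 'a) \<Rightarrow> (real ^ 'k \<Rightarrow> 'a set)
    \<Rightarrow> real \<Rightarrow> real \<Rightarrow> real \<Rightarrow> 'a \<Rightarrow> (nat \<Rightarrow> real ^ 'k) \<Rightarrow> nat \<Rightarrow> nat set" where
  "hyperbolic_times M g C b \<eta> r x \<omega> n = {j \<in> {1..n}. hyperbolic_time M g C b \<eta> r x \<omega> j}"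

definition hyperbolic_times_frequent :: "('a::metric_space, 'k::finite) manifold \<Rightarrow> 'a measure \<Rightarrow> 'a measure \<Rightarrow> real
    \<Rightarrow> ('a \<Rightarrow> real ^ 'k \<Rightarrow> 'a) \<Rightarrow> (real ^ 'k \<Rightarrow> 'a set) \<Rightarrow> real \<Rightarrow> real \<Rightarrow> real \<Rightarrow> bool" where
  "hyperbolic_times_frequent M m \<mu> \<sigma> g C b \<eta> r \<longleftrightarrow>
     (\<exists>\<theta>\<^sub>0 C\<^sub>7 \<gamma>\<^sub>1. 0 < \<theta>\<^sub>0 \<and> \<theta>\<^sub>0 < 1 \<and> C\<^sub>7 \<ge> 1 \<and> \<gamma>\<^sub>1 > 0 \<and>
        (\<forall>n. outer_measure_of (ref_measure m \<mu> \<sigma>)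
               {(x, \<omega>). x \<in> msupp \<mu> \<and> \<omega> \<in> space (noise_seq \<sigma>) \<and>
                  real (card (hyperbolic_times M g C b \<eta> r x \<omega> n)) \<le> \<theta>\<^sub>0 * real n}
             \<le> ennreal (C\<^sub>7 * exp (- \<gamma>\<^sub>1 * real n))))"

definition hyperbolic_scale :: "('a::metric_space, 'k::finite) manifold \<Rightarrow> real
    \<Rightarrow> ('a \<Rightarrow> real ^ 'k \<Rightarrow> 'a) \<Rightarrow> (real ^ 'k \<Rightarrow> 'a set) \<Rightarrow> real \<Rightarrow> real \<Rightarrow> real \<Rightarrow> real \<Rightarrow> real \<Rightarrow> bool" where
  "hyperbolic_scale M \<sigma> g C \<beta> b \<eta> r \<delta>\<^sub>0 \<longleftrightarrow> \<delta>\<^sub>0 > 0 \<and>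
     (\<exists>C\<^sub>6>0. \<forall>x. \<forall>\<omega>\<in>space (noise_seq \<sigma>). \<forall>n \<delta>.
        hyperbolic_time M g C b \<eta> r x \<omega> n \<and> 0 < \<delta> \<and> \<delta> \<le> \<delta>\<^sub>0 \<longrightarrow>
        (\<exists>V. open V \<and> x \<in> V \<and> V \<subseteq> ball x (\<delta> * \<eta> powr (real n / 2)) \<and>
           diffeo_onto M (rmap_iter g n \<omega>) V (ball (rmap_iter g n \<omega> x) \<delta>) \<and>
           (\<forall>z\<in>V. \<forall>y\<in>V.
              (\<forall>k\<in>{1..n}. dist (rmap_iter g (n - k) \<omega> z) (rmap_iter g (n - k) \<omega> y)
                 \<le> \<eta> powr (real k / 2) * dist (rmap_iter g n \<omega> z) (rmap_iter g n \<omega> y)) \<and>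
              \<bar>ln (jac M (rmap_iter g n \<omega>) z / jac M (rmap_iter g n \<omega>) y)\<bar>
                 \<le> C\<^sub>6 * dist (rmap_iter g n \<omega> z) (rmap_iter g n \<omega> y) powr \<beta>)))"


section \<open>The reference set and Young times\<close>

definition reference_choice :: "real \<Rightarrow> ('a::metric_space \<Rightarrow> real ^ 'k::finite \<Rightarrow> 'a) \<Rightarrow> (real ^ 'k \<Rightarrow> 'a set) \<Rightarrow> 'a measure
    \<Rightarrow> real \<Rightarrow> 'a set \<Rightarrow> 'a \<Rightarrow> (nat \<Rightarrow> real ^ 'k) \<Rightarrow> nat \<Rightarrow> real \<Rightarrow> real \<Rightarrow> bool" where
  "reference_choice \<sigma> g C \<mu> \<delta>\<^sub>0 A x \<omega> N \<delta>\<^sub>1 \<delta>\<^sub>2 \<longleftrightarrow>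
     \<omega> \<in> space (noise_seq \<sigma>) \<and> \<delta>\<^sub>1 > 0 \<and> \<delta>\<^sub>2 > 0 \<and>
     (\<forall>y\<in>msupp \<mu>. \<exists>i\<le>N. dist y (rmap_iter g i \<omega> x) < \<delta>\<^sub>0 / 2) \<and>
     (\<exists>\<kappa>>0. \<forall>i\<le>N. crit_dist (rmap_iter g i \<omega> x) (C (\<omega> i)) \<ge> \<kappa>) \<and>
     (\<forall>j\<le>N. ball (rmap_iter g N \<omega> x) \<delta>\<^sub>2
               \<Subset> rmap_iter g (N - j) ((shift ^^ j) \<omega>) ` ball (rmap_iter g j \<omega> x) \<delta>\<^sub>1 \<and>
             rmap_iter g (N - j) ((shift ^^ j) \<omega>) ` ball (rmap_iter g j \<omega> x) \<delta>\<^sub>1 \<Subset> A)"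

definition reach_event :: "real \<Rightarrow> ('a::metric_space \<Rightarrow> real ^ 'k::finite \<Rightarrow> 'a) \<Rightarrow> (real ^ 'k \<Rightarrow> 'a set)
    \<Rightarrow> nat \<Rightarrow> real \<Rightarrow> 'a set \<Rightarrow> 'a set \<Rightarrow> (nat \<Rightarrow> real ^ 'k) set" where
  "reach_event \<sigma> g C N \<iota> \<Delta> B = {\<omega> \<in> space (noise_seq \<sigma>).
     \<exists>i\<le>N. \<exists>B'\<subseteq>B. \<Delta> \<Subset> rmap_iter g i \<omega> ` B' \<and>
       (INF j\<in>{..i}. INF x\<in>B'. crit_dist (rmap_iter g j \<omega> x) (C (\<omega> j))) > \<iota>}"

definition reach_likely :: "real \<Rightarrow> ('a::metric_space \<Rightarrow> real ^ 'k::finite \<Rightarrow> 'a) \<Rightarrow> (real ^ 'k \<Rightarrow> 'a set) \<Rightarrow> 'a measure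
    \<Rightarrow> nat \<Rightarrow> real \<Rightarrow> real \<Rightarrow> real \<Rightarrow> 'a set \<Rightarrow> bool" where
  "reach_likely \<sigma> g C \<mu> N \<delta>\<^sub>0 \<iota> \<rho> \<Delta> \<longleftrightarrow> \<iota> > 0 \<and> \<rho> > 0 \<and>
     (\<forall>z s. s \<ge> \<delta>\<^sub>0 \<and> ball z s \<subseteq> msupp \<mu> \<longrightarrow>
        measure (noise_seq \<sigma>) (reach_event \<sigma> g C N \<iota> \<Delta> (ball z s)) > \<rho>)"

text \<open>
  \<open>sparse_time \<dots> i\<close> is the \<open>(i+1)\<close>-st \<open>N\<close>-sparse hyperbolic time; the infimum of the
  empty set of extended naturals is \<open>\<infinity>\<close>.
\<close>

primrec sparse_time :: "('a::metric_space, 'k::finite) manifold \<Rightarrow> ('a \<Rightarrow> real ^ 'k \<Rightarrow> 'a) \<Rightarrow> (real ^ 'k \<Rightarrow> 'a set)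
    \<Rightarrow> real \<Rightarrow> real \<Rightarrow> real \<Rightarrow> nat \<Rightarrow> 'a \<Rightarrow> (nat \<Rightarrow> real ^ 'k) \<Rightarrow> nat \<Rightarrow> enat" where
  "sparse_time M g C b \<eta> r N x \<omega> 0 = Inf {enat n | n. hyperbolic_time M g C b \<eta> r x \<omega> n}"
| "sparse_time M g C b \<eta> r N x \<omega> (Suc i) =
     Inf {enat n | n. hyperbolic_time M g C b \<eta> r x \<omega> n \<and>
                      enat n > sparse_time M g C b \<eta> r N x \<omega> i + enat N}"

definition sparse_times :: "('a::metric_space, 'k::finite) manifold \<Rightarrow> ('a \<Rightarrow> real ^ 'k \<Rightarrow> 'a) \<Rightarrow> (real ^ 'k \<Rightarrow> 'a set)
    \<Rightarrow> real \<Rightarrow> real \<Rightarrow> real \<Rightarrow> nat \<Rightarrow> 'a \<Rightarrow> (nat \<Rightarrow> real ^ 'k) \<Rightarrow> nat \<Rightarrow> nat set" where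
  "sparse_times M g C b \<eta> r N x \<omega> n =
     {j \<in> {1..n}. \<exists>i. enat j = sparse_time M g C b \<eta> r N x \<omega> i}"

definition young_times :: "('a::metric_space, 'k::finite) manifold \<Rightarrow> real \<Rightarrow> ('a \<Rightarrow> real ^ 'k \<Rightarrow> 'a) \<Rightarrow> (real ^ 'k \<Rightarrow> 'a set)
    \<Rightarrow> real \<Rightarrow> real \<Rightarrow> real \<Rightarrow> nat \<Rightarrow> real \<Rightarrow> real \<Rightarrow> 'a set \<Rightarrow> 'a \<Rightarrow> (nat \<Rightarrow> real ^ 'k) \<Rightarrow> nat \<Rightarrow> nat set" where
  "young_times M \<sigma> g C b \<eta> r N \<delta>\<^sub>0 \<iota> \<Delta> x \<omega> n =
     {i \<in> sparse_times M g C b \<eta> r N x \<omega> n.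
        (shift ^^ i) \<omega> \<in> reach_event \<sigma> g C N \<iota> \<Delta> (ball (rmap_iter g i \<omega> x) \<delta>\<^sub>0)}"

end

theory Submission
  imports Defs
begin

text \<open>
  At a sparse hyperbolic time \<open>i\<close> whose ball \<open>ball (f\<^sup>i x) \<delta>\<^sub>0\<close> lies in the support of \<open>\<mu>\<close>, the event
  that \<open>i\<close> is a Young time has probability at least \<open>\<rho>\<close> and depends on the noise coordinates
  \<open>i, \<dots>, i + N\<close> only, whereas being such a time depends on the coordinates before \<open>i\<close>. Along a residue
  class modulo \<open>N + 1\<close> these are adapted trials with success probability at least \<open>\<rho>\<close>, so that
  linearly many trials with few successes are exponentially unlikely; and some residue class contains
  linearly many trials, because hyperbolic times have positive frequency.

  Two points need care. A hyperbolic ball around a point near the boundary of the support may leave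
  the support. However, as soon as one noise value stays away from the boundary of the cube, the orbit
  enters the support to a uniform depth (invariance of domain), and backward contraction then puts the balls
  of all much later hyperbolic times inside the support; that this has not happened before time
  \<open>\<epsilon> n\<close> is exponentially unlikely. Secondly, the reach event need not be jointly measurable in the
  centre of the ball and the noise. By Brouwer's theorem it is open in the noise and stable under
  shrinking the ball, so compactness replaces it by finitely many measurable events.
\<close>

section \<open>Greedy selection and adaptive trials\<close>

text \<open>The selected times are stopping times, and an induction over successive selected times
  would call for conditioning at random times. Instead, every deterministic time of a residue class
  is asked whether a trial takes place there; if not, it contributes the factor 1, and Fubini for
  spliced noise sequences replaces conditional expectation. This requires that selection at time
  \<open>j\<close> be decided by the noise before \<open>j\<close>. The recursion over the index of
  a sparse time hides that, hence its reformulation as a greedy rule in the time variable.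

  The budget of \<open>\<theta>\<^sub>0 * n\<close> hyperbolic times is halved. One half pays for
  the stretch during which the balls are not yet known to lie in the support; the other is divided
  by \<open>N + 1\<close> twice, for sparseness and for the choice of a residue class. The value of
  \<open>\<theta>\<^sub>1\<close> is then dictated by the exponential rate that the trials provide.

  Joint measurability of hyperbolic times comes from the integrability of the logarithm of the
  inverse derivative norm in (H3), together with semi-continuity of the critical sets.\<close>

lemma Inf_enat_in:
  assumes "enat j = Inf {enat n | n. P n}" shows "P j"
proof -
  have "{enat n | n. P n} \<noteq> {}"
  proof
    assume "{enat n | n. P n} = {}"
    with assms have "enat j = Inf {}" by metis
    then show False by (simp add: top_enat_def)
  qed
  then have "Inf {enat n | n. P n} \<in> {enat n | n. P n}"
    by (metis (no_types, lifting) ex_in_conv wellorder_InfI)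
  with assms show ?thesis by auto
qed

text \<open>Trades the recursion over the index \<open>i\<close> for a rule in the time
  \<open>j\<close> alone: an admissible time is selected unless a selected time at most
  \<open>N\<close> earlier blocks it. Dependence on the past and measurability then follow by strong
  induction on \<open>j\<close>. The equivalence rests on consecutive selected times being more than
  \<open>N\<close> apart.\<close>

lemma greedy_selection_iff:
  fixes \<tau> :: "nat \<Rightarrow> enat" and P :: "nat \<Rightarrow> bool"
  assumes \<tau>0: "\<tau> 0 = Inf {enat n | n. P n}"
    and \<tau>S: "\<And>i. \<tau> (Suc i) = Inf {enat n | n. P n \<and> enat n > \<tau> i + enat N}"
  shows "(\<exists>i. enat j = \<tau> i) \<longleftrightarrow> P j \<and> (\<forall>l<j. j \<le> l + N \<longrightarrow> \<not> (\<exists>i. enat l = \<tau> i))"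
proof -
  have gap: "\<tau> i + enat N < \<tau> (Suc i)" if fin: "\<tau> (Suc i) \<noteq> \<infinity>" for i
  proof -
    obtain l where l: "\<tau> (Suc i) = enat l" using fin by (cases "\<tau> (Suc i)") simp_all
    with Inf_enat_in[of l "\<lambda>n. P n \<and> enat n > \<tau> i + enat N"] show ?thesis
      by (simp add: \<tau>S)
  qed
  have gap_le: "\<tau> i + enat N \<le> \<tau> (Suc i)" for i
    using gap[of i] by (cases "\<tau> (Suc i)") auto
  have mono1: "\<tau> i \<le> \<tau> (Suc i)" for i
    using order_trans[OF _ gap_le[of i]] by simp
  have mono: "i \<le> i' \<Longrightarrow> \<tau> i \<le> \<tau> i'" for i i'
    by (rule lift_Suc_mono_le[of \<tau>]) (auto intro: mono1)
  have ge: "enat i \<le> \<tau> i" for i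
  proof (induction i)
    case (Suc i)
    show ?case
    proof (cases "\<tau> (Suc i)")
      case (enat l)
      then obtain l' where "\<tau> i = enat l'"
        using mono1[of i] by (cases "\<tau> i") auto
      with gap[of i] Suc enat show ?thesis by simp
    qed simp
  qed (simp add: zero_enat_def[symmetric])
  have PI: "P j" if "enat j = \<tau> i" for i j
  proof (cases i)
    case 0 then show ?thesis using that \<tau>0 Inf_enat_in[of j P] by simp
  next
    case (Suc i')
    then show ?thesis
      using that Inf_enat_in[of j "\<lambda>n. P n \<and> enat n > \<tau> i' + enat N"] by (simp add: \<tau>S)
  qed
  show ?thesis
  proof
    assume "\<exists>i. enat j = \<tau> i"
    then obtain i where i: "enat j = \<tau> i" ..
    have "False" if l: "l < j" "j \<le> l + N" "enat l = \<tau> i'" for l i'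
    proof (cases "i' < i")
      case True
      then have "\<tau> (Suc i') \<le> \<tau> i" by (intro mono) simp
      with i have "\<tau> (Suc i') \<le> enat j" by simp
      then have "\<tau> i' + enat N < enat j"
        using gap[of i'] by (cases "\<tau> (Suc i')") (auto intro: less_le_trans)
      with l show False by (metis enat_ord_simps(2) not_le plus_enat_simps(1))
    next
      case False
      then have "\<tau> i \<le> \<tau> i'" by (intro mono) simp
      with l i show False by (metis enat_ord_simps(1) not_le)
    qed
    with PI[OF i] show "P j \<and> (\<forall>l<j. j \<le> l + N \<longrightarrow> \<not> (\<exists>i. enat l = \<tau> i))" by blast
  next
    assume *: "P j \<and> (\<forall>l<j. j \<le> l + N \<longrightarrow> \<not> (\<exists>i. enat l = \<tau> i))"
    \<comment> \<open>The first index whose value reaches \<open>j\<close>; it exists since \<tau>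
      dominates the identity. Its predecessor, if any, has a value \<open>l < j\<close>, and the
      absence of a block gives \<open>l + N < j\<close>, so that \<open>j\<close> takes part in the
      infimum defining \<open>\<tau> i\<close>.\<close>
    define i where "i = (LEAST i. enat j \<le> \<tau> i)"
    have i: "enat j \<le> \<tau> i"
      unfolding i_def by (rule LeastI[of _ j]) (rule ge)
    have "\<tau> i \<le> enat j"
    proof (cases i)
      case 0
      then show ?thesis using * by (auto simp: \<tau>0 intro!: Inf_lower)
    next
      case (Suc i')
      then have "\<not> enat j \<le> \<tau> i'"
        unfolding i_def using not_less_Least by (metis lessI)
      then obtain l where l: "\<tau> i' = enat l" "l < j"
        by (cases "\<tau> i'") auto
      with * have "\<not> j \<le> l + N" by metis
      then show ?thesis
        using * l unfolding Suc \<tau>S by (intro Inf_lower) auto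
    qed
    with i have "enat j = \<tau> i" by (rule antisym)
    then show "\<exists>i. enat j = \<tau> i" ..
  qed
qed

lemma card_le_gap_times_selected:
  assumes "finite S" "\<And>j. j \<in> H \<Longrightarrow> \<exists>l\<in>S. l \<le> j \<and> j \<le> l + N"
  shows "card H \<le> (N + 1) * card S"
proof -
  have "H \<subseteq> (\<Union>l\<in>S. {l..l + N})" using assms(2) by fastforce
  then have "card H \<le> card (\<Union>l\<in>S. {l..l + N})"
    by (intro card_mono) (use assms(1) in auto)
  also have "\<dots> \<le> (\<Sum>l\<in>S. card {l..l + N})" using assms(1) by (rule card_UN_le)
  finally show ?thesis by (simp add: mult.commute)
qed

section \<open>Supermartingale bound for adapted trials\<close>

context sequence_space
begin

lemma space_S: "space S = {\<omega>. \<forall>i. \<omega> i \<in> space M}"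
  by (auto simp: space_PiM PiE_def Pi_def)

text \<open>
  Each trial contributes a factor \<open>1/q\<close> times \<open>1/2\<close> in case of success, which has conditional
  expectation at most 1; the product of the factors is therefore a supermartingale.
\<close>

lemma nn_integral_trials_le_1:
  fixes T U :: "nat \<Rightarrow> (nat \<Rightarrow> 'a) \<Rightarrow> bool" and t :: "nat \<Rightarrow> nat" and \<rho> :: real
  defines "q \<equiv> 1 - \<rho> / 2"
  defines "Z \<equiv> \<lambda>k \<omega>. if T k \<omega> then (if U k \<omega> then 1 / 2 else 1) / q else 1"
  assumes \<rho>: "0 < \<rho>" "\<rho> \<le> 1" and t: "mono t"
    and T_meas[measurable]: "\<And>k. Measurable.pred S (T k)"
    and U_meas[measurable]: "\<And>k. Measurable.pred S (U k)"
    and T_cong: "\<And>k \<omega> \<omega>'. \<omega> \<in> space S \<Longrightarrow> \<omega>' \<in> space S \<Longrightarrow> (\<And>j. j < t k \<Longrightarrow> \<omega> j = \<omega>' j) \<Longrightarrow> T k \<omega> = T k \<omega>'"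
    and U_cong: "\<And>k \<omega> \<omega>'. \<omega> \<in> space S \<Longrightarrow> \<omega>' \<in> space S \<Longrightarrow> (\<And>j. j < t (Suc k) \<Longrightarrow> \<omega> j = \<omega>' j) \<Longrightarrow>
                   T k \<omega> \<Longrightarrow> U k \<omega> = U k \<omega>'"
    and cond: "\<And>k \<omega>. \<omega> \<in> space S \<Longrightarrow> T k \<omega> \<Longrightarrow>
                 \<P>(\<omega>' in S. U k (comb_seq (t k) \<omega> \<omega>')) \<ge> \<rho>"
  shows "(\<integral>\<^sup>+\<omega>. ennreal (\<Prod>k<K. Z k \<omega>) \<partial>S) \<le> 1"
proof (induction K)
  case 0
  show ?case by (simp add: emeasure_space_1)
next
  case (Suc K)
  have q: "0 < q" using \<rho> by (simp add: q_def)
  have Z_meas[measurable]: "Z k \<in> borel_measurable S" for k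
    unfolding Z_def by measurable
  have Z_pos: "0 \<le> Z k \<omega>" for k \<omega> using q by (simp add: Z_def)
  have comb_space: "comb_seq i \<omega> \<omega>' \<in> space S" if "\<omega> \<in> space S" "\<omega>' \<in> space S" for i \<omega> \<omega>'
    using that by (auto simp: space_S comb_seq_def)
  let ?c = "comb_seq (t K)"
  \<comment> \<open>\<open>comb_seq (t K)\<close> keeps the coordinates of \<open>\<omega>\<close>
    below \<open>t K\<close> and continues with \<open>\<omega>'\<close>. The factors with
    \<open>k < K\<close> are decided below \<open>t (Suc k) \<le> t K\<close> and do not see the
    splice.\<close>
  have past: "(\<Prod>k<K. Z k (?c \<omega> \<omega>')) = (\<Prod>k<K. Z k \<omega>)"
    if w: "\<omega> \<in> space S" "\<omega>' \<in> space S" for \<omega> \<omega>'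
  proof (rule prod.cong[OF refl])
    fix k assume "k \<in> {..<K}"
    then have "t k \<le> t (Suc k)" "t (Suc k) \<le> t K" using t by (auto simp: mono_def)
    then have "T k (?c \<omega> \<omega>') = T k \<omega>"
      using w by (intro T_cong comb_space) (auto simp: comb_seq_less)
    moreover have "T k \<omega> \<Longrightarrow> U k (?c \<omega> \<omega>') = U k \<omega>"
      using w \<open>t (Suc k) \<le> t K\<close> by (intro U_cong[symmetric] comb_space) (auto simp: comb_seq_less)
    ultimately show "Z k (?c \<omega> \<omega>') = Z k \<omega>" by (simp add: Z_def)
  qed
  have fut: "(\<integral>\<^sup>+\<omega>'. ennreal (Z K (?c \<omega> \<omega>')) \<partial>S) \<le> 1" if w: "\<omega> \<in> space S" for \<omega>
  proof (cases "T K \<omega>")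
    case False
    then have "T K (?c \<omega> \<omega>') = False" if "\<omega>' \<in> space S" for \<omega>'
      using T_cong[of "?c \<omega> \<omega>'" \<omega> K] w that by (auto simp: comb_seq_less comb_space)
    then have "(\<integral>\<^sup>+\<omega>'. ennreal (Z K (?c \<omega> \<omega>')) \<partial>S) = (\<integral>\<^sup>+\<omega>'. 1 \<partial>S)"
      by (intro nn_integral_cong) (simp add: Z_def)
    then show ?thesis by (simp add: emeasure_space_1)
  next
    case True
    then have TK: "T K (?c \<omega> \<omega>')" if "\<omega>' \<in> space S" for \<omega>'
      using T_cong[of "?c \<omega> \<omega>'" \<omega> K] w that by (auto simp: comb_seq_less comb_space)
    have comb_meas[measurable]: "?c \<omega> \<in> S \<rightarrow>\<^sub>M S"
      using w by measurable
    let ?A = "{\<omega>' \<in> space S. U K (?c \<omega> \<omega>')}"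
    have A[measurable]: "?A \<in> sets S" by measurable
    have "(\<integral>\<^sup>+\<omega>'. ennreal (Z K (?c \<omega> \<omega>')) \<partial>S) =
        (\<integral>\<^sup>+\<omega>'. ennreal (1 / (2 * q)) * indicator ?A \<omega>' + ennreal (1 / q) * indicator (space S - ?A) \<omega>' \<partial>S)"
      by (intro nn_integral_cong) (simp add: Z_def TK indicator_def)
    also have "\<dots> = ennreal (1 / (2 * q)) * emeasure S ?A + ennreal (1 / q) * emeasure S (space S - ?A)"
      by (subst nn_integral_add) (simp_all add: nn_integral_cmult_indicator)
    also have "\<dots> = ennreal (1 / (2 * q) * prob ?A + 1 / q * (1 - prob ?A))"
      using q by (simp add: emeasure_eq_measure prob_compl flip: ennreal_mult ennreal_plus)
    \<comment> \<open>With success probability at least \<rho> the numerator is at most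
      \<open>1 - \<rho> / 2\<close>; this is where the value of \<open>q\<close> comes from.\<close>
    also have "1 / (2 * q) * prob ?A + 1 / q * (1 - prob ?A) = (1 - prob ?A / 2) / q"
      using q by (simp add: field_simps)
    also have "ennreal ((1 - prob ?A / 2) / q) \<le> 1"
      using cond[OF w True] q by (simp add: q_def divide_le_eq flip: ennreal_1)
    finally show ?thesis .
  qed
  \<comment> \<open>Splicing two independent sequences at \<open>t K\<close> gives a sequence with
    the same law, so Fubini plays the part of conditioning on the coordinates before
    \<open>t K\<close>.\<close>
  have "(\<integral>\<^sup>+\<omega>. ennreal (\<Prod>k<Suc K. Z k \<omega>) \<partial>S) =
      (\<integral>\<^sup>+\<omega>. ennreal (\<Prod>k<Suc K. Z k \<omega>) \<partial>distr (S \<Otimes>\<^sub>M S) S (\<lambda>(\<omega>, \<omega>'). ?c \<omega> \<omega>'))"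
    by (simp add: PiM_comb_seq)
  also have "\<dots> = (\<integral>\<^sup>+p. ennreal (\<Prod>k<Suc K. Z k (?c (fst p) (snd p))) \<partial>(S \<Otimes>\<^sub>M S))"
    by (subst nn_integral_distr) (simp_all add: case_prod_beta')
  also have "\<dots> = (\<integral>\<^sup>+\<omega>. (\<integral>\<^sup>+\<omega>'. ennreal (\<Prod>k<Suc K. Z k (?c \<omega> \<omega>')) \<partial>S) \<partial>S)"
    by (subst P.nn_integral_fst[symmetric]) simp_all
  also have "\<dots> = (\<integral>\<^sup>+\<omega>. (\<integral>\<^sup>+\<omega>'. ennreal (\<Prod>k<K. Z k \<omega>) * ennreal (Z K (?c \<omega> \<omega>')) \<partial>S) \<partial>S)"
    by (intro nn_integral_cong) (simp add: past Z_pos prod_nonneg ennreal_mult)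
  also have "\<dots> = (\<integral>\<^sup>+\<omega>. ennreal (\<Prod>k<K. Z k \<omega>) * (\<integral>\<^sup>+\<omega>'. ennreal (Z K (?c \<omega> \<omega>')) \<partial>S) \<partial>S)"
  proof (intro nn_integral_cong)
    fix \<omega> assume "\<omega> \<in> space S"
    then have [measurable]: "?c \<omega> \<in> S \<rightarrow>\<^sub>M S" by measurable
    show "(\<integral>\<^sup>+\<omega>'. ennreal (\<Prod>k<K. Z k \<omega>) * ennreal (Z K (?c \<omega> \<omega>')) \<partial>S) =
        ennreal (\<Prod>k<K. Z k \<omega>) * (\<integral>\<^sup>+\<omega>'. ennreal (Z K (?c \<omega> \<omega>')) \<partial>S)"
      by (rule nn_integral_cmult) measurable
  qed
  also have "\<dots> \<le> (\<integral>\<^sup>+\<omega>. ennreal (\<Prod>k<K. Z k \<omega>) * 1 \<partial>S)"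
    by (intro nn_integral_mono mult_left_mono fut) simp_all
  also have "\<dots> \<le> 1" using Suc by simp
  finally show ?case .
qed

text \<open>Markov's inequality for the product of the trial factors: on this event at least
  \<open>a\<close> trials contribute \<open>1 / q\<close> each and at most \<open>s\<close> of them
  a factor \<open>1 / 2\<close>, so the product is at least
  \<open>q powr (- a) * 2 powr (- s)\<close>, where \<open>q = 1 - \<rho> / 2\<close>.\<close>

lemma prob_many_trials_few_successes:
  fixes T U :: "nat \<Rightarrow> (nat \<Rightarrow> 'a) \<Rightarrow> bool" and t :: "nat \<Rightarrow> nat" and \<rho> a s :: real
  assumes \<rho>: "0 < \<rho>" "\<rho> \<le> 1" and t: "mono t"
    and T_meas[measurable]: "\<And>k. Measurable.pred S (T k)"
    and U_meas[measurable]: "\<And>k. Measurable.pred S (U k)"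
    and T_cong: "\<And>k \<omega> \<omega>'. \<omega> \<in> space S \<Longrightarrow> \<omega>' \<in> space S \<Longrightarrow> (\<And>j. j < t k \<Longrightarrow> \<omega> j = \<omega>' j) \<Longrightarrow> T k \<omega> = T k \<omega>'"
    and U_cong: "\<And>k \<omega> \<omega>'. \<omega> \<in> space S \<Longrightarrow> \<omega>' \<in> space S \<Longrightarrow> (\<And>j. j < t (Suc k) \<Longrightarrow> \<omega> j = \<omega>' j) \<Longrightarrow>
                   T k \<omega> \<Longrightarrow> U k \<omega> = U k \<omega>'"
    and cond: "\<And>k \<omega>. \<omega> \<in> space S \<Longrightarrow> T k \<omega> \<Longrightarrow>
                 \<P>(\<omega>' in S. U k (comb_seq (t k) \<omega> \<omega>')) \<ge> \<rho>"
  shows "emeasure S {\<omega> \<in> space S. a \<le> real (card {k. k < K \<and> T k \<omega>}) \<and>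
            real (card {k. k < K \<and> T k \<omega> \<and> U k \<omega>}) \<le> s}
         \<le> ennreal ((1 - \<rho> / 2) powr a * 2 powr s)"
proof -
  let ?q = "1 - \<rho> / 2"
  let ?Z = "\<lambda>k \<omega>. if T k \<omega> then (if U k \<omega> then 1 / 2 else 1) / ?q else 1"
  let ?nT = "\<lambda>\<omega>. card {k. k < K \<and> T k \<omega>}"
  let ?nU = "\<lambda>\<omega>. card {k. k < K \<and> T k \<omega> \<and> U k \<omega>}"
  let ?c = "?q powr (- a) * 2 powr (- s)"
  have q: "0 < ?q" "?q < 1" using \<rho> by auto
  have [measurable]: "?Z k \<in> borel_measurable S" for k by measurable
  have prod: "(\<Prod>k<K. ?Z k \<omega>) = (1 / ?q) ^ ?nT \<omega> * (1 / 2) ^ ?nU \<omega>" for \<omega>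
  proof -
    have "(\<Prod>k<K. ?Z k \<omega>) = (\<Prod>k<K. (if T k \<omega> then 1 / ?q else 1) * (if T k \<omega> \<and> U k \<omega> then 1 / 2 else 1))"
      by (intro prod.cong) auto
    also have "\<dots> = (\<Prod>k\<in>{k\<in>{..<K}. T k \<omega>}. 1 / ?q) * (\<Prod>k\<in>{k\<in>{..<K}. T k \<omega> \<and> U k \<omega>}. 1 / 2)"
      unfolding prod.distrib by (intro arg_cong2[where f="(*)"] prod.inter_filter[symmetric]) auto
    finally show ?thesis by simp
  qed
  have ge: "?c \<le> (\<Prod>k<K. ?Z k \<omega>)" if "a \<le> real (?nT \<omega>)" "real (?nU \<omega>) \<le> s" for \<omega>
  proof -
    have "?q powr (- a) \<le> ?q powr (- real (?nT \<omega>))"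
      using q that by (intro powr_mono') auto
    also have "\<dots> = (1 / ?q) ^ ?nT \<omega>"
      using q by (simp add: powr_minus powr_realpow power_one_over inverse_eq_divide)
    finally have 1: "?q powr (- a) \<le> (1 / ?q) ^ ?nT \<omega>" .
    have "2 powr (- s) \<le> (2::real) powr (- real (?nU \<omega>))" using that by simp
    also have "\<dots> = (1 / 2) ^ ?nU \<omega>"
      by (simp add: powr_minus powr_realpow power_one_over inverse_eq_divide)
    finally have "2 powr (- s) \<le> (1 / 2 :: real) ^ ?nU \<omega>" .
    with 1 show ?thesis unfolding prod using q by (intro mult_mono) auto
  qed
  have c: "0 < ?c" using q by simp
  let ?A = "{\<omega> \<in> space S. a \<le> real (?nT \<omega>) \<and> real (?nU \<omega>) \<le> s}"
  have A: "?A \<subseteq> {\<omega> \<in> space S. ennreal ?c \<le> ennreal (\<Prod>k<K. ?Z k \<omega>)}"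
    using ge by (auto intro!: ennreal_leI)
  have "emeasure S ?A \<le> emeasure S {\<omega> \<in> space S. ennreal ?c \<le> ennreal (\<Prod>k<K. ?Z k \<omega>)}"
    by (intro emeasure_mono A) measurable
  also have "\<dots> \<le> emeasure S ({\<omega> \<in> space S. 1 \<le> inverse (ennreal ?c) * ennreal (\<Prod>k<K. ?Z k \<omega>)} \<inter> space S)"
  proof (intro emeasure_mono subsetI)
    fix \<omega> assume "\<omega> \<in> {\<omega> \<in> space S. ennreal ?c \<le> ennreal (\<Prod>k<K. ?Z k \<omega>)}"
    then have "\<omega> \<in> space S" "inverse (ennreal ?c) * ennreal ?c \<le> inverse (ennreal ?c) * ennreal (\<Prod>k<K. ?Z k \<omega>)"
      by (auto intro: mult_left_mono)
    moreover have "inverse (ennreal ?c) * ennreal ?c = 1"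
      unfolding inverse_ennreal[OF c] ennreal_mult[symmetric, OF less_imp_le less_imp_le, OF positive_imp_inverse_positive[OF c] c]
      using left_inverse[OF less_imp_neq[OF c, symmetric]] by (simp only: ennreal_1)
    ultimately show "\<omega> \<in> {\<omega> \<in> space S. 1 \<le> inverse (ennreal ?c) * ennreal (\<Prod>k<K. ?Z k \<omega>)} \<inter> space S"
      by simp
  qed measurable
  also have "\<dots> \<le> inverse (ennreal ?c) * (\<integral>\<^sup>+\<omega>. ennreal (\<Prod>k<K. ?Z k \<omega>) * indicator (space S) \<omega> \<partial>S)"
    by (intro order.trans[OF _ nn_integral_Markov_inequality]) (auto intro!: emeasure_mono)
  also have "\<dots> \<le> inverse (ennreal ?c) * 1"
  proof (intro mult_left_mono)
    have "(\<integral>\<^sup>+\<omega>. ennreal (\<Prod>k<K. ?Z k \<omega>) * indicator (space S) \<omega> \<partial>S) = (\<integral>\<^sup>+\<omega>. ennreal (\<Prod>k<K. ?Z k \<omega>) \<partial>S)"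
      by (intro nn_integral_cong) simp
    also have "\<dots> \<le> 1"
      by (rule nn_integral_trials_le_1[of \<rho> t T U K, OF \<rho> t T_meas U_meas T_cong U_cong cond])
    finally show "(\<integral>\<^sup>+\<omega>. ennreal (\<Prod>k<K. ?Z k \<omega>) * indicator (space S) \<omega> \<partial>S) \<le> 1" .
  qed simp
  also have "\<dots> = ennreal (?q powr a * 2 powr s)"
    using c q by (simp add: inverse_ennreal powr_minus field_simps)
  finally show ?thesis .
qed

end

section \<open>The noise and the random orbits\<close>

lemma space_noise: "space (noise \<sigma>) = noise_cube \<sigma>"
  by (simp add: noise_def noise_cube_def space_restrict_space)

lemma noise_cube_borel[measurable]: "noise_cube \<sigma> \<in> sets borel"
  by (simp add: noise_cube_def)

lemma sets_noise: "sets (noise \<sigma>) = sets (restrict_space borel (noise_cube \<sigma>))"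
  by (simp add: noise_def sets_restrict_space)

lemma emeasure_noise:
  fixes S :: "(real ^ 'k::finite) set"
  assumes S: "S \<in> sets borel"
  shows "emeasure (noise \<sigma>) (S \<inter> noise_cube \<sigma>) =
     emeasure lborel (S \<inter> noise_cube \<sigma>) / emeasure lborel (noise_cube \<sigma> :: (real ^ 'k::finite) set)"
proof -
  have "S \<inter> noise_cube \<sigma> \<in> sets (restrict_space lborel (noise_cube \<sigma>))"
    using S by (auto simp: sets_restrict_space)
  moreover have "(noise_cube \<sigma> :: (real ^ 'k::finite) set) \<in> sets (restrict_space lborel (noise_cube \<sigma>))"
    by (auto simp: sets_restrict_space noise_cube_def)
  ultimately show ?thesis
    using S unfolding noise_def
    by (subst emeasure_uniform_measure) (simp_all add: emeasure_restrict_space Int_absorb2 Int_absorb1 inf_commute)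
qed

lemma emeasure_noise_cube_finite: "emeasure lborel (noise_cube \<sigma>) < \<infinity>"
  unfolding noise_cube_def by (intro emeasure_compact_finite) simp

lemma emeasure_open_Int_noise_cube_pos:
  fixes U :: "(real ^ 'k::finite) set"
  assumes \<sigma>: "0 < \<sigma>" and U: "open U" "w \<in> U" "w \<in> noise_cube \<sigma>"
  shows "0 < emeasure lborel (U \<inter> noise_cube \<sigma>)"
proof -
  let ?b = "box (\<chi> i. - \<sigma>) (\<chi> i. \<sigma>) :: (real ^ 'k) set"
  have ne: "?b \<noteq> {}"
    using \<sigma> by (simp add: interval_ne_empty_cart)
  \<comment> \<open>\<open>w\<close> may lie on a face of the cube. The open box is dense in the
    cube, so \<open>U\<close> meets it in a nonempty open set, whose volume is positive.\<close>
  have "w \<in> closure ?b"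
    using U ne by (simp add: closure_box noise_cube_def)
  with U have "U \<inter> ?b \<noteq> {}"
    using open_Int_closure_eq_empty[of U ?b] by blast
  then have "\<not> negligible (U \<inter> ?b)"
    using U(1) by (intro open_not_negligible) auto
  then have "emeasure lborel (U \<inter> ?b) \<noteq> 0"
    using U(1) by (auto simp: negligible_iff_null_sets null_sets_def)
  then have "0 < emeasure lborel (U \<inter> ?b)" by (simp add: zero_less_iff_neq_zero)
  also have "\<dots> \<le> emeasure lborel (U \<inter> noise_cube \<sigma>)"
    using U(1) box_subset_cbox[of "\<chi> i. - \<sigma>" "\<chi> i. \<sigma>" ] by (intro emeasure_mono) (auto simp: noise_cube_def)
  finally show ?thesis .
qed

lemma prob_space_noise:
  assumes "0 < \<sigma>"
  shows "prob_space (noise \<sigma> :: (real ^ 'k::finite) measure)"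
proof -
  have 0: "(0 :: real ^ 'k) \<in> noise_cube \<sigma>"
    using assms by (simp add: noise_cube_def mem_box_cart)
  have m: "(noise_cube \<sigma> :: (real ^ 'k) set) \<in> sets (restrict_space lborel (noise_cube \<sigma>))"
    by (auto simp: sets_restrict_space noise_cube_def)
  have "emeasure (restrict_space lborel (noise_cube \<sigma>)) (noise_cube \<sigma> :: (real ^ 'k) set) = emeasure lborel (noise_cube \<sigma> :: (real ^ 'k) set)"
    by (simp add: emeasure_restrict_space noise_cube_def)
  with emeasure_open_Int_noise_cube_pos[OF assms open_UNIV UNIV_I 0] emeasure_noise_cube_finite[of \<sigma>, where 'a='k]
  show ?thesis
    unfolding noise_def by (intro prob_space_uniform_measure) auto
qed

lemma emeasure_noise_open_pos:
  assumes "0 < \<sigma>" "open U" "w \<in> U" "w \<in> noise_cube \<sigma>"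
  shows "0 < emeasure (noise \<sigma>) (U \<inter> noise_cube \<sigma>)"
  using emeasure_open_Int_noise_cube_pos[OF assms] emeasure_noise_cube_finite[of \<sigma>] assms
  by (simp add: emeasure_noise ennreal_zero_less_divide)

lemma sequence_space_noise:
  assumes "0 < \<sigma>"
  shows "sequence_space (noise \<sigma> :: (real ^ 'k::finite) measure)"
proof -
  interpret prob_space "noise \<sigma> :: (real ^ 'k) measure" by (rule prob_space_noise[OF assms])
  show ?thesis by unfold_locales
qed

lemma noise_seq_prob: "0 < \<sigma> \<Longrightarrow> prob_space (noise_seq \<sigma>)"
  unfolding noise_seq_def by (intro prob_space_PiM prob_space_noise)

lemma space_noise_seq: "space (noise_seq \<sigma>) = {\<omega>. \<forall>i. \<omega> i \<in> noise_cube \<sigma>}"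
  by (auto simp: noise_seq_def space_PiM PiE_def Pi_def space_noise)

lemma shift_pow: "(shift ^^ n) \<omega> i = \<omega> (n + i)"
  by (induction n arbitrary: i) (auto simp: shift_def)

lemma rmap_iter_Suc_apply: "rmap_iter g (Suc n) \<omega> x = g (rmap_iter g n \<omega> x) (\<omega> n)"
  by (simp add: rmap_def shift_pow)

lemma rmap_iter_cong: "(\<And>j. j < n \<Longrightarrow> \<omega> j = \<omega>' j) \<Longrightarrow> rmap_iter g n \<omega> x = rmap_iter g n \<omega>' x"
  by (induction n) (simp_all add: rmap_iter_Suc_apply del: rmap_iter.simps(2))

lemma rmap_iter_add: "rmap_iter g (n + k) \<omega> x = rmap_iter g k ((shift ^^ n) \<omega>) (rmap_iter g n \<omega> x)"
  by (induction k) (simp_all add: rmap_iter_Suc_apply shift_pow del: rmap_iter.simps(2))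

lemma hyperbolic_time_cong:
  assumes "\<And>j. j < n \<Longrightarrow> \<omega> j = \<omega>' j"
  shows "hyperbolic_time M g C b \<eta> r x \<omega> n = hyperbolic_time M g C b \<eta> r x \<omega>' n"
proof -
  have 1: "rmap_iter g i \<omega> x = rmap_iter g i \<omega>' x" if "i < n" for i
    using that assms by (intro rmap_iter_cong) auto
  have 2: "rmap g ((shift ^^ i) \<omega>) = rmap g ((shift ^^ i) \<omega>')" if "i < n" for i
    using that assms by (auto simp: rmap_def shift_pow)
  have "(\<Prod>i=k..<n. inv_deriv_norm M (rmap g ((shift ^^ i) \<omega>)) (rmap_iter g i \<omega> x)) =
      (\<Prod>i=k..<n. inv_deriv_norm M (rmap g ((shift ^^ i) \<omega>')) (rmap_iter g i \<omega>' x))" for k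
    by (intro prod.cong refl) (simp add: 1 2)
  then show ?thesis
    unfolding hyperbolic_time_def using 1 assms by auto
qed

section \<open>The support of the stationary measure\<close>

lemma closed_msupp: "closed (msupp \<mu>)"
proof -
  have "open (- msupp \<mu>)"
  proof (subst open_subopen, intro ballI)
    fix x assume "x \<in> - msupp \<mu>"
    then obtain U where "open U" "x \<in> U" "\<not> emeasure \<mu> U > 0" by (auto simp: msupp_def)
    then show "\<exists>T. open T \<and> x \<in> T \<and> T \<subseteq> - msupp \<mu>"
      by (intro exI[of _ U]) (auto simp: msupp_def)
  qed
  then show ?thesis by (simp add: closed_def)
qed

text \<open>By continuity a neighbourhood \<open>U\<close> of \<open>g y w\<close> is hit from all
  of a neighbourhood \<open>V\<close> of \<open>y\<close> under all noise values in a neighbourhood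
  \<open>W\<close> of \<open>w\<close>. Stationarity then gives \<open>U\<close> at least the mass
  of \<open>V\<close> times the noise probability of \<open>W\<close>, and both are
  positive.\<close>

lemma msupp_invariant:
  fixes g :: "'a::metric_space \<Rightarrow> real ^ 'k::finite \<Rightarrow> 'a"
  assumes \<sigma>: "0 < \<sigma>" and cont: "continuous_on (UNIV \<times> noise_cube \<sigma>) (\<lambda>(x, w). g x w)"
    and st: "stationary \<sigma> g \<mu>"
    and y: "y \<in> msupp \<mu>" and w: "w \<in> noise_cube \<sigma>"
  shows "g y w \<in> msupp \<mu>"
  unfolding msupp_def
proof (intro CollectI allI impI)
  fix U assume U: "open U" "g y w \<in> U"
  obtain O1 where O1: "open O1" "O1 \<inter> UNIV \<times> noise_cube \<sigma> = (\<lambda>(x, w). g x w) -` U \<inter> UNIV \<times> noise_cube \<sigma>"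
    using iffD1[OF continuous_on_open_invariant cont, rule_format, OF U(1)] by metis
  have "(y, w) \<in> (\<lambda>(x, w). g x w) -` U \<inter> UNIV \<times> noise_cube \<sigma>" using U(2) w by simp
  then have "(y, w) \<in> O1" unfolding O1(2)[symmetric] by simp
  then obtain V W where VW: "open V" "open W" "(y, w) \<in> V \<times> W" "V \<times> W \<subseteq> O1"
    by (rule open_prod_elim[OF O1(1)])
  let ?W = "W \<inter> noise_cube \<sigma>"
  have g_meas: "g z \<in> noise \<sigma> \<rightarrow>\<^sub>M borel" for z
  proof -
    have "continuous_on (noise_cube \<sigma>) (g z)"
      using continuous_on_compose2[OF cont continuous_on_Pair[OF continuous_on_const continuous_on_id]]
      by auto
    then show ?thesis
      using borel_measurable_continuous_on_restrict measurable_cong_sets[OF sets_noise refl] by blast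
  qed
  have pos: "0 < emeasure (noise \<sigma>) ?W"
    using VW w \<sigma> by (intro emeasure_noise_open_pos) auto
  have ge: "emeasure (noise \<sigma>) ?W \<le> emeasure (transition \<sigma> g z) U" if "z \<in> V" for z
  proof -
    have "?W \<subseteq> g z -` U \<inter> space (noise \<sigma>)"
    proof
      fix w' assume "w' \<in> ?W"
      then have "(z, w') \<in> O1 \<inter> UNIV \<times> noise_cube \<sigma>" using that VW(4) by auto
      then show "w' \<in> g z -` U \<inter> space (noise \<sigma>)" unfolding O1(2) by (simp add: space_noise)
    qed
    then show ?thesis
      using U g_meas[of z] unfolding transition_def
      by (subst emeasure_distr) (auto intro!: emeasure_mono measurable_sets)
  qed
  have sets: "sets \<mu> = sets borel" using st by (simp add: stationary_def)
  have "0 < emeasure (noise \<sigma>) ?W * emeasure \<mu> V"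
    using pos VW y by (auto simp: msupp_def ennreal_zero_less_mult_iff)
  also have "\<dots> = (\<integral>\<^sup>+z. emeasure (noise \<sigma>) ?W * indicator V z \<partial>\<mu>)"
    using VW sets by (intro nn_integral_cmult_indicator[symmetric]) auto
  also have "\<dots> \<le> (\<integral>\<^sup>+z. emeasure (transition \<sigma> g z) U \<partial>\<mu>)"
    using ge by (intro nn_integral_mono) (auto simp: indicator_def)
  also have "\<dots> = emeasure \<mu> U" using st U unfolding stationary_def by auto
  finally show "0 < emeasure \<mu> U" .
qed

lemma rmap_iter_invariant:
  assumes "\<And>y w. y \<in> X \<Longrightarrow> w \<in> noise_cube \<sigma> \<Longrightarrow> g y w \<in> X" "\<omega> \<in> space (noise_seq \<sigma>)" "x \<in> X"
  shows "rmap_iter g n \<omega> x \<in> X"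
  using assms by (induction n) (auto simp: rmap_iter_Suc_apply space_noise_seq simp del: rmap_iter.simps(2))

section \<open>Interior noise values lead into the interior of the support\<close>

lemma chart_at:
  assumes "smooth_atlas M"
  shows "chart_at M x \<in> charts M" "x \<in> fst (chart_at M x)"
proof -
  have "x \<in> (\<Union>c\<in>charts M. fst c)" using assms unfolding smooth_atlas_def by simp
  then have "\<exists>c. c \<in> charts M \<and> x \<in> fst c" by blast
  from someI_ex[OF this] show "chart_at M x \<in> charts M" "x \<in> fst (chart_at M x)"
    by (auto simp: chart_at_def)
qed

lemma chart_homeo:
  assumes "smooth_atlas M" "c \<in> charts M"
  shows "open (fst c)" "open (snd c ` fst c)" "homeomorphism (fst c) (snd c ` fst c) (snd c) (chart_inv c)"
  using assms unfolding smooth_atlas_def by auto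

text \<open>The noise has the dimension of the manifold: read in a chart, \<open>g y\<close> is a
  continuous injection of an open set of the model space into that space, so its image is open by
  invariance of domain. Noise values on a face of the cube have no such open set around
  them.\<close>

lemma noise_value_interior:
  fixes M :: "('a::metric_space, 'k::finite) manifold"
  assumes M: "smooth_atlas M" and d: "noise_diffeo M \<sigma> g y" and w: "w \<in> interior (noise_cube \<sigma>)"
    and X: "\<And>w. w \<in> noise_cube \<sigma> \<Longrightarrow> g y w \<in> X"
  shows "g y w \<in> interior X"
proof -
  let ?c = "chart_at M (g y w)"
  note c = chart_homeo[OF M chart_at(1)[OF M, of "g y w"]]
  have cont: "continuous_on (interior (noise_cube \<sigma>)) (g y)" and inj: "inj_on (g y) (interior (noise_cube \<sigma>))"
    using d interior_subset[of "noise_cube \<sigma>"] unfolding noise_diffeo_def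
    by (auto intro: continuous_on_subset inj_on_subset)
  define O1 where "O1 = interior (noise_cube \<sigma>) \<inter> g y -` fst ?c"
  have O1: "open O1" unfolding O1_def
    using cont c(1) by (intro continuous_open_preimage) auto
  have wO: "w \<in> O1" using w chart_at(2)[OF M, of "g y w"] by (simp add: O1_def)
  have inj_c: "inj_on (snd ?c) (fst ?c)" and cont_c: "continuous_on (fst ?c) (snd ?c)"
    using c(3) by (auto simp: homeomorphism_def intro: inj_on_inverseI)
  have 1: "continuous_on O1 (snd ?c \<circ> g y)"
    by (intro continuous_on_compose continuous_on_subset[OF cont] continuous_on_subset[OF cont_c]) (auto simp: O1_def)
  have 2: "inj_on (snd ?c \<circ> g y) O1"
    by (intro comp_inj_on inj_on_subset[OF inj] inj_on_subset[OF inj_c]) (auto simp: O1_def)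
  have op: "open ((snd ?c \<circ> g y) ` O1)"
    using invariance_of_domain[OF 1 O1 2] .
  have "open (fst ?c \<inter> snd ?c -` ((snd ?c \<circ> g y) ` O1))"
    by (rule continuous_open_preimage[OF cont_c c(1) op])
  also have "fst ?c \<inter> snd ?c -` ((snd ?c \<circ> g y) ` O1) = g y ` O1"
    using inj_c by (fastforce simp: O1_def inj_on_def)
  finally show ?thesis
    using X wO interior_subset[of "noise_cube \<sigma>"] by (intro interiorI[of "g y ` O1"]) (auto simp: O1_def)
qed

lemma uniform_interior_radius:
  fixes g :: "'a::metric_space \<Rightarrow> real ^ 'k::finite \<Rightarrow> 'a"
  assumes comp: "compact X" "compact K" and cont: "continuous_on (X \<times> K) (\<lambda>(x, w). g x w)"
    and int: "\<And>y w. y \<in> X \<Longrightarrow> w \<in> K \<Longrightarrow> g y w \<in> interior X"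
  shows "\<exists>\<kappa>>0. \<forall>y\<in>X. \<forall>w\<in>K. ball (g y w) \<kappa> \<subseteq> X"
proof -
  let ?G = "(\<lambda>(x, w). g x w) ` (X \<times> K)"
  have "compact ?G" by (intro compact_continuous_image cont compact_Times comp)
  moreover have "?G \<subseteq> interior X" using int by auto
  ultimately obtain e where e: "e > 0" "(\<Union>x\<in>?G. ball x e) \<subseteq> interior X"
    using compact_subset_open_imp_ball_epsilon_subset[OF _ open_interior] by blast
  show ?thesis
  proof (intro exI[of _ e] conjI ballI)
    show "e > 0" by (rule e(1))
    fix y w assume "y \<in> X" "w \<in> K"
    then have "g y w \<in> ?G" by auto
    then show "ball (g y w) e \<subseteq> X" using e(2) interior_subset[of X] by blast
  qed
qed

section \<open>Openness of the reach events\<close>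

text \<open>Solutions of \<open>F z = v\<close> are the fixed points of
  \<open>z - L' (F z - v)\<close>, a Newton step with frozen derivative \<open>L\<close>. The
  hypothesis \<open>near\<close> keeps this step inside the closed ball, and Brouwer's theorem asks
  for no more than continuity of \<open>F\<close>.\<close>

lemma brouwer_surjective_near_linear:
  fixes F L L' :: "'v::euclidean_space \<Rightarrow> 'v"
  assumes cont: "continuous_on (cball p r) F" and r: "0 < r"
    and L': "linear L'" "\<And>v. L' (L v) = v" "\<And>v. L (L' v) = v" and L: "linear L"
    and K: "\<And>v. norm (L' v) \<le> K * norm v"
    and near: "\<And>z. z \<in> cball p r \<Longrightarrow> K * norm (F z - v - L (z - p)) \<le> r"
  shows "v \<in> F ` cball p r"
proof -
  let ?\<Phi> = "\<lambda>z. z - L' (F z - v)"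
  have "bounded_linear L'" using L'(1) by (simp add: linear_conv_bounded_linear)
  then have "continuous_on (cball p r) ?\<Phi>"
    by (intro continuous_intros cont bounded_linear.continuous_on[of L'])
  moreover have "?\<Phi> ` cball p r \<subseteq> cball p r"
  proof (intro image_subsetI)
    fix z assume z: "z \<in> cball p r"
    have "p - ?\<Phi> z = L' (F z - v - L (z - p))"
      by (subst linear_diff[OF L'(1)]) (simp add: L')
    then have "norm (p - ?\<Phi> z) \<le> K * norm (F z - v - L (z - p))" using K by metis
    with near[OF z] show "?\<Phi> z \<in> cball p r" by (simp add: dist_norm)
  qed
  ultimately obtain z where z: "z \<in> cball p r" "?\<Phi> z = z"
    using brouwer[of "cball p r" ?\<Phi>] r by (auto simp: image_subset_iff Pi_iff)
  then have "L' (F z - v) = 0" by simp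
  then have "F z = v" using L'(3)[of "F z - v"] L by (simp add: linear_0)
  with z show ?thesis by blast
qed

text \<open>
  A map near \<open>g(\<sqdot>, w)\<close> in the uniform topology still covers a neighbourhood of \<open>g q w\<close>:
  differentiability at the single point \<open>q\<close> suffices for this by Brouwer's theorem.
\<close>

lemma regular_robustly_open:
  fixes M :: "('a::metric_space, 'k::finite) manifold"
  assumes M: "smooth_atlas M"
    and cont: "continuous_on (UNIV \<times> noise_cube \<sigma>) (\<lambda>(x, w). g x w)"
    and w: "w \<in> noise_cube \<sigma>" and reg: "regular_at M (\<lambda>y. g y w) q"
    and U: "open U" "q \<in> U"
  shows "\<exists>\<epsilon>>0. \<forall>w'\<in>noise_cube \<sigma>. dist w' w < \<epsilon> \<longrightarrow> ball (g q w) \<epsilon> \<subseteq> (\<lambda>y. g y w') ` U"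
proof -
  define c where "c = chart_at M q"
  define d where "d = chart_at M (g q w)"
  define p where "p = snd c q"
  define G where "G = (\<lambda>w' z. snd d (g (chart_inv c z) w'))"
  note c = chart_homeo[OF M chart_at(1)[OF M, of q], folded c_def]
  note d = chart_homeo[OF M chart_at(1)[OF M, of "g q w"], folded d_def]
  have qc: "q \<in> fst c" and gd: "g q w \<in> fst d"
    using chart_at(2)[OF M] by (auto simp: c_def d_def)
  have inj_c: "\<And>y. y \<in> fst c \<Longrightarrow> chart_inv c (snd c y) = y"
    and cont_ci: "continuous_on (snd c ` fst c) (chart_inv c)" and ci: "chart_inv c ` (snd c ` fst c) = fst c"
    and sci: "\<And>z. z \<in> snd c ` fst c \<Longrightarrow> snd c (chart_inv c z) = z"
    using c(3) by (auto simp: homeomorphism_def)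
  have inj_d: "\<And>y. y \<in> fst d \<Longrightarrow> chart_inv d (snd d y) = y" and cont_d: "continuous_on (fst d) (snd d)"
    using d(3) by (auto simp: homeomorphism_def)
  have cp: "chart_inv c p = q" using inj_c qc by (simp add: p_def)
  define L where "L = mderiv M (\<lambda>y. g y w) q"
  have Gw: "coord_rep M (\<lambda>y. g y w) q = G w"
    by (auto simp: coord_rep_def G_def c_def d_def)
  have L: "(G w has_derivative L) (at p)"
    using reg unfolding regular_at_def mdifferentiable_def L_def mderiv_def Gw p_def c_def
    by (simp add: frechet_derivative_works)
  have linL: "linear L" using has_derivative_linear[OF L] .
  have bijL: "bij L" using reg by (simp add: regular_at_def L_def)
  obtain L' where L': "linear L'" "L' \<circ> L = id"
    using linear_injective_left_inverse[OF linL bij_is_inj[OF bijL]] by blast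
  have L'L: "L' (L v) = v" for v using L'(2) by (metis comp_apply id_apply)
  have LL': "L (L' v) = v" for v
  proof -
    obtain u where "v = L u" using bijL by (metis bij_pointE)
    then show ?thesis by (simp add: L'L)
  qed
  obtain K where K: "K > 0" "\<And>v. norm (L' v) \<le> norm v * K"
    using L'(1) bounded_linear.pos_bounded[of L'] by (auto simp: linear_conv_bounded_linear)
  \<comment> \<open>The Brouwer step tolerates a total error \<open>r / K\<close>. Three errors
    occur, from changing the noise value, from linearising at \<open>p\<close>, and from moving the
    target away from \<open>g q w\<close>; each is allotted \<open>r / (4 * K)\<close>.\<close>
  have "0 < 1 / (4 * K)" using K by simp
  with L obtain r1 where r1: "r1 > 0" "\<And>z. norm (z - p) < r1 \<Longrightarrow> norm (G w z - G w p - L (z - p)) \<le> 1 / (4 * K) * norm (z - p)"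
    unfolding has_derivative_at_alt by meson
  have "open (snd c ` fst c \<inter> chart_inv c -` U)"
    by (rule continuous_open_preimage[OF cont_ci c(2) U(1)])
  moreover have "p \<in> snd c ` fst c \<inter> chart_inv c -` U" using cp U qc by (auto simp: p_def)
  ultimately obtain r2 where r2: "r2 > 0" "ball p r2 \<subseteq> snd c ` fst c \<inter> chart_inv c -` U"
    using open_contains_ball by blast
  have cont_h: "continuous_on (ball p r2 \<times> noise_cube \<sigma>) (\<lambda>(z, w'). g (chart_inv c z) w')"
  proof -
    have 1: "continuous_on (ball p r2 \<times> noise_cube \<sigma>) (\<lambda>v. chart_inv c (fst v))"
      using r2(2) by (intro continuous_on_compose2[OF cont_ci] continuous_intros) auto
    have "continuous_on (ball p r2 \<times> noise_cube \<sigma>) (\<lambda>v. (chart_inv c (fst v), snd v))"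
      by (intro continuous_on_Pair 1 continuous_on_snd continuous_on_id)
    moreover have "(\<lambda>v. (chart_inv c (fst v), snd v)) ` (ball p r2 \<times> noise_cube \<sigma>) \<subseteq> UNIV \<times> noise_cube \<sigma>"
      by auto
    ultimately show ?thesis
      using continuous_on_compose2[OF cont] by (fastforce simp: case_prod_beta')
  qed
  let ?h = "\<lambda>(z, w'). g (chart_inv c z) w'"
  have pw: "(p, w) \<in> ball p r2 \<times> noise_cube \<sigma>" using r2 w by simp
  have "?h (p, w) \<in> fst d" using cp gd by simp
  then obtain e where e: "e > 0" "ball (?h (p, w)) e \<subseteq> fst d" using d(1) open_contains_ball by blast
  obtain e0 where e0_dist: "e0 > 0"
    "\<And>v. v \<in> ball p r2 \<times> noise_cube \<sigma> \<Longrightarrow> dist v (p, w) < e0 \<Longrightarrow> dist (?h v) (?h (p, w)) < e"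
    using bspec[OF cont_h[unfolded continuous_on_iff] pw] e(1) by meson
  have e0: "e0 > 0" "\<And>v. v \<in> ball p r2 \<times> noise_cube \<sigma> \<Longrightarrow> dist v (p, w) < e0 \<Longrightarrow> ?h v \<in> fst d"
  proof -
    fix v assume "v \<in> ball p r2 \<times> noise_cube \<sigma>" "dist v (p, w) < e0"
    from e0_dist(2)[OF this] have "?h v \<in> ball (?h (p, w)) e" by (simp add: dist_commute)
    then show "?h v \<in> fst d" using e(2) by (rule subsetD[rotated])
  qed (rule e0_dist)
  define r where "r = min (min (r1 / 2) (r2 / 2)) (e0 / 4)"
  have r: "0 < r" "r < r1" "r < r2" "r < e0 / 2" using r1 r2 e0 by (auto simp: r_def)
  \<comment> \<open>A compact set of noise values, so that \<open>G\<close> is uniformly continuous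
    in both arguments and one tolerance \<open>e1\<close> serves all \<open>z\<close> in the
    ball.\<close>
  let ?W = "noise_cube \<sigma> \<inter> cball w (e0 / 4)"
  have in_d: "g (chart_inv c z) w' \<in> fst d" if "z \<in> cball p r" "w' \<in> ?W" for z w'
  proof -
    have "dist (z, w') (p, w) \<le> dist z p + dist w' w"
      unfolding dist_Pair_Pair by (rule sqrt_sum_squares_le_sum) auto
    also have "\<dots> < e0" using that r e0 by (auto simp: dist_commute)
    finally show ?thesis using e0(2)[of "(z, w')"] that r by auto
  qed
  have contG: "continuous_on (cball p r \<times> ?W) (\<lambda>(z, w'). G w' z)"
  proof -
    have "continuous_on (cball p r \<times> ?W) (\<lambda>(z, w'). g (chart_inv c z) w')"
      using r by (intro continuous_on_subset[OF cont_h]) auto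
    moreover have "(\<lambda>(z, w'). g (chart_inv c z) w') ` (cball p r \<times> ?W) \<subseteq> fst d"
      using in_d by (auto simp del: mem_cball)
    ultimately have "continuous_on (cball p r \<times> ?W) (\<lambda>v. snd d ((\<lambda>(z, w'). g (chart_inv c z) w') v))"
      by (rule continuous_on_compose2[OF cont_d])
    then show ?thesis by (simp add: case_prod_beta' G_def)
  qed
  have "compact (cball p r \<times> ?W)" unfolding noise_cube_def by (intro compact_Times compact_Int) auto
  with contG have unif: "uniformly_continuous_on (cball p r \<times> ?W) (\<lambda>(z, w'). G w' z)"
    by (rule compact_uniformly_continuous)
  have rK: "0 < r / (4 * K)" using r K by simp
  let ?X = "cball p r \<times> ?W"
  have "\<exists>e>0. \<forall>v\<in>?X. \<forall>v'\<in>?X. dist v' v < e \<longrightarrow> dist ((\<lambda>(z, w'). G w' z) v') ((\<lambda>(z, w'). G w' z) v) < r / (4 * K)"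
    by (rule mp[OF spec[OF unif[unfolded uniformly_continuous_on_def]] rK])
  then obtain e1 where e1: "e1 > 0" "\<And>v v'. v \<in> ?X \<Longrightarrow> v' \<in> ?X \<Longrightarrow> dist v' v < e1 \<Longrightarrow>
      dist ((\<lambda>(z, w'). G w' z) v') ((\<lambda>(z, w'). G w' z) v) < r / (4 * K)"
    by blast
  obtain e2 where e2: "e2 > 0" "ball (g q w) e2 \<subseteq> fst d"
    using d(1) gd open_contains_ball by blast
  obtain e3 where e3: "e3 > 0" "\<And>y. y \<in> fst d \<Longrightarrow> dist y (g q w) < e3 \<Longrightarrow> dist (snd d y) (snd d (g q w)) < r / (4 * K)"
    using bspec[OF cont_d[unfolded continuous_on_iff] gd] rK by meson
  define \<epsilon> where "\<epsilon> = min (min e1 (e0 / 4)) (min e2 e3)"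
  have \<epsilon>: "\<epsilon> > 0" "\<epsilon> \<le> e1" "\<epsilon> \<le> e0 / 4" "\<epsilon> \<le> e2" "\<epsilon> \<le> e3"
    using e0 e1 e2 e3 by (auto simp: \<epsilon>_def)
  show ?thesis
  proof (intro exI[of _ \<epsilon>] conjI ballI impI subsetI)
    show "\<epsilon> > 0" by fact
    fix w' y assume w': "w' \<in> noise_cube \<sigma>" "dist w' w < \<epsilon>" and y: "y \<in> ball (g q w) \<epsilon>"
    have W: "w' \<in> ?W" "w \<in> ?W" using w' w \<epsilon> e0(1) by (auto simp: dist_commute)
    have yd: "y \<in> fst d" using y e2 \<epsilon> by auto
    have "snd d y \<in> G w' ` cball p r"
    proof (rule brouwer_surjective_near_linear[where K = K, OF _ r(1) L'(1) L'L LL' linL])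
      have "continuous_on (cball p r) (\<lambda>z. (z, w'))" by (intro continuous_intros)
      moreover have "(\<lambda>z. (z, w')) ` cball p r \<subseteq> cball p r \<times> ?W" using W by blast
      ultimately have "continuous_on (cball p r) (\<lambda>z. (\<lambda>(z, w'). G w' z) (z, w'))"
        by (rule continuous_on_compose2[OF contG])
      then show "continuous_on (cball p r) (G w')" by simp
      show "norm (L' v) \<le> K * norm v" for v using K(2)[of v] by (simp add: mult.commute)
      fix z assume z: "z \<in> cball p r"
      have "dist (z, w') (z, w) < e1" using w' \<epsilon> by (simp add: dist_Pair_Pair)
      then have 1: "norm (G w' z - G w z) \<le> r / (4 * K)"
        using e1(2)[of "(z, w)" "(z, w')"] z W by (auto simp: dist_norm)
      have "norm (G w z - G w p - L (z - p)) \<le> 1 / (4 * K) * norm (z - p)"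
        using z r by (intro r1) (auto simp: dist_norm norm_minus_commute)
      also have "\<dots> \<le> 1 / (4 * K) * r"
        using z K by (intro mult_left_mono) (auto simp: dist_norm norm_minus_commute)
      finally have 2: "norm (G w z - G w p - L (z - p)) \<le> r / (4 * K)" by simp
      have 3: "norm (G w p - snd d y) \<le> r / (4 * K)"
        using e3(2)[OF yd] y \<epsilon> by (simp add: G_def cp dist_norm norm_minus_commute dist_commute)
      have "norm (G w' z - snd d y - L (z - p)) =
          norm ((G w' z - G w z) + (G w z - G w p - L (z - p)) + (G w p - snd d y))" by (simp add: algebra_simps)
      also have "\<dots> \<le> r / (4 * K) + r / (4 * K) + r / (4 * K)"
        by (intro norm_triangle_mono 1 2 3)
      finally have "norm (G w' z - snd d y - L (z - p)) \<le> r / (4 * K) + r / (4 * K) + r / (4 * K)" .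
      then have "K * norm (G w' z - snd d y - L (z - p)) \<le> K * (r / (4 * K) + r / (4 * K) + r / (4 * K))"
        using K by (intro mult_left_mono) auto
      also have "\<dots> \<le> r" using K r by (simp add: field_simps)
      finally show "K * norm (G w' z - snd d y - L (z - p)) \<le> r" .
    qed
    then obtain z where z: "z \<in> cball p r" "snd d y = snd d (g (chart_inv c z) w')"
      by (auto simp: G_def)
    then have "y = g (chart_inv c z) w'"
      using inj_d[OF yd] inj_d[OF in_d[OF z(1) W(1)]] by metis
    moreover have "chart_inv c z \<in> U" using r2(2) z(1) r by (auto simp: subset_eq)
    ultimately show "y \<in> (\<lambda>y. g y w') ` U" by blast
  qed
qed

section \<open>Semi-continuous critical sets and interiors of noise events\<close>

locale critical_family =
  fixes \<sigma> :: real and C :: "real ^ 'k::finite \<Rightarrow> 'a::metric_space set"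
  assumes closed_C: "\<And>w. w \<in> noise_cube \<sigma> \<Longrightarrow> closed (C w)"
    and usc: "\<And>w \<epsilon>. w \<in> noise_cube \<sigma> \<Longrightarrow> 0 < \<epsilon> \<Longrightarrow> \<exists>\<delta>>0. \<forall>w'\<in>noise_cube \<sigma>.
        dist w' w < \<delta> \<longrightarrow> C w' \<subseteq> (\<Union>y\<in>C w. ball y \<epsilon>)"
begin

text \<open>Upper semi-continuity lets the critical sets near \<open>w\<close> spill only slightly
  out of \<open>C w\<close>, so the distance cannot drop by much. Equal emptiness has to be
  demanded: a nearby empty critical set has distance 1 by convention, which may be less than
  \<open>t\<close>.\<close>

lemma crit_dist_lsc:
  assumes w: "w \<in> noise_cube \<sigma>" and t: "t < crit_dist x (C w)"
  shows "\<exists>e>0. \<forall>x' w'. dist x' x < e \<longrightarrow> w' \<in> noise_cube \<sigma> \<longrightarrow> dist w' w < e \<longrightarrow> (C w' = {} \<longleftrightarrow> C w = {}) \<longrightarrow>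
           t < crit_dist x' (C w')"
proof (cases "C w = {}")
  case True
  then show ?thesis using t by (intro exI[of _ 1]) (auto simp: crit_dist_def)
next
  case False
  \<comment> \<open>The slack is split in three: for moving \<open>x\<close>, for moving the
    critical set, and for keeping the inequality strict after passing to the infimum.\<close>
  define \<epsilon> where "\<epsilon> = (infdist x (C w) - t) / 3"
  have \<epsilon>: "\<epsilon> > 0" using t False by (simp add: \<epsilon>_def crit_dist_def)
  obtain \<delta> where \<delta>: "\<delta> > 0" "\<And>w'. w' \<in> noise_cube \<sigma> \<Longrightarrow> dist w' w < \<delta> \<Longrightarrow> C w' \<subseteq> (\<Union>y\<in>C w. ball y \<epsilon>)"
    using usc[OF w \<epsilon>] by blast
  show ?thesis
  proof (intro exI[of _ "min \<delta> \<epsilon>"] conjI allI impI)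
    fix x' w' assume *: "dist x' x < min \<delta> \<epsilon>" "w' \<in> noise_cube \<sigma>" "dist w' w < min \<delta> \<epsilon>" "C w' = {} \<longleftrightarrow> C w = {}"
    have ne: "C w' \<noteq> {}" using * False by simp
    have "t + \<epsilon> \<le> dist x' z" if z: "z \<in> C w'" for z
    proof -
      have "z \<in> (\<Union>y\<in>C w. ball y \<epsilon>)" using \<delta>(2)[of w'] * z by auto
      then obtain y where y: "y \<in> C w" "dist y z < \<epsilon>" by auto
      have "infdist x (C w) \<le> dist x y" by (rule infdist_le[OF y(1)])
      also have "\<dots> \<le> dist x' x + dist x' z + dist y z" by metric
      finally show ?thesis using * y \<epsilon>_def by (simp add: field_simps)
    qed
    then have "t + \<epsilon> \<le> infdist x' (C w')"
      using ne unfolding infdist_def by (auto intro!: cINF_greatest)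
    with \<epsilon> ne show "t < crit_dist x' (C w')" by (simp add: crit_dist_def)
  qed (use \<delta> \<epsilon> in auto)
qed

lemma empty_crit_open:
  assumes w: "w \<in> noise_cube \<sigma>" "C w = {}"
  shows "\<exists>e>0. \<forall>w'\<in>noise_cube \<sigma>. dist w' w < e \<longrightarrow> C w' = {}"
  using usc[OF w(1), of 1] w(2) by auto

definition near :: "nat \<Rightarrow> real \<Rightarrow> (nat \<Rightarrow> real ^ 'k) \<Rightarrow> (nat \<Rightarrow> real ^ 'k) \<Rightarrow> bool" where
  "near n \<epsilon> \<omega> \<omega>' \<longleftrightarrow> (\<forall>j\<le>n. dist (\<omega>' j) (\<omega> j) < \<epsilon> \<and> (C (\<omega>' j) = {} \<longleftrightarrow> C (\<omega> j) = {}))"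

lemma near_trans: "near n \<epsilon> \<omega> \<omega>' \<Longrightarrow> near n \<epsilon>' \<omega>' \<omega>'' \<Longrightarrow> near n (\<epsilon> + \<epsilon>') \<omega> \<omega>''"
  unfolding near_def
proof (intro allI impI conjI)
  fix j assume "\<forall>j\<le>n. dist (\<omega>' j) (\<omega> j) < \<epsilon> \<and> (C (\<omega>' j) = {} \<longleftrightarrow> C (\<omega> j) = {})"
    "\<forall>j\<le>n. dist (\<omega>'' j) (\<omega>' j) < \<epsilon>' \<and> (C (\<omega>'' j) = {} \<longleftrightarrow> C (\<omega>' j) = {})" "j \<le> n"
  then have "dist (\<omega>' j) (\<omega> j) < \<epsilon>" "dist (\<omega>'' j) (\<omega>' j) < \<epsilon>'" by auto
  then show "dist (\<omega>'' j) (\<omega> j) < \<epsilon> + \<epsilon>'" by metric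
qed auto

lemma near_mono: "near n \<epsilon> \<omega> \<omega>' \<Longrightarrow> \<epsilon> \<le> \<epsilon>' \<Longrightarrow> near n \<epsilon>' \<omega> \<omega>'"
  unfolding near_def by (meson less_le_trans)

text \<open>
  The interior of an event, as seen through the coordinates up to \<open>n\<close>. Emptiness of a critical set
  counts as a discrete coordinate, because \<open>crit_dist\<close> jumps there.
\<close>

definition inner_event :: "nat \<Rightarrow> (nat \<Rightarrow> real ^ 'k) set \<Rightarrow> (nat \<Rightarrow> real ^ 'k) set" where
  "inner_event n R = {\<omega> \<in> space (noise_seq \<sigma>). \<exists>\<epsilon>>0. \<forall>\<omega>'\<in>space (noise_seq \<sigma>). near n \<epsilon> \<omega> \<omega>' \<longrightarrow> \<omega>' \<in> R}"

lemma inner_event_subset: "inner_event n R \<subseteq> R"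
  by (auto simp: inner_event_def near_def)

lemma inner_event_mono: "R \<subseteq> R' \<Longrightarrow> inner_event n R \<subseteq> inner_event n R'"
  unfolding inner_event_def by blast

lemma inner_event_cong:
  assumes "\<And>j. j \<le> n \<Longrightarrow> \<omega> j = \<omega>' j" "\<omega> \<in> space (noise_seq \<sigma>)" "\<omega>' \<in> space (noise_seq \<sigma>)"
  shows "\<omega> \<in> inner_event n R \<longleftrightarrow> \<omega>' \<in> inner_event n R"
  using assms by (simp add: inner_event_def near_def cong: conj_cong imp_cong)

lemma measurable_noise_seq_borel: "(\<lambda>\<omega>. \<omega>) \<in> noise_seq \<sigma> \<rightarrow>\<^sub>M PiM UNIV (\<lambda>_. borel :: (real ^ 'k) measure)"
proof (rule measurable_PiM_single')
  fix i :: nat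
  have "(\<lambda>\<omega>. \<omega> i) \<in> noise_seq \<sigma> \<rightarrow>\<^sub>M (noise \<sigma> :: (real ^ 'k) measure)"
    unfolding noise_seq_def by (rule measurable_component_singleton) simp
  moreover have "(\<lambda>w. w) \<in> noise \<sigma> \<rightarrow>\<^sub>M (borel :: (real ^ 'k) measure)"
    unfolding measurable_cong_sets[OF sets_noise refl] by (rule measurable_restrict_space1) simp
  ultimately show "(\<lambda>\<omega>. \<omega> i) \<in> noise_seq \<sigma> \<rightarrow>\<^sub>M (borel :: (real ^ 'k) measure)" by (rule measurable_compose)
qed auto

text \<open>There are countably many coordinates, so the product sigma-algebra contains every open
  set of the product topology.\<close>

lemma open_in_noise_seq:
  fixes O1 :: "(nat \<Rightarrow> real ^ 'k) set"
  assumes "open O1"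
  shows "O1 \<inter> space (noise_seq \<sigma>) \<in> sets (noise_seq \<sigma>)"
proof -
  have "O1 \<in> sets (PiM UNIV (\<lambda>_. borel))"
    using assms by (simp add: sets_PiM_equal_borel)
  from measurable_sets[OF measurable_noise_seq_borel this] show ?thesis by simp
qed

lemma empty_crit_relatively_open:
  obtains V :: "(real ^ 'k) set" where "open V" "\<And>w. w \<in> noise_cube \<sigma> \<Longrightarrow> w \<in> V \<longleftrightarrow> C w = {}"
proof -
  define e where "e = (\<lambda>w. SOME e. e > 0 \<and> (\<forall>w'\<in>noise_cube \<sigma>. dist w' w < e \<longrightarrow> C w' = {}))"
  have e: "e w > 0 \<and> (\<forall>w'\<in>noise_cube \<sigma>. dist w' w < e w \<longrightarrow> C w' = {})" if "w \<in> noise_cube \<sigma>" "C w = {}" for w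
    unfolding e_def using empty_crit_open[OF that] by (rule someI_ex)
  define V where "V = (\<Union>w\<in>{w\<in>noise_cube \<sigma>. C w = {}}. ball w (e w))"
  show thesis
  proof (rule that[of V])
    show "open V" by (auto simp: V_def)
    fix w :: "real ^ 'k" assume w: "w \<in> noise_cube \<sigma>"
    show "w \<in> V \<longleftrightarrow> C w = {}"
    proof
      assume "w \<in> V"
      then obtain w0 where "w0 \<in> noise_cube \<sigma>" "C w0 = {}" "w \<in> ball w0 (e w0)"
        unfolding V_def by blast
      with e[of w0] w show "C w = {}" by (simp add: dist_commute)
    next
      assume "C w = {}"
      with e[OF w] w show "w \<in> V" unfolding V_def by (intro UN_I[of w]) auto
    qed
  qed
qed

lemma empty_crit_sets: "{\<omega> \<in> space (noise_seq \<sigma>). C (\<omega> j) = {}} \<in> sets (noise_seq \<sigma>)"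
proof -
  obtain V where V: "open V" "\<And>w. w \<in> noise_cube \<sigma> \<Longrightarrow> w \<in> V \<longleftrightarrow> C w = {}"
    by (rule empty_crit_relatively_open) blast
  have "open ((\<lambda>\<omega>. \<omega> j) -` V)"
    by (intro open_vimage V(1) continuous_on_product_coordinates)
  from open_in_noise_seq[OF this]
  have "(\<lambda>\<omega>. \<omega> j) -` V \<inter> space (noise_seq \<sigma>) \<in> sets (noise_seq \<sigma>)" .
  also have "(\<lambda>\<omega>. \<omega> j) -` V \<inter> space (noise_seq \<sigma>) = {\<omega> \<in> space (noise_seq \<sigma>). C (\<omega> j) = {}}"
    using V(2) by (auto simp: space_noise_seq)
  finally show ?thesis .
qed

text \<open>No measurability of \<open>R\<close> is assumed. Once the pattern \<open>e\<close> of
  empty critical sets among the coordinates up to \<open>n\<close> is fixed, nearness is an open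
  cylinder condition; so on each of the finitely many measurable pieces \<open>P e\<close> the inner
  event is relatively open.\<close>

lemma inner_event_sets: "inner_event n R \<in> sets (noise_seq \<sigma>)"
proof -
  let ?\<Omega> = "space (noise_seq \<sigma>)"
  define P where "P = (\<lambda>e. {\<omega> \<in> ?\<Omega>. \<forall>j\<le>n. C (\<omega> j) = {} \<longleftrightarrow> j \<in> e})"
  have P: "P e \<in> sets (noise_seq \<sigma>)" for e
  proof -
    have *: "{\<omega> \<in> ?\<Omega>. C (\<omega> j) = {} \<longleftrightarrow> j \<in> e} \<in> sets (noise_seq \<sigma>)" for j
      using empty_crit_sets[of j] sets.sets_Collect_neg[OF empty_crit_sets[of j]] by (cases "j \<in> e") auto
    have "P e = (\<Inter>j\<in>{..n}. {\<omega> \<in> ?\<Omega>. C (\<omega> j) = {} \<longleftrightarrow> j \<in> e})"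
      by (auto simp: P_def)
    also have "\<dots> \<in> sets (noise_seq \<sigma>)" using * by (intro sets.finite_INT) auto
    finally show ?thesis .
  qed
  define Q where "Q = (\<lambda>e. \<Union>\<omega>\<in>P e. \<Union>\<epsilon>\<in>{\<epsilon>. \<epsilon> > 0 \<and> (\<forall>\<omega>'\<in>?\<Omega>. near n \<epsilon> \<omega> \<omega>' \<longrightarrow> \<omega>' \<in> R)}.
     \<Inter>j\<in>{..n}. (\<lambda>\<omega>'. \<omega>' j) -` ball (\<omega> j) (\<epsilon> / 2))"
  have Q: "open (Q e)" for e
    unfolding Q_def
    by (intro open_UN ballI open_INT open_vimage continuous_on_product_coordinates) auto
  have "inner_event n R = (\<Union>e\<in>Pow {..n}. P e \<inter> (Q e \<inter> ?\<Omega>))"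
  proof (intro equalityI subsetI)
    fix \<omega> assume "\<omega> \<in> inner_event n R"
    then obtain \<epsilon> where *: "\<omega> \<in> ?\<Omega>" "\<epsilon> > 0" "\<forall>\<omega>'\<in>?\<Omega>. near n \<epsilon> \<omega> \<omega>' \<longrightarrow> \<omega>' \<in> R"
      by (auto simp: inner_event_def)
    let ?e = "{j \<in> {..n}. C (\<omega> j) = {}}"
    have Pe: "\<omega> \<in> P ?e" using * by (auto simp: P_def)
    have "\<omega> \<in> (\<Inter>j\<in>{..n}. (\<lambda>\<omega>'. \<omega>' j) -` ball (\<omega> j) (\<epsilon> / 2))" using *(2) by simp
    with Pe *(2,3) have "\<omega> \<in> Q ?e" unfolding Q_def
      by (intro UN_I[of \<omega>] UN_I[of \<epsilon>] CollectI conjI)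
    with Pe *(1) show "\<omega> \<in> (\<Union>e\<in>Pow {..n}. P e \<inter> (Q e \<inter> ?\<Omega>))"
      by (intro UN_I[of ?e] IntI) auto
  next
    fix \<omega>' assume "\<omega>' \<in> (\<Union>e\<in>Pow {..n}. P e \<inter> (Q e \<inter> ?\<Omega>))"
    then obtain e where e: "\<omega>' \<in> P e" "\<omega>' \<in> Q e" "\<omega>' \<in> ?\<Omega>" by (elim UN_E IntE)
    from e(2) obtain \<omega> \<epsilon> where *: "\<omega> \<in> P e" "\<epsilon> > 0" "\<forall>\<omega>'\<in>?\<Omega>. near n \<epsilon> \<omega> \<omega>' \<longrightarrow> \<omega>' \<in> R"
      and close: "\<omega>' \<in> (\<Inter>j\<in>{..n}. (\<lambda>\<omega>'. \<omega>' j) -` ball (\<omega> j) (\<epsilon> / 2))" unfolding Q_def by (elim UN_E CollectE conjE)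
    \<comment> \<open>The cylinders have half the radius, so every \<open>\<omega>'\<close> in one
      of them still has a neighbourhood of radius \<open>\<epsilon> / 2\<close> inside
      \<open>R\<close>.\<close>
    have "near n (\<epsilon> / 2) \<omega> \<omega>'" using e *(1) close by (auto simp: near_def P_def dist_commute)
    then have "near n \<epsilon> \<omega> \<omega>''" if "near n (\<epsilon> / 2) \<omega>' \<omega>''" for \<omega>''
      using near_trans[of n "\<epsilon> / 2" \<omega> \<omega>' "\<epsilon> / 2" \<omega>''] that by simp
    with *(3) have "\<forall>\<omega>''\<in>?\<Omega>. near n (\<epsilon> / 2) \<omega>' \<omega>'' \<longrightarrow> \<omega>'' \<in> R" by blast
    moreover have "\<epsilon> / 2 > 0" using *(2) by simp
    ultimately show "\<omega>' \<in> inner_event n R"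
      unfolding inner_event_def using e(3) by (intro CollectI conjI exI[of _ "\<epsilon> / 2"])
  qed
  also have "\<dots> \<in> sets (noise_seq \<sigma>)"
    by (intro sets.finite_UN sets.Int P open_in_noise_seq Q) simp
  finally show ?thesis .
qed

end

text \<open>A real infimum bounds its terms only for a family bounded below: the outer one ranges
  over finitely many times, the inner one over nonnegative values.\<close>

lemma INF_INF_greater:
  fixes F :: "nat \<Rightarrow> 'b \<Rightarrow> real"
  assumes "(INF j\<in>{..i}. INF x\<in>B. F j x) > t" "\<And>j x. 0 \<le> F j x" "j \<le> i" "x \<in> B"
  shows "F j x > t"
proof -
  have "(INF j\<in>{..i}. INF x\<in>B. F j x) \<le> (INF x\<in>B. F j x)"
    using assms(3) by (intro cINF_lower) auto
  also have "\<dots> \<le> F j x"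
    using assms(2,4) by (intro cINF_lower bdd_belowI2[of _ 0]) auto
  finally show ?thesis using assms(1) by simp
qed

lemma crit_dist_nonneg: "0 \<le> crit_dist x S"
  by (simp add: crit_dist_def infdist_nonneg)

lemma crit_dist_zero: "x \<in> S \<Longrightarrow> crit_dist x S = 0"
  by (auto simp: crit_dist_def)

section \<open>Robustness of reach events under changes of noise and centre\<close>

locale regular_family = critical_family \<sigma> C
  for \<sigma> :: real and C :: "real ^ 'k::finite \<Rightarrow> 'a::metric_space set" +
  fixes M :: "('a, 'k) manifold" and g :: "'a \<Rightarrow> real ^ 'k \<Rightarrow> 'a"
  assumes atlas: "smooth_atlas M"
    and compact_M: "compact (UNIV :: 'a set)"
    and sigma_pos: "0 < \<sigma>"
    and cont_g: "continuous_on (UNIV \<times> noise_cube \<sigma>) (\<lambda>(x, w). g x w)"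
    and C_eq: "\<And>w. w \<in> noise_cube \<sigma> \<Longrightarrow> C w = {x. \<not> regular_at M (\<lambda>y. g y w) x}"
begin

lemma rmap_iter_robustly_continuous:
  assumes \<omega>: "\<omega> \<in> space (noise_seq \<sigma>)" and e: "0 < e"
  shows "\<exists>\<epsilon>>0. \<forall>\<omega>'\<in>space (noise_seq \<sigma>). (\<forall>l<j. dist (\<omega>' l) (\<omega> l) < \<epsilon>) \<longrightarrow>
           (\<forall>z. dist z q < \<epsilon> \<longrightarrow> dist (rmap_iter g j \<omega>' z) (rmap_iter g j \<omega> q) < e)"
  using e
proof (induction j arbitrary: e)
  case 0
  then show ?case by auto
next
  case (Suc j)
  let ?p = "(rmap_iter g j \<omega> q, \<omega> j)"
  have "?p \<in> UNIV \<times> noise_cube \<sigma>" using \<omega> by (auto simp: space_noise_seq)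
  from bspec[OF cont_g[unfolded continuous_on_iff] this] Suc.prems
  obtain d where d: "d > 0" "\<And>v. v \<in> UNIV \<times> noise_cube \<sigma> \<Longrightarrow> dist v ?p < d \<Longrightarrow>
      dist ((\<lambda>(x, w). g x w) v) ((\<lambda>(x, w). g x w) ?p) < e" by meson
  obtain \<epsilon> where \<epsilon>: "\<epsilon> > 0" "\<And>\<omega>' z. \<omega>' \<in> space (noise_seq \<sigma>) \<Longrightarrow> (\<forall>l<j. dist (\<omega>' l) (\<omega> l) < \<epsilon>) \<Longrightarrow>
           dist z q < \<epsilon> \<Longrightarrow> dist (rmap_iter g j \<omega>' z) (rmap_iter g j \<omega> q) < d / 2"
    using Suc.IH[of "d / 2"] d(1) by (meson half_gt_zero)
  show ?case
  proof (intro exI[of _ "min \<epsilon> (d / 2)"] conjI ballI allI impI)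
    fix \<omega>' z assume *: "\<omega>' \<in> space (noise_seq \<sigma>)" "\<forall>l<Suc j. dist (\<omega>' l) (\<omega> l) < min \<epsilon> (d / 2)" "dist z q < min \<epsilon> (d / 2)"
    have "dist (rmap_iter g j \<omega>' z, \<omega>' j) ?p \<le> dist (rmap_iter g j \<omega>' z) (rmap_iter g j \<omega> q) + dist (\<omega>' j) (\<omega> j)"
      unfolding dist_Pair_Pair by (rule sqrt_sum_squares_le_sum) auto
    also have "\<dots> < d" using \<epsilon>(2)[of \<omega>' z] * by force
    finally show "dist (rmap_iter g (Suc j) \<omega>' z) (rmap_iter g (Suc j) \<omega> q) < e"
      using d(2)[of "(rmap_iter g j \<omega>' z, \<omega>' j)"] * unfolding rmap_iter_Suc_apply by (simp add: space_noise_seq)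
  qed (use \<epsilon> d in auto)
qed

text \<open>One application of \<open>regular_robustly_open\<close> per step, each to a ball already
  covered by the previous steps. The image at time \<open>i\<close> itself may be critical, since no
  map is applied to it.\<close>

lemma rmap_iter_robustly_open:
  assumes \<omega>: "\<omega> \<in> space (noise_seq \<sigma>)"
    and reg: "\<And>j. j < i \<Longrightarrow> rmap_iter g j \<omega> q \<notin> C (\<omega> j)"
    and U: "open U" "q \<in> U"
  shows "\<exists>\<epsilon>>0. \<forall>\<omega>'\<in>space (noise_seq \<sigma>). (\<forall>l<i. dist (\<omega>' l) (\<omega> l) < \<epsilon>) \<longrightarrow>
           ball (rmap_iter g i \<omega> q) \<epsilon> \<subseteq> rmap_iter g i \<omega>' ` U"
  using reg
proof (induction i)
  case 0
  from U obtain e where "e > 0" "ball q e \<subseteq> U" using open_contains_ball by blast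
  then show ?case by auto
next
  case (Suc i)
  from Suc.IH Suc.prems obtain e1 where e1: "e1 > 0"
    "\<And>\<omega>'. \<omega>' \<in> space (noise_seq \<sigma>) \<Longrightarrow> (\<forall>l<i. dist (\<omega>' l) (\<omega> l) < e1) \<Longrightarrow> ball (rmap_iter g i \<omega> q) e1 \<subseteq> rmap_iter g i \<omega>' ` U"
    by (meson less_SucI)
  have w: "\<omega> i \<in> noise_cube \<sigma>" using \<omega> by (simp add: space_noise_seq)
  have "regular_at M (\<lambda>y. g y (\<omega> i)) (rmap_iter g i \<omega> q)"
    using Suc.prems[of i] C_eq[OF w] by simp
  from regular_robustly_open[OF atlas cont_g w this, of "ball (rmap_iter g i \<omega> q) e1"] e1(1)
  obtain e2 where e2: "e2 > 0" "\<And>w'. w' \<in> noise_cube \<sigma> \<Longrightarrow> dist w' (\<omega> i) < e2 \<Longrightarrow>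
      ball (g (rmap_iter g i \<omega> q) (\<omega> i)) e2 \<subseteq> (\<lambda>y. g y w') ` ball (rmap_iter g i \<omega> q) e1"
    by (auto simp del: ball_eq_empty)
  show ?case
  proof (intro exI[of _ "min e1 e2"] conjI ballI impI)
    fix \<omega>' assume *: "\<omega>' \<in> space (noise_seq \<sigma>)" "\<forall>l<Suc i. dist (\<omega>' l) (\<omega> l) < min e1 e2"
    have "ball (rmap_iter g (Suc i) \<omega> q) (min e1 e2) \<subseteq> ball (g (rmap_iter g i \<omega> q) (\<omega> i)) e2"
      unfolding rmap_iter_Suc_apply by auto
    also have "\<dots> \<subseteq> (\<lambda>y. g y (\<omega>' i)) ` ball (rmap_iter g i \<omega> q) e1"
      using * by (intro e2) (auto simp: space_noise_seq)
    also have "\<dots> \<subseteq> (\<lambda>y. g y (\<omega>' i)) ` (rmap_iter g i \<omega>' ` U)"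
      using * by (intro image_mono e1) auto
    also have "\<dots> = rmap_iter g (Suc i) \<omega>' ` U"
      unfolding rmap_iter_Suc_apply by (simp add: image_image)
    finally show "ball (rmap_iter g (Suc i) \<omega> q) (min e1 e2) \<subseteq> rmap_iter g (Suc i) \<omega>' ` U" .
  qed (use e1 e2 in auto)
qed

lemma crit_dist_rmap_iter_lsc:
  assumes \<omega>: "\<omega> \<in> space (noise_seq \<sigma>)" and t: "t < crit_dist (rmap_iter g j \<omega> q) (C (\<omega> j))"
  shows "\<exists>\<epsilon>>0. \<forall>\<omega>'\<in>space (noise_seq \<sigma>). near j \<epsilon> \<omega> \<omega>' \<longrightarrow>
           (\<forall>z. dist z q < \<epsilon> \<longrightarrow> t < crit_dist (rmap_iter g j \<omega>' z) (C (\<omega>' j)))"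
proof -
  have w: "\<omega> j \<in> noise_cube \<sigma>" using \<omega> by (simp add: space_noise_seq)
  from crit_dist_lsc[OF w t] obtain e where e: "e > 0"
    "\<And>x' w'. dist x' (rmap_iter g j \<omega> q) < e \<Longrightarrow> w' \<in> noise_cube \<sigma> \<Longrightarrow> dist w' (\<omega> j) < e \<Longrightarrow>
       (C w' = {} \<longleftrightarrow> C (\<omega> j) = {}) \<Longrightarrow> t < crit_dist x' (C w')" by metis
  from rmap_iter_robustly_continuous[OF \<omega> e(1), of j q] obtain \<epsilon> where \<epsilon>: "\<epsilon> > 0"
    "\<And>\<omega>' z. \<omega>' \<in> space (noise_seq \<sigma>) \<Longrightarrow> (\<forall>l<j. dist (\<omega>' l) (\<omega> l) < \<epsilon>) \<Longrightarrow> dist z q < \<epsilon> \<Longrightarrow>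
        dist (rmap_iter g j \<omega>' z) (rmap_iter g j \<omega> q) < e" by metis
  show ?thesis
  proof (intro exI[of _ "min \<epsilon> e"] conjI ballI allI impI)
    fix \<omega>' z assume "\<omega>' \<in> space (noise_seq \<sigma>)" "near j (min \<epsilon> e) \<omega> \<omega>'" "dist z q < min \<epsilon> e"
    then show "t < crit_dist (rmap_iter g j \<omega>' z) (C (\<omega>' j))"
      by (intro e(2) \<epsilon>(2)) (auto simp: near_def space_noise_seq)
  qed (use \<epsilon> e in auto)
qed

text \<open>The local form of the openness of reach events, for a single point \<open>q\<close> and
  its image. The distance bounds are open conditions in the point and the noise, so they persist on
  a small ball \<open>U\<close> around \<open>q\<close>, whose perturbed image still covers a ball
  around \<open>rmap_iter g i \<omega> q\<close>.\<close>

lemma point_robustly_reached: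
  assumes \<omega>: "\<omega> \<in> space (noise_seq \<sigma>)" and t: "0 < t" and i: "i \<le> N"
    and crit: "\<And>j. j \<le> i \<Longrightarrow> t < crit_dist (rmap_iter g j \<omega> q) (C (\<omega> j))"
    and q: "q \<in> ball y \<delta>"
  shows "\<exists>s \<epsilon> U. s < \<delta> \<and> 0 < \<epsilon> \<and> U \<subseteq> ball y s \<and> (\<forall>\<omega>'\<in>space (noise_seq \<sigma>). near N \<epsilon> \<omega> \<omega>' \<longrightarrow>
      ball (rmap_iter g i \<omega> q) \<epsilon> \<subseteq> rmap_iter g i \<omega>' ` U \<and>
      (\<forall>j\<le>i. \<forall>z\<in>U. t < crit_dist (rmap_iter g j \<omega>' z) (C (\<omega>' j))))"
proof -
  have "\<exists>\<epsilon>. \<forall>j\<le>i. \<epsilon> j > 0 \<and> (\<forall>\<omega>'\<in>space (noise_seq \<sigma>). near j (\<epsilon> j) \<omega> \<omega>' \<longrightarrow>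
           (\<forall>z. dist z q < \<epsilon> j \<longrightarrow> t < crit_dist (rmap_iter g j \<omega>' z) (C (\<omega>' j))))"
    using crit_dist_rmap_iter_lsc[OF \<omega> crit] by metis
  then obtain \<epsilon> where \<epsilon>: "\<And>j. j \<le> i \<Longrightarrow> \<epsilon> j > 0"
    "\<And>j \<omega>' z. j \<le> i \<Longrightarrow> \<omega>' \<in> space (noise_seq \<sigma>) \<Longrightarrow> near j (\<epsilon> j) \<omega> \<omega>' \<Longrightarrow> dist z q < \<epsilon> j \<Longrightarrow>
       t < crit_dist (rmap_iter g j \<omega>' z) (C (\<omega>' j))" by metis
  define e where "e = Min (\<epsilon> ` {..i})"
  have e: "e > 0" "\<And>j. j \<le> i \<Longrightarrow> e \<le> \<epsilon> j"
    using \<epsilon>(1) by (auto simp: e_def)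
  \<comment> \<open>Midway between the distance of \<open>q\<close> from the centre and \<delta>,
    which leaves room for \<open>U\<close> in a strictly smaller ball.\<close>
  define s where "s = (dist y q + \<delta>) / 2"
  have s: "s < \<delta>" "dist y q < s" using q by (auto simp: s_def)
  define U where "U = ball q (min e (s - dist y q))"
  have U: "open U" "q \<in> U" using e s by (auto simp: U_def)
  have "rmap_iter g j \<omega> q \<notin> C (\<omega> j)" if "j < i" for j
    using crit[of j] that t crit_dist_zero by fastforce
  from rmap_iter_robustly_open[OF \<omega> this U] obtain e' where e': "e' > 0"
    "\<And>\<omega>'. \<omega>' \<in> space (noise_seq \<sigma>) \<Longrightarrow> (\<forall>l<i. dist (\<omega>' l) (\<omega> l) < e') \<Longrightarrow> ball (rmap_iter g i \<omega> q) e' \<subseteq> rmap_iter g i \<omega>' ` U"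
    by metis
  show ?thesis
  proof (rule exI[of _ s], rule exI[of _ "min e e'"], rule exI[of _ U], intro conjI ballI allI impI)
    show "U \<subseteq> ball y s"
    proof
      fix z assume "z \<in> U"
      then have "dist q z < s - dist y q" by (simp add: U_def)
      moreover have "dist y z \<le> dist y q + dist q z" by (rule dist_triangle)
      ultimately show "z \<in> ball y s" by simp
    qed
    fix \<omega>' assume *: "\<omega>' \<in> space (noise_seq \<sigma>)" "near N (min e e') \<omega> \<omega>'"
    have "ball (rmap_iter g i \<omega> q) (min e e') \<subseteq> ball (rmap_iter g i \<omega> q) e'" by auto
    also have "\<dots> \<subseteq> rmap_iter g i \<omega>' ` U"
      using * i by (intro e') (auto simp: near_def)
    finally show "ball (rmap_iter g i \<omega> q) (min e e') \<subseteq> rmap_iter g i \<omega>' ` U" .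
    fix j z assume jz: "j \<le> i" "z \<in> U"
    have "near N e \<omega> \<omega>'" by (rule near_mono[OF *(2)]) simp
    then have "near j e \<omega> \<omega>'" using jz(1) i by (simp add: near_def)
    then have "near j (\<epsilon> j) \<omega> \<omega>'" using near_mono e(2)[OF jz(1)] by blast
    moreover have "dist z q < \<epsilon> j" using jz e(2)[of j] by (auto simp: U_def dist_commute)
    ultimately show "t < crit_dist (rmap_iter g j \<omega>' z) (C (\<omega>' j))"
      using jz * by (intro \<epsilon>(2))
  qed (use s e e' in auto)
qed

lemma reach_event_mono: "B \<subseteq> B' \<Longrightarrow> reach_event \<sigma> g C N \<iota> \<Delta> B \<subseteq> reach_event \<sigma> g C N \<iota> \<Delta> B'"
  unfolding reach_event_def by (blast intro: subset_trans)

text \<open>Every point of the compact set \<open>closure \<Delta>\<close> is reached robustly. A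
  finite subcover yields a common tolerance \<open>e\<close> and a common radius \<open>s'\<close>,
  and the union \<open>B\<close> of the finitely many neighbourhoods replaces the original set
  \<open>B'\<close>.\<close>

lemma reach_event_inner:
  assumes \<iota>: "0 < \<iota>" and \<Delta>: "\<Delta> \<noteq> {}" and \<omega>: "\<omega> \<in> reach_event \<sigma> g C N \<iota> \<Delta> (ball y \<delta>)"
  shows "\<exists>s<\<delta>. \<omega> \<in> inner_event N (reach_event \<sigma> g C N \<iota> \<Delta> (ball y s))"
proof -
  from \<omega> obtain i B' where \<omega>S: "\<omega> \<in> space (noise_seq \<sigma>)" and i: "i \<le> N" and B': "B' \<subseteq> ball y \<delta>" "\<Delta> \<Subset> rmap_iter g i \<omega> ` B'"
    and inf: "(INF j\<in>{..i}. INF x\<in>B'. crit_dist (rmap_iter g j \<omega> x) (C (\<omega> j))) > \<iota>"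
    by (auto simp: reach_event_def)
  \<comment> \<open>A margin above \<iota>: strict pointwise bounds by \<open>t\<close> only give an
    infimum that is at least \<open>t\<close>.\<close>
  obtain t where t: "\<iota> < t" "(INF j\<in>{..i}. INF x\<in>B'. crit_dist (rmap_iter g j \<omega> x) (C (\<omega> j))) > t"
    using dense[OF inf] by blast
  have crit: "t < crit_dist (rmap_iter g j \<omega> q) (C (\<omega> j))" if "j \<le> i" "q \<in> B'" for j q
    using INF_INF_greater[OF t(2) crit_dist_nonneg that] .
  define Q where "Q = (\<lambda>p s \<epsilon> U. s < \<delta> \<and> 0 < \<epsilon> \<and> U \<subseteq> ball y s \<and> (\<forall>\<omega>'\<in>space (noise_seq \<sigma>). near N \<epsilon> \<omega> \<omega>' \<longrightarrow>
      ball p \<epsilon> \<subseteq> rmap_iter g i \<omega>' ` U \<and>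
      (\<forall>j\<le>i. \<forall>z\<in>U. t < crit_dist (rmap_iter g j \<omega>' z) (C (\<omega>' j)))))"
  have "\<exists>s \<epsilon> U. Q p s \<epsilon> U" if p: "p \<in> closure \<Delta>" for p
  proof -
    have "p \<in> rmap_iter g i \<omega> ` B'" using p B'(2) interior_subset by (auto simp: compactly_inside_def)
    then obtain q where q: "q \<in> B'" "p = rmap_iter g i \<omega> q" by blast
    show ?thesis unfolding q(2) Q_def
      by (rule point_robustly_reached[OF \<omega>S _ i crit]) (use \<iota> t q B' in auto)
  qed
  then obtain s \<epsilon> U where "\<And>p. p \<in> closure \<Delta> \<Longrightarrow> Q p (s p) (\<epsilon> p) (U p)" by metis
  then have sU: "\<And>p. p \<in> closure \<Delta> \<Longrightarrow> s p < \<delta>" "\<And>p. p \<in> closure \<Delta> \<Longrightarrow> 0 < \<epsilon> p"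
    "\<And>p. p \<in> closure \<Delta> \<Longrightarrow> U p \<subseteq> ball y (s p)"
    and reach: "\<And>p \<omega>'. p \<in> closure \<Delta> \<Longrightarrow> \<omega>' \<in> space (noise_seq \<sigma>) \<Longrightarrow> near N (\<epsilon> p) \<omega> \<omega>' \<Longrightarrow>
      ball p (\<epsilon> p) \<subseteq> rmap_iter g i \<omega>' ` U p"
    and far: "\<And>p \<omega>' j z. p \<in> closure \<Delta> \<Longrightarrow> \<omega>' \<in> space (noise_seq \<sigma>) \<Longrightarrow> near N (\<epsilon> p) \<omega> \<omega>' \<Longrightarrow>
      j \<le> i \<Longrightarrow> z \<in> U p \<Longrightarrow> t < crit_dist (rmap_iter g j \<omega>' z) (C (\<omega>' j))"
    unfolding Q_def by blast+
  have "compact (closure \<Delta>)" using compact_M compact_Int_closed[of UNIV "closure \<Delta>"] by simp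
  moreover have "closure \<Delta> \<subseteq> (\<Union>p\<in>closure \<Delta>. ball p (\<epsilon> p))" using sU(2) by auto
  ultimately obtain P where P: "P \<subseteq> closure \<Delta>" "finite P" "closure \<Delta> \<subseteq> (\<Union>p\<in>P. ball p (\<epsilon> p))"
    by (elim compactE_image[of _ "closure \<Delta>" "\<lambda>p. ball p (\<epsilon> p)"]) auto
  \<comment> \<open>Nonemptiness of \<Delta> enters here; it makes the minimum and the maximum over
    \<open>P\<close> meaningful.\<close>
  have Pne: "P \<noteq> {}" using P(3) \<Delta> closure_subset by fastforce
  define e where "e = Min (\<epsilon> ` P)"
  define s' where "s' = Max (s ` P)"
  define B where "B = (\<Union>p\<in>P. U p)"
  have e: "e > 0" "\<And>p. p \<in> P \<Longrightarrow> e \<le> \<epsilon> p" using P Pne sU(2) by (auto simp: e_def)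
  have s': "s' < \<delta>" "\<And>p. p \<in> P \<Longrightarrow> s p \<le> s'" using P Pne sU(1) by (auto simp: s'_def)
  have BU: "B \<subseteq> ball y s'"
  proof
    fix z assume "z \<in> B"
    then obtain p where "p \<in> P" "z \<in> U p" by (auto simp: B_def)
    then show "z \<in> ball y s'" using sU(3)[of p] s'(2)[of p] P(1) by fastforce
  qed
  have "\<omega>' \<in> reach_event \<sigma> g C N \<iota> \<Delta> (ball y s')" if \<omega>': "\<omega>' \<in> space (noise_seq \<sigma>)" "near N e \<omega> \<omega>'" for \<omega>'
  proof -
    have nr: "near N (\<epsilon> p) \<omega> \<omega>'" if "p \<in> P" for p using near_mono[OF \<omega>'(2) e(2)[OF that]] .
    have "(\<Union>p\<in>P. ball p (\<epsilon> p)) \<subseteq> (\<Union>p\<in>P. rmap_iter g i \<omega>' ` U p)"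
      using reach[OF _ \<omega>'(1) nr] P(1) by (intro UN_mono) auto
    also have "\<dots> = rmap_iter g i \<omega>' ` B" by (auto simp: B_def)
    finally have "(\<Union>p\<in>P. ball p (\<epsilon> p)) \<subseteq> interior (rmap_iter g i \<omega>' ` B)"
      by (intro interior_maximal) auto
    with P(3) have cov: "\<Delta> \<Subset> rmap_iter g i \<omega>' ` B" by (auto simp: compactly_inside_def)
    then have "\<Delta> \<subseteq> rmap_iter g i \<omega>' ` B"
      using closure_subset interior_subset unfolding compactly_inside_def by (meson subset_trans)
    with \<Delta> have Bne: "B \<noteq> {}" by auto
    have "t \<le> (INF j\<in>{..i}. INF x\<in>B. crit_dist (rmap_iter g j \<omega>' x) (C (\<omega>' j)))"
    proof (intro cINF_greatest less_imp_le)
      fix j z assume "j \<in> {..i}" "z \<in> B"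
      then show "t < crit_dist (rmap_iter g j \<omega>' z) (C (\<omega>' j))"
        using far[OF _ \<omega>'(1) nr] P(1) by (auto simp: B_def)
    qed (use Bne in auto)
    with t(1) have "\<iota> < (INF j\<in>{..i}. INF x\<in>B. crit_dist (rmap_iter g j \<omega>' x) (C (\<omega>' j)))" by simp
    with \<omega>'(1) i BU cov show ?thesis unfolding reach_event_def by blast
  qed
  then show ?thesis using s' e \<omega>S unfolding inner_event_def by blast
qed

text \<open>The inner events grow with the radius and, by \<open>reach_event_inner\<close>, cover
  the reach event of the full ball as the radius tends to \<delta>. Continuity of the measure from
  below passes the strict bound to some smaller radius.\<close>

lemma inner_reach_event_likely:
  assumes \<iota>: "0 < \<iota>" and \<Delta>: "\<Delta> \<noteq> {}" and \<rho>: "0 \<le> \<rho>"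
    and likely: "\<rho> < measure (noise_seq \<sigma>) (reach_event \<sigma> g C N \<iota> \<Delta> (ball y \<delta>))"
  shows "\<exists>s<\<delta>. \<rho> < measure (noise_seq \<sigma>) (inner_event N (reach_event \<sigma> g C N \<iota> \<Delta> (ball y s)))"
proof -
  interpret prob_space "noise_seq \<sigma> :: (nat \<Rightarrow> real ^ 'k) measure" using noise_seq_prob[OF sigma_pos] .
  let ?s = "\<lambda>n. \<delta> - 1 / real (Suc n)"
  let ?I = "\<lambda>n. inner_event N (reach_event \<sigma> g C N \<iota> \<Delta> (ball y (?s n)))"
  have "incseq ?I"
    by (intro incseq_SucI inner_event_mono reach_event_mono subset_ball) (simp add: field_simps)
  then have lim: "(\<lambda>n. prob (?I n)) \<longlonglongrightarrow> prob (\<Union>n. ?I n)"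
    using inner_event_sets by (intro finite_Lim_measure_incseq) auto
  have "reach_event \<sigma> g C N \<iota> \<Delta> (ball y \<delta>) \<subseteq> (\<Union>n. ?I n)"
  proof
    fix \<omega> assume "\<omega> \<in> reach_event \<sigma> g C N \<iota> \<Delta> (ball y \<delta>)"
    from reach_event_inner[OF \<iota> \<Delta> this] obtain s where s: "s < \<delta>"
      "\<omega> \<in> inner_event N (reach_event \<sigma> g C N \<iota> \<Delta> (ball y s))" by blast
    obtain n where "1 / real (Suc n) < \<delta> - s" using s(1) nat_approx_posE[of "\<delta> - s"] by auto
    then have "ball y s \<subseteq> ball y (?s n)" by (intro subset_ball) simp
    from s(2) subsetD[OF inner_event_mono[OF reach_event_mono[OF this]]] have "\<omega> \<in> ?I n" by simp
    then show "\<omega> \<in> (\<Union>n. ?I n)" by (rule UN_I[OF UNIV_I])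
  qed
  \<comment> \<open>Monotonicity asks for measurability of the larger set only, so nothing has to be
    known about the reach event.\<close>
  then have "measure (noise_seq \<sigma>) (reach_event \<sigma> g C N \<iota> \<Delta> (ball y \<delta>)) \<le> prob (\<Union>n. ?I n)"
    using inner_event_sets by (intro finite_measure_mono) auto
  with likely have "\<rho> < prob (\<Union>n. ?I n)" by simp
  from order_tendstoD(1)[OF lim this] obtain n where "\<rho> < prob (?I n)"
    by (auto simp: eventually_sequentially)
  then show ?thesis by (intro exI[of _ "?s n"]) auto
qed

lemma closed_ball_centres:
  fixes X :: "'a set"
  assumes "closed X" shows "closed {y. ball y \<delta> \<subseteq> X}"
proof -
  have "open (- {y. ball y \<delta> \<subseteq> X})"
  proof (subst open_subopen, intro ballI)
    fix y assume "y \<in> - {y. ball y \<delta> \<subseteq> X}"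
    then have "\<not> ball y \<delta> \<subseteq> X" by simp
    then obtain z where z: "dist y z < \<delta>" "z \<notin> X" unfolding subset_eq by auto
    show "\<exists>T. open T \<and> y \<in> T \<and> T \<subseteq> - {y. ball y \<delta> \<subseteq> X}"
      using z by (intro exI[of _ "ball z \<delta>"]) (auto simp: dist_commute)
  qed
  then show ?thesis by (simp add: closed_def)
qed

text \<open>The room gained by shrinking a ball is spent on its centre: the inner event for radius
  \<open>s z\<close> around \<open>z\<close> serves every centre within
  \<open>\<delta> - s z\<close> of \<open>z\<close>. The admissible centres form a compact set, so
  finitely many events suffice.\<close>

lemma finite_inner_reach_cover:
  assumes X: "closed X" and \<iota>: "0 < \<iota>" and \<Delta>: "\<Delta> \<noteq> {}" and \<rho>: "0 \<le> \<rho>"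
    and likely: "\<forall>y. ball y \<delta> \<subseteq> X \<longrightarrow> \<rho> < measure (noise_seq \<sigma>) (reach_event \<sigma> g C N \<iota> \<Delta> (ball y \<delta>))"
  shows "\<exists>(Z :: 'a set) V E. finite Z \<and> (\<forall>z\<in>Z. open (V z)) \<and> {y. ball y \<delta> \<subseteq> X} \<subseteq> (\<Union>z\<in>Z. V z) \<and>
    (\<forall>z. E z \<in> sets (noise_seq \<sigma>)) \<and>
    (\<forall>z. \<forall>\<omega>\<in>space (noise_seq \<sigma>). \<forall>\<omega>'\<in>space (noise_seq \<sigma>). (\<forall>j\<le>N. \<omega> j = \<omega>' j) \<longrightarrow> (\<omega> \<in> E z \<longleftrightarrow> \<omega>' \<in> E z)) \<and>
    (\<forall>z\<in>Z. \<rho> < measure (noise_seq \<sigma>) (E z)) \<and>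
    (\<forall>z\<in>Z. \<forall>y\<in>V z. E z \<subseteq> reach_event \<sigma> g C N \<iota> \<Delta> (ball y \<delta>))"
proof -
  let ?Y = "{y. ball y \<delta> \<subseteq> X}"
  obtain s where s: "\<And>y. y \<in> ?Y \<Longrightarrow> s y < \<delta> \<and> \<rho> < measure (noise_seq \<sigma>) (inner_event N (reach_event \<sigma> g C N \<iota> \<Delta> (ball y (s y))))"
    using inner_reach_event_likely[OF \<iota> \<Delta> \<rho> likely[rule_format]] by (metis mem_Collect_eq)
  define V where "V = (\<lambda>y. ball y (\<delta> - s y))"
  define E where "E = (\<lambda>y. inner_event N (reach_event \<sigma> g C N \<iota> \<Delta> (ball y (s y))))"
  have "compact ?Y" using compact_M closed_ball_centres[OF X] compact_Int_closed[of UNIV ?Y] by simp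
  moreover have "?Y \<subseteq> (\<Union>y\<in>?Y. V y)" using s by (fastforce simp: V_def)
  ultimately obtain Z where Z: "Z \<subseteq> ?Y" "finite Z" "?Y \<subseteq> (\<Union>z\<in>Z. V z)"
    by (elim compactE_image[of _ ?Y V]) (auto simp: V_def)
  show ?thesis
  proof (rule exI[of _ Z], rule exI[of _ V], rule exI[of _ E], intro conjI ballI allI impI)
    show "E z \<subseteq> reach_event \<sigma> g C N \<iota> \<Delta> (ball y \<delta>)" if "z \<in> Z" "y \<in> V z" for z y
    proof -
      have "ball z (s z) \<subseteq> ball y \<delta>"
      proof
        fix u assume "u \<in> ball z (s z)"
        with that(2) show "u \<in> ball y \<delta>" unfolding V_def mem_ball by metric
      qed
      from subset_trans[OF inner_event_subset reach_event_mono[OF this]] show ?thesis unfolding E_def .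
    qed
    show "\<omega> \<in> E z \<longleftrightarrow> \<omega>' \<in> E z" if "\<omega> \<in> space (noise_seq \<sigma>)" "\<omega>' \<in> space (noise_seq \<sigma>)" "\<forall>j\<le>N. \<omega> j = \<omega>' j" for z \<omega> \<omega>'
      unfolding E_def by (rule inner_event_cong) (use that in auto)
  qed (use Z s in \<open>auto simp: V_def E_def inner_event_sets\<close>)
qed

end

section \<open>Measurability of hyperbolic times\<close>

lemma crit_dist_pos: "closed S \<Longrightarrow> x \<notin> S \<Longrightarrow> 0 < crit_dist x S"
  by (auto simp: crit_dist_def infdist_pos_not_in_closed)

text \<open>The quotients in the supremum are reciprocals of those bounded below by
  \<open>lo\<close>. Hence they are bounded above and the supremum dominates each of them; an
  unbounded real supremum would carry no information.\<close>

lemma inv_deriv_norm_pos: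
  assumes reg: "regular_at M f x"
    and lo: "0 < lo" "\<And>v. v \<noteq> 0 \<Longrightarrow> lo \<le> tnorm M (f x) (mderiv M f x v) / tnorm M x v"
  shows "0 < inv_deriv_norm M f x"
proof -
  let ?D = "mderiv M f x"
  let ?R = "\<lambda>v. tnorm M x (inv ?D v) / tnorm M (f x) v"
  have bij: "bij ?D" using reg by (simp add: regular_at_def)
  have "linear ?D" using reg unfolding regular_at_def mdifferentiable_def mderiv_def
    by (simp add: linear_frechet_derivative)
  then have D0: "?D 0 = 0" by (rule linear_0)
  have R: "0 < ?R v \<and> ?R v \<le> 1 / lo" if "v \<noteq> 0" for v
  proof -
    have v: "?D (inv ?D v) = v" using bij by (simp add: bij_is_surj surj_f_inv_f)
    with D0 that have "inv ?D v \<noteq> 0" by metis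
    define r where "r = tnorm M (f x) v / tnorm M x (inv ?D v)"
    from lo(2)[OF \<open>inv ?D v \<noteq> 0\<close>] v have "lo \<le> r" by (simp add: r_def)
    moreover have "?R v = 1 / r" by (simp add: r_def)
    ultimately show ?thesis using lo(1) by (simp add: frac_le)
  qed
  obtain v :: "real ^ 'b" where v: "v \<noteq> 0" using that[of "axis undefined 1"] by (simp add: axis_eq_0_iff)
  have "?R v \<le> (SUP v\<in>- {0}. ?R v)"
    using R v by (intro cSUP_upper bdd_aboveI2[of _ _ "1 / lo"]) auto
  with R[OF v] reg show ?thesis by (simp add: inv_deriv_norm_def)
qed

lemma shift_pow_measurable: "(shift ^^ n) \<in> noise_seq \<sigma> \<rightarrow>\<^sub>M noise_seq \<sigma>"
proof -
  have "shift ^^ n = (\<lambda>\<omega>. \<lambda>i\<in>UNIV. \<omega> (n + i))" by (intro ext) (simp add: shift_pow)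
  also have "\<dots> \<in> noise_seq \<sigma> \<rightarrow>\<^sub>M noise_seq \<sigma>"
    unfolding noise_seq_def by (intro measurable_restrict measurable_component_singleton) simp
  finally show ?thesis .
qed

text \<open>The usual closed-graph property of an upper semi-continuous family of closed
  sets.\<close>

lemma (in critical_family) closed_crit_graph: "closed {(x, w). w \<in> noise_cube \<sigma> \<and> x \<in> C w}"
proof -
  have "open (- {(x, w). w \<in> noise_cube \<sigma> \<and> x \<in> C w})"
  proof (subst open_subopen, intro ballI)
    fix p assume "p \<in> - {(x, w). w \<in> noise_cube \<sigma> \<and> x \<in> C w}"
    then obtain x w where p: "p = (x, w)" "w \<notin> noise_cube \<sigma> \<or> w \<in> noise_cube \<sigma> \<and> x \<notin> C w" by (cases p) auto
    from p(2) show "\<exists>T. open T \<and> p \<in> T \<and> T \<subseteq> - {(x, w). w \<in> noise_cube \<sigma> \<and> x \<in> C w}"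
    proof
      assume w: "w \<notin> noise_cube \<sigma>"
      have "closed (noise_cube \<sigma> :: (real ^ 'k) set)" unfolding noise_cube_def by (rule closed_cbox)
      then show ?thesis
        using w p(1) by (intro exI[of _ "UNIV \<times> - noise_cube \<sigma>"]) (auto intro!: open_Times)
    next
      assume w: "w \<in> noise_cube \<sigma> \<and> x \<notin> C w"
      obtain \<epsilon> where \<epsilon>: "\<epsilon> > 0" "ball x \<epsilon> \<inter> C w = {}"
        using closed_C[of w] w by (metis ComplI disjoint_eq_subset_Compl open_Compl open_contains_ball)
      then obtain \<delta> where \<delta>: "\<delta> > 0" "\<And>w'. w' \<in> noise_cube \<sigma> \<Longrightarrow> dist w' w < \<delta> \<Longrightarrow> C w' \<subseteq> (\<Union>y\<in>C w. ball y (\<epsilon> / 2))"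
        using usc[of w "\<epsilon> / 2"] w by auto
      have "x' \<notin> C w'" if "w' \<in> noise_cube \<sigma>" "dist w' w < \<delta>" "dist x x' < \<epsilon> / 2" for x' w'
      proof
        assume "x' \<in> C w'"
        then have "x' \<in> (\<Union>y\<in>C w. ball y (\<epsilon> / 2))" using \<delta>(2)[OF that(1,2)] by (rule subsetD[rotated])
        then obtain y where y: "y \<in> C w" "dist y x' < \<epsilon> / 2" by auto
        then have "dist x y < \<epsilon>" using that(3) by metric
        with \<epsilon>(2) y(1) show False by auto
      qed
      then show ?thesis
        using p(1) \<delta>(1) \<epsilon>(1) by (intro exI[of _ "ball x (\<epsilon> / 2) \<times> ball w \<delta>"]) (auto intro!: open_Times simp: dist_commute)
    qed
  qed
  then show ?thesis by (simp add: closed_def)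
qed

text \<open>The function has relatively open superlevel sets where the critical set is nonempty and
  is constantly 1 where it is empty; the noise values of the second kind form a relatively open set
  \<open>V\<close>.\<close>

lemma (in critical_family) crit_dist_measurable:
  "(\<lambda>(x, w). crit_dist x (C w)) \<in> borel_measurable (restrict_space borel (UNIV \<times> noise_cube \<sigma>))"
  unfolding borel_measurable_iff_greater
proof
  fix t :: real
  let ?Q = "UNIV \<times> noise_cube \<sigma> :: ('a \<times> (real ^ 'k)) set"
  obtain V where V: "open V" "\<And>w. w \<in> noise_cube \<sigma> \<Longrightarrow> w \<in> V \<longleftrightarrow> C w = {}"
    by (rule empty_crit_relatively_open) blast
  define e where "e = (\<lambda>x w. SOME e. e>0 \<and> (\<forall>x' w'. dist x' x < e \<longrightarrow> w' \<in> noise_cube \<sigma> \<longrightarrow> dist w' w < e \<longrightarrow> (C w' = {} \<longleftrightarrow> C w = {}) \<longrightarrow>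
           t < crit_dist x' (C w')))"
  have e: "e x w >0 \<and> (\<forall>x' w'. dist x' x < e x w \<longrightarrow> w' \<in> noise_cube \<sigma> \<longrightarrow> dist w' w < e x w \<longrightarrow> (C w' = {} \<longleftrightarrow> C w = {}) \<longrightarrow>
           t < crit_dist x' (C w'))" if "w \<in> noise_cube \<sigma>" "t < crit_dist x (C w)" for x w
    unfolding e_def using crit_dist_lsc[OF that] by (rule someI_ex)
  define O1 where "O1 = (\<Union>x. \<Union>w\<in>{w\<in>noise_cube \<sigma>. t < crit_dist x (C w) \<and> C w \<noteq> {}}. ball x (e x w) \<times> ball w (e x w))"
  have O1: "open O1" by (auto simp: O1_def intro!: open_Times)
  have O1_iff: "(x, w) \<in> O1 \<longleftrightarrow> t < crit_dist x (C w)" if w: "w \<in> noise_cube \<sigma>" "C w \<noteq> {}" for x w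
  proof
    assume "(x, w) \<in> O1"
    then obtain x0 w0 where 0: "w0 \<in> noise_cube \<sigma>" "t < crit_dist x0 (C w0)" "C w0 \<noteq> {}"
      "(x, w) \<in> ball x0 (e x0 w0) \<times> ball w0 (e x0 w0)" unfolding O1_def by blast
    with e[OF 0(1,2)] w show "t < crit_dist x (C w)" by (simp add: dist_commute)
  next
    assume t: "t < crit_dist x (C w)"
    with w e[OF w(1) t] show "(x, w) \<in> O1"
      unfolding O1_def by (intro UN_I[of x] UN_I[of w]) auto
  qed
  let ?X = "(if t < 1 then UNIV \<times> V else {}) \<union> (O1 - UNIV \<times> V)"
  have eq: "{p \<in> ?Q. t < (case p of (x, w) \<Rightarrow> crit_dist x (C w))} = ?Q \<inter> ?X"
  proof (intro set_eqI)
    fix p :: "'a \<times> (real ^ 'k)"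
    obtain x w where p: "p = (x, w)" by (cases p)
    show "p \<in> {p \<in> ?Q. t < (case p of (x, w) \<Rightarrow> crit_dist x (C w))} \<longleftrightarrow>
       p \<in> ?Q \<inter> ?X"
    proof (cases "w \<in> noise_cube \<sigma>")
      case True
      then show ?thesis using V(2)[OF True] O1_iff[OF True] p
        by (cases "C w = {}") (auto simp: crit_dist_def)
    qed (use p in auto)
  qed
  have "?X \<in> sets borel"
  proof -
    have "(UNIV :: 'a set) \<times> V \<in> sets borel" by (intro borel_open open_Times open_UNIV V(1))
    with borel_open[OF O1] show ?thesis by (cases "t < 1") (simp_all add: sets.Un sets.Diff)
  qed
  then have "?Q \<inter> ?X \<in> sets (restrict_space borel ?Q)"
    unfolding sets_restrict_space by (rule imageI)
  then show "{p \<in> space (restrict_space borel ?Q). t < (case p of (x, w) \<Rightarrow> crit_dist x (C w))} \<in> sets (restrict_space borel ?Q)"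
    unfolding space_restrict_space space_borel Int_UNIV_right eq .
qed

lemma (in critical_family) noise_coordinate_measurable:
  "(\<lambda>\<omega>. \<omega> i) \<in> noise_seq \<sigma> \<rightarrow>\<^sub>M (borel :: (real ^ 'k) measure)"
  by (rule measurable_compose[OF measurable_noise_seq_borel]) (rule measurable_component_singleton, simp)

section \<open>Adaptedness and counting of sparse times\<close>

lemma sparse_time_iff:
  "(\<exists>i. enat j = sparse_time M g C b \<eta> r N x \<omega> i) \<longleftrightarrow> hyperbolic_time M g C b \<eta> r x \<omega> j \<and>
     (\<forall>l<j. j \<le> l + N \<longrightarrow> \<not> (\<exists>i. enat l = sparse_time M g C b \<eta> r N x \<omega> i))"
  by (rule greedy_selection_iff) simp_all

text \<open>Immediate from the greedy rule: whether \<open>j\<close> is selected depends on its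
  being a hyperbolic time, hence on the noise before \<open>j\<close>, and on selections at earlier
  times.\<close>

lemma sparse_time_cong:
  assumes "\<And>l. l < j \<Longrightarrow> \<omega> l = \<omega>' l"
  shows "(\<exists>i. enat j = sparse_time M g C b \<eta> r N x \<omega> i) \<longleftrightarrow> (\<exists>i. enat j = sparse_time M g C b \<eta> r N x \<omega>' i)"
  using assms
proof (induction j rule: less_induct)
  case (less j)
  have "(\<exists>i. enat l = sparse_time M g C b \<eta> r N x \<omega> i) \<longleftrightarrow> (\<exists>i. enat l = sparse_time M g C b \<eta> r N x \<omega>' i)" if "l < j" for l
    using that less.prems by (intro less.IH) auto
  moreover have "hyperbolic_time M g C b \<eta> r x \<omega> j = hyperbolic_time M g C b \<eta> r x \<omega>' j"
    using less.prems by (rule hyperbolic_time_cong)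
  ultimately show ?case
    by (subst (1 2) sparse_time_iff) auto
qed

text \<open>A hyperbolic time that is not selected is blocked by a selected one at most
  \<open>N\<close> earlier, so each selected time accounts for at most \<open>N + 1\<close>
  hyperbolic times.\<close>

lemma card_hyperbolic_times_le:
  "card (hyperbolic_times M g C b \<eta> r x \<omega> n) \<le> (N + 1) * card (sparse_times M g C b \<eta> r N x \<omega> n)"
proof (rule card_le_gap_times_selected)
  let ?S = "\<lambda>j. \<exists>i. enat j = sparse_time M g C b \<eta> r N x \<omega> i"
  show "finite (sparse_times M g C b \<eta> r N x \<omega> n)" by (simp add: sparse_times_def)
  fix j assume "j \<in> hyperbolic_times M g C b \<eta> r x \<omega> n"
  then have j: "j \<in> {1..n}" "hyperbolic_time M g C b \<eta> r x \<omega> j" by (auto simp: hyperbolic_times_def)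
  show "\<exists>l\<in>sparse_times M g C b \<eta> r N x \<omega> n. l \<le> j \<and> j \<le> l + N"
  proof (cases "?S j")
    case True
    then show ?thesis using j by (intro bexI[of _ j]) (auto simp: sparse_times_def)
  next
    case False
    then obtain l where l: "l < j" "j \<le> l + N" "?S l"
      using sparse_time_iff[of j] j(2) by metis
    then have "hyperbolic_time M g C b \<eta> r x \<omega> l" using sparse_time_iff[of l] by metis
    then have "0 < l" by (simp add: hyperbolic_time_def)
    with l j show ?thesis by (intro bexI[of _ l]) (auto simp: sparse_times_def)
  qed
qed

section \<open>Joint measurability in the starting point and the noise\<close>

locale measurable_family = regular_family \<sigma> C M g
  for \<sigma> :: real and C :: "real ^ 'k::finite \<Rightarrow> 'a::{metric_space, second_countable_topology} set"
    and M :: "('a, 'k) manifold" and g :: "'a \<Rightarrow> real ^ 'k \<Rightarrow> 'a" +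
  assumes noncritical_inv_deriv_norm_pos:
      "\<And>x w. w \<in> noise_cube \<sigma> \<Longrightarrow> x \<notin> C w \<Longrightarrow> 0 < inv_deriv_norm M (\<lambda>y. g y w) x"
    and ln_inv_deriv_norm_measurable:
      "(\<lambda>(x, \<omega>). ln (inv_deriv_norm M (rmap g \<omega>) x)) \<in> borel_measurable (borel \<Otimes>\<^sub>M noise_seq \<sigma>)"
begin

abbreviation orbits :: "('a \<times> (nat \<Rightarrow> real ^ 'k)) measure" where
  "orbits \<equiv> borel \<Otimes>\<^sub>M noise_seq \<sigma>"

lemma space_orbits: "p \<in> space orbits \<longleftrightarrow> snd p \<in> space (noise_seq \<sigma>)"
  by (cases p) (simp add: space_pair_measure)

lemma orbits_coordinate_measurable: "(\<lambda>p. snd p i) \<in> orbits \<rightarrow>\<^sub>M borel"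
  by (rule measurable_compose[OF measurable_snd noise_coordinate_measurable])

lemma position_noise_measurable:
  assumes "f \<in> orbits \<rightarrow>\<^sub>M (borel :: 'a measure)"
  shows "(\<lambda>p. (f p, snd p i)) \<in> orbits \<rightarrow>\<^sub>M restrict_space borel (UNIV \<times> noise_cube \<sigma>)"
proof (rule measurable_restrict_space2)
  show "(\<lambda>p. (f p, snd p i)) \<in> orbits \<rightarrow>\<^sub>M borel"
    using measurable_Pair[OF assms orbits_coordinate_measurable] by (simp add: borel_prod)
qed (auto simp: space_orbits space_noise_seq)

lemma rmap_iter_measurable: "(\<lambda>p. rmap_iter g n (snd p) (fst p)) \<in> orbits \<rightarrow>\<^sub>M borel"
proof (induction n)
  case 0
  then show ?case by simp
next
  case (Suc n)
  have "(\<lambda>(x, w). g x w) \<in> restrict_space borel (UNIV \<times> noise_cube \<sigma>) \<rightarrow>\<^sub>M borel"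
    using cont_g by (rule borel_measurable_continuous_on_restrict)
  from measurable_compose[OF position_noise_measurable[OF Suc] this] show ?case
    unfolding rmap_iter_Suc_apply by simp
qed

lemma crit_dist_rmap_iter_measurable:
  "(\<lambda>p. crit_dist (rmap_iter g n (snd p) (fst p)) (C (snd p n))) \<in> borel_measurable orbits"
  using measurable_compose[OF position_noise_measurable[OF rmap_iter_measurable] crit_dist_measurable] by simp

text \<open>What is given is measurability of the logarithm. Off the critical graph the norm is
  positive and \<open>exp\<close> recovers it; on the graph it is 0 by definition. The graph is
  closed, so the case split is measurable.\<close>

lemma inv_deriv_norm_measurable: "(\<lambda>p. inv_deriv_norm M (rmap g (snd p)) (fst p)) \<in> borel_measurable orbits"
proof -
  let ?G = "{(x, w). w \<in> noise_cube \<sigma> \<and> x \<in> C w}"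
  have "(\<lambda>p. (fst p, snd p 0)) \<in> orbits \<rightarrow>\<^sub>M borel"
    using measurable_Pair[OF measurable_fst orbits_coordinate_measurable, of 0] by (simp add: borel_prod)
  moreover have "?G \<in> sets borel" using closed_crit_graph by (rule borel_closed)
  ultimately have "(\<lambda>p. (fst p, snd p 0)) -` ?G \<inter> space orbits \<in> sets orbits"
    by (rule measurable_sets)
  also have "(\<lambda>p. (fst p, snd p 0)) -` ?G \<inter> space orbits = {p \<in> space orbits. (fst p, snd p 0) \<in> ?G}" by auto
  finally have G: "{p \<in> space orbits. (fst p, snd p 0) \<in> ?G} \<in> sets orbits" .
  have "(\<lambda>p. if (fst p, snd p 0) \<in> ?G then 0 else exp (ln (inv_deriv_norm M (rmap g (snd p)) (fst p)))) \<in> borel_measurable orbits"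
    using G ln_inv_deriv_norm_measurable
    by (intro measurable_If borel_measurable_exp[THEN measurable_compose[rotated]]) (simp_all add: case_prod_beta')
  then show ?thesis
  proof (rule measurable_cong[THEN iffD1, rotated])
    fix p assume "p \<in> space orbits"
    then have w: "snd p 0 \<in> noise_cube \<sigma>" by (simp add: space_orbits space_noise_seq)
    have eq: "rmap g (snd p) = (\<lambda>y. g y (snd p 0))" by (auto simp: rmap_def)
    show "(if (fst p, snd p 0) \<in> ?G then 0 else exp (ln (inv_deriv_norm M (rmap g (snd p)) (fst p)))) =
       inv_deriv_norm M (rmap g (snd p)) (fst p)"
    proof (cases "fst p \<in> C (snd p 0)")
      case True
      then show ?thesis using w C_eq[OF w] by (simp add: eq inv_deriv_norm_def)
    next
      case False
      then show ?thesis using noncritical_inv_deriv_norm_pos[OF w False] by (simp add: eq)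
    qed
  qed
qed

lemma inv_deriv_norm_rmap_iter_measurable:
  "(\<lambda>p. inv_deriv_norm M (rmap g ((shift ^^ i) (snd p))) (rmap_iter g i (snd p) (fst p))) \<in> borel_measurable orbits"
proof -
  have "(\<lambda>p. (rmap_iter g i (snd p) (fst p), (shift ^^ i) (snd p))) \<in> orbits \<rightarrow>\<^sub>M orbits"
    by (intro measurable_Pair rmap_iter_measurable measurable_compose[OF measurable_snd shift_pow_measurable])
  from measurable_compose[OF this inv_deriv_norm_measurable] show ?thesis by simp
qed

lemma hyperbolic_time_measurable:
  "Measurable.pred orbits (\<lambda>p. hyperbolic_time M g C b \<eta> r (fst p) (snd p) n)"
proof -
  note [measurable] = inv_deriv_norm_rmap_iter_measurable crit_dist_rmap_iter_measurable
  show ?thesis unfolding hyperbolic_time_def trunc_dist_def by measurable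
qed

lemma sparse_time_measurable:
  "Measurable.pred orbits (\<lambda>p. \<exists>i. enat j = sparse_time M g C b \<eta> r N (fst p) (snd p) i)"
proof (induction j rule: less_induct)
  case (less j)
  have "Measurable.pred orbits (\<lambda>p. \<forall>l\<in>{l. l < j \<and> j \<le> l + N}. \<not> (\<exists>i. enat l = sparse_time M g C b \<eta> r N (fst p) (snd p) i))"
    using less by (intro pred_intros_finite pred_intros_logic) auto
  then have "Measurable.pred orbits (\<lambda>p. hyperbolic_time M g C b \<eta> r (fst p) (snd p) j \<and>
     (\<forall>l\<in>{l. l < j \<and> j \<le> l + N}. \<not> (\<exists>i. enat l = sparse_time M g C b \<eta> r N (fst p) (snd p) i)))"
    by (intro pred_intros_logic hyperbolic_time_measurable)
  then show ?case by (subst sparse_time_iff) (simp add: imp_conjL)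
qed

end

section \<open>Successful trials at sparse hyperbolic times\<close>

context measurable_family
begin

text \<open>
  A hyperbolic time pulls \<open>ball (f^i x) \<delta>\<close> back into a small ball around every earlier point of the
  orbit. One earlier point well inside \<open>X\<close> therefore puts the whole ball inside \<open>X\<close>.
\<close>

lemma hyperbolic_ball_subset:
  assumes scale: "hyperbolic_scale M \<sigma> g C \<beta> b \<eta> r \<delta>" and \<eta>: "0 < \<eta>" "\<eta> < 1"
    and inv: "\<And>y w. y \<in> X \<Longrightarrow> w \<in> noise_cube \<sigma> \<Longrightarrow> g y w \<in> X"
    and \<omega>: "\<omega> \<in> space (noise_seq \<sigma>)"
    and deep: "ball (rmap_iter g k \<omega> x) \<kappa> \<subseteq> X"
    and n1: "\<delta> * \<eta> powr (real n1 / 2) < \<kappa>" "k + n1 \<le> i" "k < i"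
    and hyp: "hyperbolic_time M g C b \<eta> r x \<omega> i"
  shows "ball (rmap_iter g i \<omega> x) \<delta> \<subseteq> X"
proof
  fix p assume p: "p \<in> ball (rmap_iter g i \<omega> x) \<delta>"
  have "0 < \<delta>" using scale by (simp add: hyperbolic_scale_def)
  with scale \<omega> hyp obtain V where V: "x \<in> V" "diffeo_onto M (rmap_iter g i \<omega>) V (ball (rmap_iter g i \<omega> x) \<delta>)"
    "\<forall>z\<in>V. \<forall>y\<in>V. \<forall>k\<in>{1..i}. dist (rmap_iter g (i - k) \<omega> z) (rmap_iter g (i - k) \<omega> y)
                 \<le> \<eta> powr (real k / 2) * dist (rmap_iter g i \<omega> z) (rmap_iter g i \<omega> y)"
    unfolding hyperbolic_scale_def by (metis order_refl)
  from V(2) p obtain z where z: "z \<in> V" "p = rmap_iter g i \<omega> z"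
    unfolding diffeo_onto_def bij_betw_def by (metis imageE)
  \<comment> \<open>The contraction in \<open>hyperbolic_scale\<close> is indexed by the number of
    steps back from \<open>i\<close>; the point at time \<open>k\<close> lies
    \<open>i - k \<ge> n1\<close> steps back.\<close>
  have "i - k \<in> {1..i}" "i - (i - k) = k" using n1(3) by auto
  with V(3) z V(1) have "dist (rmap_iter g k \<omega> z) (rmap_iter g k \<omega> x) \<le> \<eta> powr (real (i - k) / 2) * dist p (rmap_iter g i \<omega> x)"
    by metis
  also have "\<dots> \<le> \<eta> powr (real n1 / 2) * \<delta>"
    using p n1(2) \<eta> by (intro mult_mono powr_mono') (auto simp: dist_commute)
  also have "\<dots> < \<kappa>" using n1(1) by (simp add: mult.commute)
  finally have "rmap_iter g k \<omega> z \<in> X" using deep by (auto simp: dist_commute subset_eq)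
  \<comment> \<open>Forward invariance of \<open>X\<close> carries the orbit of \<open>z\<close>
    from time \<open>k\<close>, where it is in \<open>X\<close>, up to its value \<open>p\<close> at
    time \<open>i\<close>.\<close>
  then have "rmap_iter g (i - k) ((shift ^^ k) \<omega>) (rmap_iter g k \<omega> z) \<in> X"
    using inv \<omega> by - (rule rmap_iter_invariant[of X \<sigma> g], simp_all add: space_noise_seq shift_pow)
  then show "p \<in> X" using rmap_iter_add[of g k "i - k" \<omega> z] n1(3) z(2) by simp
qed

text \<open>In use \<open>Y\<close> is the set of centres whose \<delta>-ball lies in the support;
  membership makes the lower bound on the reach probability available. The bound
  \<open>i \<le> n\<close> keeps the set of trials finite.\<close>

definition trial :: "real \<Rightarrow> real \<Rightarrow> real \<Rightarrow> nat \<Rightarrow> 'a set \<Rightarrow> nat \<Rightarrow> nat \<Rightarrow> 'a \<times> (nat \<Rightarrow> real ^ 'k) \<Rightarrow> bool" where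
  "trial b \<eta> r N Y n i p \<longleftrightarrow> i \<le> n \<and> (\<exists>l. enat i = sparse_time M g C b \<eta> r N (fst p) (snd p) l) \<and>
     rmap_iter g i (snd p) (fst p) \<in> Y"

text \<open>A measurable substitute for the reach event, built from finitely many neighbourhoods
  \<open>V z\<close> and events \<open>E z\<close>. It is applied to data for which success implies
  the reach event.\<close>

definition success :: "'a set \<Rightarrow> ('a \<Rightarrow> 'a set) \<Rightarrow> ('a \<Rightarrow> (nat \<Rightarrow> real ^ 'k) set) \<Rightarrow> nat \<Rightarrow> 'a \<times> (nat \<Rightarrow> real ^ 'k) \<Rightarrow> bool" where
  "success Z V E i p \<longleftrightarrow> (\<exists>z\<in>Z. rmap_iter g i (snd p) (fst p) \<in> V z \<and> (shift ^^ i) (snd p) \<in> E z)"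

lemma trial_measurable: "closed Y \<Longrightarrow> Measurable.pred orbits (trial b \<eta> r N Y n i)"
proof -
  assume "closed Y"
  then have Y: "Y \<in> sets borel" by (rule borel_closed)
  have "Measurable.pred orbits (\<lambda>p. rmap_iter g i (snd p) (fst p) \<in> Y)"
    by (rule measurable_compose[OF rmap_iter_measurable]) (use Y in simp)
  then show ?thesis unfolding trial_def
    by (intro pred_intros_logic sparse_time_measurable) simp_all
qed

lemma success_measurable:
  assumes "finite Z" "\<And>z. z \<in> Z \<Longrightarrow> open (V z)" "\<And>z. z \<in> Z \<Longrightarrow> E z \<in> sets (noise_seq \<sigma>)"
  shows "Measurable.pred orbits (success Z V E i)"
proof -
  have "Measurable.pred orbits (\<lambda>p. rmap_iter g i (snd p) (fst p) \<in> V z)" if "z \<in> Z" for z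
    by (rule measurable_compose[OF rmap_iter_measurable]) (use borel_open[OF assms(2)[OF that]] in simp)
  moreover have "Measurable.pred orbits (\<lambda>p. (shift ^^ i) (snd p) \<in> E z)" if "z \<in> Z" for z
    by (rule measurable_compose[OF measurable_compose[OF measurable_snd shift_pow_measurable]]) (use assms(3)[OF that] in simp)
  ultimately show ?thesis unfolding success_def
    using assms(1) by (intro pred_intros_finite pred_intros_logic) auto
qed

text \<open>With \<open>x\<close> fixed, a trial at \<open>q + (N + 1) * k\<close> is decided by
  earlier noise and its success by the noise up to \<open>N\<close> steps later, that is strictly
  before the next time of the residue class. The bound for adapted trials thus applies with these
  deterministic times.\<close>

lemma few_successes_section:
  assumes \<rho>: "0 < \<rho>" "\<rho> \<le> 1" and Y: "closed Y" "Y \<subseteq> (\<Union>z\<in>Z. V z)"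
    and Z: "finite Z" "\<And>z. z \<in> Z \<Longrightarrow> open (V z)"
    and E: "\<And>z. z \<in> Z \<Longrightarrow> E z \<in> sets (noise_seq \<sigma>)"
    "\<And>z \<omega> \<omega>'. (\<And>j. j \<le> N \<Longrightarrow> \<omega> j = \<omega>' j) \<Longrightarrow> \<omega> \<in> space (noise_seq \<sigma>) \<Longrightarrow> \<omega>' \<in> space (noise_seq \<sigma>) \<Longrightarrow> \<omega> \<in> E z \<longleftrightarrow> \<omega>' \<in> E z"
    "\<And>z. z \<in> Z \<Longrightarrow> \<rho> < measure (noise_seq \<sigma>) (E z)"
  shows "emeasure (noise_seq \<sigma>) {\<omega> \<in> space (noise_seq \<sigma>).
       a \<le> real (card {k. k < K \<and> trial b \<eta> r N Y n (q + (N + 1) * k) (x, \<omega>)}) \<and>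
       real (card {k. k < K \<and> trial b \<eta> r N Y n (q + (N + 1) * k) (x, \<omega>) \<and> success Z V E (q + (N + 1) * k) (x, \<omega>)}) \<le> s}
     \<le> ennreal ((1 - \<rho> / 2) powr a * 2 powr s)"
proof -
  interpret sequence_space "noise \<sigma> :: (real ^ 'k) measure" by (rule sequence_space_noise[OF sigma_pos])
  let ?t = "\<lambda>k. q + (N + 1) * k"
  note noise_seq = noise_seq_def[of \<sigma>, symmetric]
  have sec: "(\<lambda>\<omega>. (x, \<omega>)) \<in> noise_seq \<sigma> \<rightarrow>\<^sub>M orbits" by simp
  have comb_space: "comb_seq i \<omega> \<omega>' \<in> space (noise_seq \<sigma>)" if "\<omega> \<in> space (noise_seq \<sigma>)" "\<omega>' \<in> space (noise_seq \<sigma>)" for i and \<omega> \<omega>' :: "nat \<Rightarrow> real ^ 'k"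
    using that by (auto simp: space_noise_seq comb_seq_def)
  have shift_comb: "(shift ^^ i) (comb_seq i \<omega> \<omega>') = \<omega>'" for i and \<omega> \<omega>' :: "nat \<Rightarrow> real ^ 'k"
    by (auto simp: shift_pow comb_seq_def)
  have shift_space: "(shift ^^ i) \<omega> \<in> space (noise_seq \<sigma>)" if "\<omega> \<in> space (noise_seq \<sigma>)" for i and \<omega> :: "nat \<Rightarrow> real ^ 'k"
    using that by (simp add: space_noise_seq shift_pow)
  have succ: "Measurable.pred (noise_seq \<sigma>) (\<lambda>\<omega>. success Z V E i (x, \<omega>))" for i
    by (rule measurable_compose[OF sec success_measurable]) (use Z E in auto)
  show ?thesis
  proof (rule prob_many_trials_few_successes[of \<rho> ?t, unfolded noise_seq, OF \<rho>])
    show "mono ?t" by (intro monoI add_mono mult_le_mono order_refl)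
    show "Measurable.pred (noise_seq \<sigma>) (\<lambda>\<omega>. trial b \<eta> r N Y n (?t k) (x, \<omega>))" for k
      by (rule measurable_compose[OF sec trial_measurable[OF Y(1)]])
    show "Measurable.pred (noise_seq \<sigma>) (\<lambda>\<omega>. success Z V E (?t k) (x, \<omega>))" for k
      by (rule succ)
    show "trial b \<eta> r N Y n (?t k) (x, \<omega>) = trial b \<eta> r N Y n (?t k) (x, \<omega>')"
      if "\<omega> \<in> space (noise_seq \<sigma>)" "\<omega>' \<in> space (noise_seq \<sigma>)" "\<And>j. j < ?t k \<Longrightarrow> \<omega> j = \<omega>' j" for k \<omega> \<omega>'
      using sparse_time_cong[of "?t k" \<omega> \<omega>' M g C b \<eta> r N x] rmap_iter_cong[of "?t k" \<omega> \<omega>' g x] that(3)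
      by (simp add: trial_def)
    show "success Z V E (?t k) (x, \<omega>) = success Z V E (?t k) (x, \<omega>')"
      if w: "\<omega> \<in> space (noise_seq \<sigma>)" "\<omega>' \<in> space (noise_seq \<sigma>)" "\<And>j. j < ?t (Suc k) \<Longrightarrow> \<omega> j = \<omega>' j" for k \<omega> \<omega>'
    proof -
      have "rmap_iter g (?t k) \<omega> x = rmap_iter g (?t k) \<omega>' x" using w(3) by (intro rmap_iter_cong) simp
      moreover have "(shift ^^ ?t k) \<omega> \<in> E z \<longleftrightarrow> (shift ^^ ?t k) \<omega>' \<in> E z" for z
        using w by (intro E(2) shift_space) (auto simp: shift_pow)
      ultimately show ?thesis by (simp add: success_def)
    qed
    show "\<rho> \<le> measure (noise_seq \<sigma>) {\<omega>' \<in> space (noise_seq \<sigma>). success Z V E (?t k) (x, comb_seq (?t k) \<omega> \<omega>')}"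
      if w: "\<omega> \<in> space (noise_seq \<sigma>)" "trial b \<eta> r N Y n (?t k) (x, \<omega>)" for k \<omega>
    proof -
      let ?y = "rmap_iter g (?t k) \<omega> x"
      have "?y \<in> Y" using w(2) by (simp add: trial_def)
      \<comment> \<open>The past fixes the position at the trial and hence the choice of
        \<open>z\<close>; the shifted future is a fresh noise sequence, which lies in
        \<open>E z\<close> with probability above \<rho>.\<close>
      with Y(2) obtain z where z: "z \<in> Z" "?y \<in> V z" by blast
      have y: "rmap_iter g (?t k) (comb_seq (?t k) \<omega> \<omega>') x = ?y" for \<omega>'
        by (rule rmap_iter_cong) (rule comb_seq_less)
      have "success Z V E (?t k) (x, comb_seq (?t k) \<omega> \<omega>')" if "\<omega>' \<in> E z" for \<omega>'
        unfolding success_def using z that by (intro bexI[of _ z]) (simp_all only: fst_conv snd_conv y shift_comb)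
      then have "E z \<subseteq> {\<omega>' \<in> space (noise_seq \<sigma>). success Z V E (?t k) (x, comb_seq (?t k) \<omega> \<omega>')}"
        using sets.sets_into_space[OF E(1)[OF z(1)]] by blast
      moreover have "{\<omega>' \<in> space (noise_seq \<sigma>). success Z V E (?t k) (x, comb_seq (?t k) \<omega> \<omega>')} \<in> sets (noise_seq \<sigma>)"
      proof -
        have "comb_seq (?t k) \<omega> \<in> noise_seq \<sigma> \<rightarrow>\<^sub>M noise_seq \<sigma>"
          using w(1) unfolding noise_seq_def by measurable
        from measurable_compose[OF this succ] show ?thesis by (simp add: pred_def)
      qed
      ultimately have "measure (noise_seq \<sigma>) (E z) \<le> measure (noise_seq \<sigma>) {\<omega>' \<in> space (noise_seq \<sigma>). success Z V E (?t k) (x, comb_seq (?t k) \<omega> \<omega>')}"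
        using finite_measure.finite_measure_mono[OF prob_space.finite_measure[OF noise_seq_prob[OF sigma_pos]]] by blast
      with E(3)[OF z(1)] show ?thesis by simp
    qed
  qed
qed

end

section \<open>Outer measure, counting and decay estimates\<close>

lemma outer_measure_le_sections:
  assumes P: "prob_space P" and A: "A \<in> sets (R \<Otimes>\<^sub>M P)"
    and c: "\<And>x. x \<in> space R \<Longrightarrow> emeasure P (Pair x -` A) \<le> c"
  shows "outer_measure_of (R \<Otimes>\<^sub>M P) A \<le> emeasure R (space R) * c"
proof -
  interpret prob_space P by fact
  have "outer_measure_of (R \<Otimes>\<^sub>M P) A = (\<integral>\<^sup>+x. emeasure P (Pair x -` A) \<partial>R)"
    using A by (simp add: outer_measure_of_eq emeasure_pair_measure_alt)
  also have "\<dots> \<le> (\<integral>\<^sup>+x. c \<partial>R)" using c by (rule nn_integral_mono)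
  finally show ?thesis by (simp add: mult.commute)
qed

lemma noise_seq_avoid:
  fixes U :: "(real ^ 'k::finite) set"
  assumes \<sigma>: "0 < \<sigma>" and U: "U \<in> sets borel" and p: "p \<le> measure (noise \<sigma>) (U \<inter> noise_cube \<sigma>)" "p \<le> 1"
  shows "emeasure (noise_seq \<sigma>) {\<omega> \<in> space (noise_seq \<sigma>). \<forall>k<L. \<omega> k \<notin> U} \<le> ennreal ((1 - p) ^ L)"
    and "{\<omega> \<in> space (noise_seq \<sigma>). \<forall>k<L. \<omega> k \<notin> U} \<in> sets (noise_seq \<sigma>)"
proof -
  interpret sequence_space "noise \<sigma> :: (real ^ 'k) measure" by (rule sequence_space_noise[OF \<sigma>])
  note noise = prob_space_noise[OF \<sigma>, where 'k = 'k]
  let ?A = "noise_cube \<sigma> - U"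
  have UI: "U \<inter> noise_cube \<sigma> \<in> sets (noise \<sigma>)"
    using U by (auto simp: sets_noise sets_restrict_space)
  have A_eq: "?A = space (noise \<sigma>) - U \<inter> noise_cube \<sigma>" by (auto simp: space_noise)
  have A: "?A \<in> sets (noise \<sigma>)" unfolding A_eq using UI by (rule sets.compl_sets)
  have set_eq: "{\<omega> \<in> space (noise_seq \<sigma>). \<forall>k<L. \<omega> k \<notin> U} = {\<omega> \<in> space (noise_seq \<sigma>). \<forall>k\<in>{..<L}. \<omega> k \<in> ?A}"
    by (auto simp: space_noise_seq)
  have "emeasure (noise \<sigma>) ?A = ennreal (1 - measure (noise \<sigma>) (U \<inter> noise_cube \<sigma>))"
    unfolding A_eq using UI
    by (simp add: finite_measure.emeasure_eq_measure[OF prob_space.finite_measure[OF noise]] prob_space.prob_compl[OF noise])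
  also have "\<dots> \<le> ennreal (1 - p)" using p by (intro ennreal_leI) simp
  finally have le: "emeasure (noise \<sigma>) ?A \<le> ennreal (1 - p)" .
  have "emeasure (noise_seq \<sigma>) {\<omega> \<in> space (noise_seq \<sigma>). \<forall>k\<in>{..<L}. \<omega> k \<in> ?A} = (\<Prod>k\<in>{..<L}. emeasure (noise \<sigma>) ?A)"
    unfolding noise_seq_def by (rule emeasure_PiM_Collect) (use A in auto)
  also have "\<dots> \<le> (\<Prod>k\<in>{..<L}. ennreal (1 - p))" using le by (intro prod_mono_ennreal)
  also have "\<dots> = ennreal ((1 - p) ^ L)" using p by (simp add: ennreal_power)
  finally show "emeasure (noise_seq \<sigma>) {\<omega> \<in> space (noise_seq \<sigma>). \<forall>k<L. \<omega> k \<notin> U} \<le> ennreal ((1 - p) ^ L)"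
    unfolding set_eq .
  have "(\<lambda>\<omega>. \<omega> k) \<in> noise_seq \<sigma> \<rightarrow>\<^sub>M (noise \<sigma> :: (real ^ 'k) measure)" for k
    unfolding noise_seq_def by (rule measurable_component_singleton) simp
  note [measurable] = this A
  show "{\<omega> \<in> space (noise_seq \<sigma>). \<forall>k<L. \<omega> k \<notin> U} \<in> sets (noise_seq \<sigma>)"
    unfolding set_eq by measurable
qed

lemma card_residue_classes:
  fixes a :: real
  assumes G: "G \<subseteq> {..n}" and a: "real (N + 1) * a \<le> real (card G)"
  shows "\<exists>q<N + 1. a \<le> real (card {k. k < Suc n \<and> q + (N + 1) * k \<in> G})"
proof (rule ccontr)
  assume "\<not> ?thesis"
  then have less: "real (card {k. k < Suc n \<and> q + (N + 1) * k \<in> G}) < a" if "q < N + 1" for q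
    using that by force
  have "G \<subseteq> (\<Union>q\<in>{..<N + 1}. (\<lambda>k. q + (N + 1) * k) ` {k. k < Suc n \<and> q + (N + 1) * k \<in> G})"
  proof
    fix i assume i: "i \<in> G"
    have "i div (N + 1) \<le> i" by simp
    with i G have "i div (N + 1) < Suc n" by (meson atMost_iff le_imp_less_Suc order_trans subsetD)
    moreover have "i mod (N + 1) + (N + 1) * (i div (N + 1)) = i" by (rule mod_mult_div_eq)
    ultimately show "i \<in> (\<Union>q\<in>{..<N + 1}. (\<lambda>k. q + (N + 1) * k) ` {k. k < Suc n \<and> q + (N + 1) * k \<in> G})"
      using i by (intro UN_I[of "i mod (N + 1)"] image_eqI[of _ _ "i div (N + 1)"]) auto
  qed
  then have "card G \<le> card (\<Union>q\<in>{..<N + 1}. (\<lambda>k. q + (N + 1) * k) ` {k. k < Suc n \<and> q + (N + 1) * k \<in> G})"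
    by (intro card_mono) auto
  also have "\<dots> \<le> (\<Sum>q\<in>{..<N + 1}. card ((\<lambda>k. q + (N + 1) * k) ` {k. k < Suc n \<and> q + (N + 1) * k \<in> G}))"
    by (intro card_UN_le) simp
  also have "\<dots> \<le> (\<Sum>q\<in>{..<N + 1}. card {k. k < Suc n \<and> q + (N + 1) * k \<in> G})"
    by (intro sum_mono card_image_le) simp
  finally have "real (card G) \<le> (\<Sum>q\<in>{..<N + 1}. real (card {k. k < Suc n \<and> q + (N + 1) * k \<in> G}))"
    unfolding of_nat_sum[symmetric] of_nat_le_iff .
  also have "\<dots> < (\<Sum>q\<in>{..<N + 1}. a)"
    using less by (intro sum_strict_mono) auto
  finally show False using a by simp
qed

text \<open>Both outer measures are attained by measurable hulls, and the union of the hulls is a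
  measurable superset.\<close>

lemma outer_measure_of_Un_le:
  assumes "A \<subseteq> space M" "B \<subseteq> space M"
  shows "outer_measure_of M (A \<union> B) \<le> outer_measure_of M A + outer_measure_of M B"
proof -
  obtain E F where E: "E \<in> sets M" "A \<subseteq> E" "outer_measure_of M A = emeasure M E"
    and F: "F \<in> sets M" "B \<subseteq> F" "outer_measure_of M B = emeasure M F"
    using outer_measure_of_attain assms by metis
  have "outer_measure_of M (A \<union> B) \<le> outer_measure_of M (E \<union> F)"
    using E F by (intro outer_measure_of_mono) auto
  also have "\<dots> \<le> emeasure M E + emeasure M F"
    using E F by (simp add: emeasure_subadditive)
  finally show ?thesis using E F by simp
qed

lemma outer_measure_of_UN_le:
  assumes "finite I" "\<And>i. i \<in> I \<Longrightarrow> A i \<subseteq> space M"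
  shows "outer_measure_of M (\<Union>i\<in>I. A i) \<le> (\<Sum>i\<in>I. outer_measure_of M (A i))"
  using assms
proof (induction I rule: finite_induct)
  case (insert i I)
  have "outer_measure_of M (A i \<union> (\<Union>i\<in>I. A i)) \<le> outer_measure_of M (A i) + outer_measure_of M (\<Union>i\<in>I. A i)"
    using insert.prems by (intro outer_measure_of_Un_le) auto
  also have "\<dots> \<le> outer_measure_of M (A i) + (\<Sum>i\<in>I. outer_measure_of M (A i))"
    using insert by (intro add_left_mono) auto
  finally show ?case using insert.hyps by simp
qed simp

text \<open>Allowing \<open>\<theta> * x\<close> successes costs a factor
  \<open>2 powr (\<theta> * x)\<close>. As \<open>ln 2 < 1\<close>, the bound on \<theta> makes this
  cost at most half of the decay rate \<open>- a * ln q\<close>.\<close>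

lemma powr_decay_bound:
  fixes q a \<theta> :: real
  assumes "0 < q" "\<theta> \<le> - a * ln q / 2"  "0 \<le> x" "0 \<le> \<theta>"
  shows "q powr (a * x) * 2 powr (\<theta> * x) \<le> exp (- (- a * ln q / 2) * x)"
proof -
  have "\<theta> * ln 2 \<le> \<theta>" using assms(4) ln_2_less_1 by (intro mult_left_le) auto
  then have "a * ln q + \<theta> * ln 2 \<le> a * ln q / 2" using assms(2) by simp
  then have "(a * ln q + \<theta> * ln 2) * x \<le> (a * ln q / 2) * x" using assms(3) by (rule mult_right_mono)
  then have "exp ((a * ln q + \<theta> * ln 2) * x) \<le> exp ((a * ln q / 2) * x)" by simp
  moreover have "q powr (a * x) * 2 powr (\<theta> * x) = exp ((a * ln q + \<theta> * ln 2) * x)"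
    using assms(1) by (simp add: powr_def exp_add[symmetric] algebra_simps)
  ultimately show ?thesis by simp
qed

text \<open>Rounding down loses at most one unit of the exponent, which accounts for the factor
  \<open>1 / q = exp (- ln q)\<close>.\<close>

lemma power_floor_bound:
  fixes q \<epsilon> x :: real
  assumes "0 < q" "q < 1"
  shows "q ^ nat \<lfloor>\<epsilon> * x\<rfloor> \<le> exp (- ln q) * exp (- (- ln q * \<epsilon>) * x)"
proof -
  have "q ^ nat \<lfloor>\<epsilon> * x\<rfloor> = q powr real (nat \<lfloor>\<epsilon> * x\<rfloor>)" using assms by (simp add: powr_realpow)
  also have "\<dots> \<le> q powr (\<epsilon> * x - 1)"
    using assms by (intro powr_mono') linarith+
  also have "\<dots> = exp (- ln q) * exp (- (- ln q * \<epsilon>) * x)"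
    using assms by (simp add: powr_def exp_add[symmetric] algebra_simps)
  finally show ?thesis .
qed

section \<open>Decomposition of the exceptional event\<close>

context measurable_family
begin

lemma many_trials_few_successes:
  assumes R: "sets R = sets (restrict_space borel X)"
    and \<rho>: "0 < \<rho>" "\<rho> \<le> 1" and Y: "closed Y" "Y \<subseteq> (\<Union>z\<in>Z. V z)"
    and Z: "finite Z" "\<And>z. z \<in> Z \<Longrightarrow> open (V z)"
    and E: "\<And>z. z \<in> Z \<Longrightarrow> E z \<in> sets (noise_seq \<sigma>)"
    "\<And>z \<omega> \<omega>'. (\<And>j. j \<le> N \<Longrightarrow> \<omega> j = \<omega>' j) \<Longrightarrow> \<omega> \<in> space (noise_seq \<sigma>) \<Longrightarrow> \<omega>' \<in> space (noise_seq \<sigma>) \<Longrightarrow> \<omega> \<in> E z \<longleftrightarrow> \<omega>' \<in> E z"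
    "\<And>z. z \<in> Z \<Longrightarrow> \<rho> < measure (noise_seq \<sigma>) (E z)"
  shows "outer_measure_of (R \<Otimes>\<^sub>M noise_seq \<sigma>) {p \<in> space (R \<Otimes>\<^sub>M noise_seq \<sigma>).
       a \<le> real (card {k. k < K \<and> trial b \<eta> r N Y n (q + (N + 1) * k) p}) \<and>
       real (card {k. k < K \<and> trial b \<eta> r N Y n (q + (N + 1) * k) p \<and> success Z V E (q + (N + 1) * k) p}) \<le> s}
     \<le> emeasure R (space R) * ennreal ((1 - \<rho> / 2) powr a * 2 powr s)" (is "outer_measure_of ?Q ?A \<le> _")
proof (rule outer_measure_le_sections[OF noise_seq_prob[OF sigma_pos]])
  have "(\<lambda>x. x) \<in> R \<rightarrow>\<^sub>M borel"
    unfolding measurable_cong_sets[OF R refl] by (rule measurable_restrict_space1) simp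
  then have "(\<lambda>p. (fst p, snd p)) \<in> ?Q \<rightarrow>\<^sub>M orbits"
    by (intro measurable_Pair measurable_snd measurable_compose[OF measurable_fst])
  then have id: "(\<lambda>p. p) \<in> ?Q \<rightarrow>\<^sub>M orbits" by simp
  have [measurable]: "Measurable.pred ?Q (trial b \<eta> r N Y n i)" "Measurable.pred ?Q (success Z V E i)" for i
    using measurable_compose[OF id trial_measurable[OF Y(1)]]
      measurable_compose[OF id success_measurable[OF Z E(1)]] by auto
  show "?A \<in> sets ?Q" by measurable
  fix x assume x: "x \<in> space R"
  have "Pair x -` ?A = {\<omega> \<in> space (noise_seq \<sigma>).
       a \<le> real (card {k. k < K \<and> trial b \<eta> r N Y n (q + (N + 1) * k) (x, \<omega>)}) \<and>
       real (card {k. k < K \<and> trial b \<eta> r N Y n (q + (N + 1) * k) (x, \<omega>) \<and> success Z V E (q + (N + 1) * k) (x, \<omega>)}) \<le> s}"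
    using x by (auto simp: space_pair_measure)
  with few_successes_section[OF \<rho> Y Z E]
  show "emeasure (noise_seq \<sigma>) (Pair x -` ?A) \<le> ennreal ((1 - \<rho> / 2) powr a * 2 powr s)" by simp
qed

text \<open>Sparse times up to \<open>L + n1\<close> are written off. Every later one is a trial,
  because the noise value at \<open>k < L\<close> has put the orbit deep into \<open>X\<close> at
  least \<open>n1\<close> steps earlier. The factor \<open>N + 1\<close> is the price of
  sparseness.\<close>

lemma trials_from_hyperbolic_times:
  assumes scale: "hyperbolic_scale M \<sigma> g C \<beta> b \<eta> r \<delta>" and \<eta>: "0 < \<eta>" "\<eta> < 1"
    and inv: "\<And>y w. y \<in> X \<Longrightarrow> w \<in> noise_cube \<sigma> \<Longrightarrow> g y w \<in> X"
    and deep: "\<And>y w. y \<in> X \<Longrightarrow> w \<in> U \<inter> noise_cube \<sigma> \<Longrightarrow> ball (g y w) \<kappa> \<subseteq> X"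
    and n1: "\<delta> * \<eta> powr (real n1 / 2) < \<kappa>"
    and \<omega>: "\<omega> \<in> space (noise_seq \<sigma>)" and x: "x \<in> X" and k: "k < L" "\<omega> k \<in> U"
  shows "real (card (hyperbolic_times M g C b \<eta> r x \<omega> n)) \<le>
    real (N + 1) * (real (card {i. trial b \<eta> r N {y. ball y \<delta> \<subseteq> X} n i (x, \<omega>)}) + real (L + n1 + 1))"
proof -
  let ?Y = "{y. ball y \<delta> \<subseteq> X}"
  let ?G = "{i. trial b \<eta> r N ?Y n i (x, \<omega>)}"
  have fin: "finite ?G" by (rule finite_subset[of _ "{..n}"]) (auto simp: trial_def)
  have "sparse_times M g C b \<eta> r N x \<omega> n \<subseteq> ?G \<union> {..L + n1}"
  proof
    fix i assume i: "i \<in> sparse_times M g C b \<eta> r N x \<omega> n"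
    then have sp: "\<exists>l. enat i = sparse_time M g C b \<eta> r N x \<omega> l" "i \<le> n" by (auto simp: sparse_times_def)
    then have hyp: "hyperbolic_time M g C b \<eta> r x \<omega> i" using sparse_time_iff[of i] by metis
    show "i \<in> ?G \<union> {..L + n1}"
    proof (cases "i \<le> L + n1")
      case False
      have "rmap_iter g k \<omega> x \<in> X" by (rule rmap_iter_invariant[OF _ \<omega> x]) (rule inv)
      \<comment> \<open>The noise value at \<open>k\<close> acts on the step to time
        \<open>Suc k\<close>, so this is the time at which the orbit is deep.\<close>
      then have deep_k: "ball (rmap_iter g (Suc k) \<omega> x) \<kappa> \<subseteq> X"
        unfolding rmap_iter_Suc_apply using \<omega> k by (intro deep) (auto simp: space_noise_seq)
      have "Suc k + n1 \<le> i" "Suc k < i" using False k(1) by auto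
      from hyperbolic_ball_subset[OF scale \<eta> inv \<omega> deep_k n1 this hyp]
      have "ball (rmap_iter g i \<omega> x) \<delta> \<subseteq> X" .
      with sp show ?thesis by (simp add: trial_def)
    qed simp
  qed
  then have "card (sparse_times M g C b \<eta> r N x \<omega> n) \<le> card (?G \<union> {..L + n1})"
    using fin by (intro card_mono) auto
  also have "\<dots> \<le> card ?G + card {..L + n1}" by (rule card_Un_le)
  finally have "card (sparse_times M g C b \<eta> r N x \<omega> n) \<le> card ?G + (L + n1 + 1)" by simp
  then have "(N + 1) * card (sparse_times M g C b \<eta> r N x \<omega> n) \<le> (N + 1) * (card ?G + (L + n1 + 1))"
    by (rule mult_le_mono2)
  with card_hyperbolic_times_le[of M g C b \<eta> r x \<omega> n N]
  have "card (hyperbolic_times M g C b \<eta> r x \<omega> n) \<le> (N + 1) * (card ?G + (L + n1 + 1))" by linarith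
  then have "real (card (hyperbolic_times M g C b \<eta> r x \<omega> n)) \<le> real ((N + 1) * (card ?G + (L + n1 + 1)))"
    by (simp only: of_nat_le_iff)
  then show ?thesis by (simp only: of_nat_mult of_nat_add)
qed

lemma successes_le_young_times:
  assumes E: "\<And>z y. z \<in> Z \<Longrightarrow> y \<in> V z \<Longrightarrow> E z \<subseteq> reach_event \<sigma> g C N \<iota> \<Delta> (ball y \<delta>)"
  shows "card {k. k < K \<and> trial b \<eta> r N Y n (q + (N + 1) * k) (x, \<omega>) \<and> success Z V E (q + (N + 1) * k) (x, \<omega>)}
    \<le> card (young_times M \<sigma> g C b \<eta> r N \<delta> \<iota> \<Delta> x \<omega> n)"
proof (rule card_inj_on_le)
  show "inj_on (\<lambda>k. q + (N + 1) * k) {k. k < K \<and> trial b \<eta> r N Y n (q + (N + 1) * k) (x, \<omega>) \<and> success Z V E (q + (N + 1) * k) (x, \<omega>)}"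
    by (rule inj_onI) (simp only: add_left_cancel mult_cancel1, simp)
  show "finite (young_times M \<sigma> g C b \<eta> r N \<delta> \<iota> \<Delta> x \<omega> n)"
    by (simp add: young_times_def sparse_times_def)
  have "i \<in> young_times M \<sigma> g C b \<eta> r N \<delta> \<iota> \<Delta> x \<omega> n"
    if i: "trial b \<eta> r N Y n i (x, \<omega>)" "success Z V E i (x, \<omega>)" for i
  proof -
    have sp: "\<exists>l. enat i = sparse_time M g C b \<eta> r N x \<omega> l" "i \<le> n" using i by (auto simp: trial_def)
    then have "hyperbolic_time M g C b \<eta> r x \<omega> i" using sparse_time_iff[of i] by metis
    then have "0 < i" by (simp add: hyperbolic_time_def)
    moreover have "(shift ^^ i) \<omega> \<in> reach_event \<sigma> g C N \<iota> \<Delta> (ball (rmap_iter g i \<omega> x) \<delta>)"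
      using i(2) E unfolding success_def fst_conv snd_conv by blast
    ultimately show ?thesis using sp by (simp add: young_times_def sparse_times_def)
  qed
  then show "(\<lambda>k. q + (N + 1) * k) ` {k. k < K \<and> trial b \<eta> r N Y n (q + (N + 1) * k) (x, \<omega>) \<and> success Z V E (q + (N + 1) * k) (x, \<omega>)}
      \<subseteq> young_times M \<sigma> g C b \<eta> r N \<delta> \<iota> \<Delta> x \<omega> n" by blast
qed

text \<open>For large \<open>n\<close>, few Young times force one of three things: few hyperbolic
  times, no noise value in \<open>U\<close> during an initial stretch of length proportional to
  \<open>n\<close>, or a residue class with many trials and few successes. Each has exponentially
  small measure.\<close>

lemma young_times_frequent:
  fixes R :: "'a measure" and U :: "(real ^ 'k) set" and Z :: "'a set"
  assumes X: "closed X" and R: "sets R = sets (restrict_space borel X)"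
    and inv: "\<And>y w. y \<in> X \<Longrightarrow> w \<in> noise_cube \<sigma> \<Longrightarrow> g y w \<in> X"
    and freq: "0 < \<theta>\<^sub>0" "1 \<le> C\<^sub>7" "0 < \<gamma>\<^sub>1"
      "\<And>n. outer_measure_of (R \<Otimes>\<^sub>M noise_seq \<sigma>) {(x, \<omega>). x \<in> X \<and> \<omega> \<in> space (noise_seq \<sigma>) \<and>
          real (card (hyperbolic_times M g C b \<eta> r x \<omega> n)) \<le> \<theta>\<^sub>0 * real n} \<le> ennreal (C\<^sub>7 * exp (- \<gamma>\<^sub>1 * real n))"
    and scale: "hyperbolic_scale M \<sigma> g C \<beta> b \<eta> r \<delta>" and \<eta>: "0 < \<eta>" "\<eta> < 1"
    and deep: "0 < \<kappa>" "\<And>y w. y \<in> X \<Longrightarrow> w \<in> U \<inter> noise_cube \<sigma> \<Longrightarrow> ball (g y w) \<kappa> \<subseteq> X"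
    and U: "U \<in> sets borel" "0 < p" "p < 1" "p \<le> measure (noise \<sigma>) (U \<inter> noise_cube \<sigma>)"
    and \<rho>: "0 < \<rho>" "\<rho> \<le> 1" and Z: "finite Z" "\<And>z. z \<in> Z \<Longrightarrow> open (V z)" "{y. ball y \<delta> \<subseteq> X} \<subseteq> (\<Union>z\<in>Z. V z)"
    and E: "\<And>z. z \<in> Z \<Longrightarrow> E z \<in> sets (noise_seq \<sigma>)"
    "\<And>z \<omega> \<omega>'. (\<And>j. j \<le> N \<Longrightarrow> \<omega> j = \<omega>' j) \<Longrightarrow> \<omega> \<in> space (noise_seq \<sigma>) \<Longrightarrow> \<omega>' \<in> space (noise_seq \<sigma>) \<Longrightarrow> \<omega> \<in> E z \<longleftrightarrow> \<omega>' \<in> E z"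
    "\<And>z. z \<in> Z \<Longrightarrow> \<rho> < measure (noise_seq \<sigma>) (E z)"
    "\<And>z y. z \<in> Z \<Longrightarrow> y \<in> V z \<Longrightarrow> E z \<subseteq> reach_event \<sigma> g C N \<iota> \<Delta> (ball y \<delta>)"
  shows "\<exists>C\<^sub>9 \<gamma>\<^sub>2 \<theta>\<^sub>1. C\<^sub>9 \<ge> 1 \<and> \<gamma>\<^sub>2 > 0 \<and> 0 < \<theta>\<^sub>1 \<and> \<theta>\<^sub>1 < 1 \<and>
    (\<forall>n\<ge>1. outer_measure_of (R \<Otimes>\<^sub>M noise_seq \<sigma>) {(x, \<omega>). x \<in> X \<and> \<omega> \<in> space (noise_seq \<sigma>) \<and>
           real (card (young_times M \<sigma> g C b \<eta> r N \<delta> \<iota> \<Delta> x \<omega> n)) \<le> \<theta>\<^sub>1 * real n}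
      \<le> ennreal (C\<^sub>9 * exp (- \<gamma>\<^sub>2 * real n)))"
proof -
  let ?\<Omega> = "space (noise_seq \<sigma>) :: (nat \<Rightarrow> real ^ 'k) set"
  let ?Q = "R \<Otimes>\<^sub>M (noise_seq \<sigma> :: (nat \<Rightarrow> real ^ 'k) measure)"
  let ?Y = "{y. ball y \<delta> \<subseteq> X}"
  have space_R: "space R = X" using sets_eq_imp_space_eq[OF R] by (simp add: space_restrict_space)
  have space_Q: "space ?Q = X \<times> ?\<Omega>" by (simp add: space_pair_measure space_R)
  interpret P: prob_space "noise_seq \<sigma> :: (nat \<Rightarrow> real ^ 'k) measure" by (rule noise_seq_prob[OF sigma_pos])
  \<comment> \<open>At \<open>n = 0\<close> the frequency hypothesis speaks of the whole space, and
    so bounds the total mass of \<open>R\<close> by \<open>C\<^sub>7\<close>.\<close>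
  have "{(x, \<omega>). x \<in> X \<and> \<omega> \<in> ?\<Omega> \<and> real (card (hyperbolic_times M g C b \<eta> r x \<omega> 0)) \<le> \<theta>\<^sub>0 * real 0} = space ?Q"
    by (auto simp: hyperbolic_times_def space_Q)
  with freq(4)[of 0] have total: "emeasure ?Q (space ?Q) \<le> ennreal C\<^sub>7" by simp
  moreover have "emeasure ?Q (space ?Q) = emeasure R (space R)"
    unfolding space_pair_measure by (subst P.emeasure_pair_measure_Times) (simp_all add: P.emeasure_space_1)
  ultimately have R_le: "emeasure R (space R) \<le> ennreal C\<^sub>7" by simp
  have \<delta>: "0 < \<delta>" using scale by (simp add: hyperbolic_scale_def)
  obtain n1 where n1: "\<delta> * \<eta> powr (real n1 / 2) < \<kappa>"
  proof -
    have "\<eta> powr (1 / 2) < 1" using powr_less_mono2[of "1 / 2" \<eta> 1] \<eta> by simp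
    then obtain n where "(\<eta> powr (1 / 2)) ^ n < \<kappa> / \<delta>"
      using real_arch_pow_inv[of "\<kappa> / \<delta>" "\<eta> powr (1 / 2)"] deep(1) \<delta> by auto
    then have "\<delta> * \<eta> powr (real n / 2) < \<kappa>"
      using \<eta> \<delta> by (simp add: powr_power pos_less_divide_eq mult.commute)
    then show thesis by (rule that)
  qed
  define m where "m = real (N + 1)"
  have m: "1 \<le> m" by (simp add: m_def)
  \<comment> \<open>The initial stretch and the fixed loss \<open>n1 + 1\<close> take at most
    \<open>\<epsilon> * n\<close> sparse times each, worth \<open>\<theta>\<^sub>0 * n / 2\<close>
    hyperbolic times after multiplication by \<open>m\<close>. The remaining half, divided by
    \<open>m\<close> for sparseness and by \<open>m\<close> again for the residue class, gives
    \<open>a\<close>. The bound \<open>c\<close> on \<open>\<theta>\<^sub>1\<close> is the one that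
    \<open>powr_decay_bound\<close> asks for.\<close>
  define \<epsilon> where "\<epsilon> = \<theta>\<^sub>0 / (4 * m)"
  define a where "a = \<theta>\<^sub>0 / (2 * m\<^sup>2)"
  define q where "q = 1 - \<rho> / 2"
  define c where "c = - a * ln q / 2"
  define \<theta>\<^sub>1 where "\<theta>\<^sub>1 = min (1 / 2) c"
  have \<epsilon>: "0 < \<epsilon>" using freq(1) m by (simp add: \<epsilon>_def)
  have a: "0 < a" using freq(1) m by (simp add: a_def)
  have q: "0 < q" "q < 1" using \<rho> by (auto simp: q_def)
  have c: "0 < c" using a q by (simp add: c_def mult_pos_neg)
  have \<theta>\<^sub>1: "0 < \<theta>\<^sub>1" "\<theta>\<^sub>1 < 1" "\<theta>\<^sub>1 \<le> c" using c by (auto simp: \<theta>\<^sub>1_def)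
  \<comment> \<open>From \<open>n3\<close> on the fixed loss is absorbed. The finitely many smaller
    \<open>n\<close> are covered by the bound on the total mass, at the cost of the factor
    \<open>exp (\<gamma> * n3)\<close> in \<open>C\<^sub>9\<close>.\<close>
  obtain n3 where n3: "real (n1 + 1) \<le> \<epsilon> * real n3"
    using reals_Archimedean3[OF \<epsilon>] by (metis less_imp_le mult.commute)
  define d where "d = - ln (1 - p)"
  have d: "0 < d" using U by (simp add: d_def)
  define \<gamma> where "\<gamma> = min \<gamma>\<^sub>1 (min (d * \<epsilon>) c)"
  have \<gamma>: "0 < \<gamma>" "\<gamma> \<le> \<gamma>\<^sub>1" "\<gamma> \<le> d * \<epsilon>" "\<gamma> \<le> c" using freq(3) d \<epsilon> c by (auto simp: \<gamma>_def)
  \<comment> \<open>One summand for each kind of exceptional set: few hyperbolic times, avoidance of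
    \<open>U\<close> with its rounding factor \<open>exp d\<close>, and the \<open>m\<close> residue
    classes.\<close>
  define D where "D = C\<^sub>7 * (1 + exp d + m)"
  define C\<^sub>9 where "C\<^sub>9 = D * exp (\<gamma> * real n3)"
  have "C\<^sub>7 * 1 \<le> C\<^sub>7 * (1 + exp d + m)"
    using freq(2) m exp_ge_zero[of d] by (intro mult_left_mono) linarith+
  then have D: "C\<^sub>7 \<le> D" by (simp add: D_def)
  have C\<^sub>9: "D \<le> C\<^sub>9"
    using mult_left_mono[of 1 "exp (\<gamma> * real n3)" D] D freq(2) \<gamma>(1) by (simp add: C\<^sub>9_def)
  define Bad where "Bad = (\<lambda>n. {(x, \<omega>). x \<in> X \<and> \<omega> \<in> ?\<Omega> \<and> real (card (young_times M \<sigma> g C b \<eta> r N \<delta> \<iota> \<Delta> x \<omega> n)) \<le> \<theta>\<^sub>1 * real n})"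
  define L where "L = (\<lambda>n::nat. nat \<lfloor>\<epsilon> * real n\<rfloor>)"
  define A1 where "A1 = (\<lambda>n. {(x, \<omega>). x \<in> X \<and> \<omega> \<in> ?\<Omega> \<and> real (card (hyperbolic_times M g C b \<eta> r x \<omega> n)) \<le> \<theta>\<^sub>0 * real n})"
  define A2 where "A2 = (\<lambda>n. X \<times> {\<omega> \<in> ?\<Omega>. \<forall>k<L n. \<omega> k \<notin> U})"
  define A3 where "A3 = (\<lambda>n q'. {p \<in> space ?Q. a * real n \<le> real (card {k. k < Suc n \<and> trial b \<eta> r N ?Y n (q' + (N + 1) * k) p}) \<and>
       real (card {k. k < Suc n \<and> trial b \<eta> r N ?Y n (q' + (N + 1) * k) p \<and> success Z V E (q' + (N + 1) * k) p}) \<le> \<theta>\<^sub>1 * real n})"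
  have decay: "exp (- g' * real n) \<le> exp (- \<gamma> * real n)" if "\<gamma> \<le> g'" for g' n
    using that by (simp add: mult_right_mono)
  have A1: "outer_measure_of ?Q (A1 n) \<le> ennreal (C\<^sub>7 * exp (- \<gamma> * real n))" for n
    unfolding A1_def using freq(2) decay[OF \<gamma>(2)]
    by (intro order_trans[OF freq(4)] ennreal_leI mult_left_mono) auto
  have A2: "outer_measure_of ?Q (A2 n) \<le> ennreal (C\<^sub>7 * (exp d * exp (- \<gamma> * real n)))" for n
  proof -
    note avoid = noise_seq_avoid[OF sigma_pos U(1,4) less_imp_le[OF U(3)], of "L n"]
    have XR: "X \<in> sets R" using sets.top[of R] by (simp add: space_R)
    have "outer_measure_of ?Q (A2 n) = emeasure ?Q (A2 n)"
      unfolding A2_def by (rule outer_measure_of_eq[OF pair_measureI[OF XR avoid(2)]])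
    also have "\<dots> = emeasure R X * emeasure (noise_seq \<sigma>) {\<omega> \<in> ?\<Omega>. \<forall>k<L n. \<omega> k \<notin> U}"
      unfolding A2_def by (rule P.emeasure_pair_measure_Times[OF XR avoid(2)])
    also have "\<dots> \<le> ennreal C\<^sub>7 * ennreal ((1 - p) ^ L n)"
      using R_le avoid(1) by (intro mult_mono) (auto simp: space_R)
    also have "\<dots> = ennreal (C\<^sub>7 * (1 - p) ^ L n)" using freq(2) U by (simp add: ennreal_mult)
    also have "\<dots> \<le> ennreal (C\<^sub>7 * (exp d * exp (- \<gamma> * real n)))"
    proof (intro ennreal_leI mult_left_mono)
      have "(1 - p) ^ L n \<le> exp d * exp (- (d * \<epsilon>) * real n)"
        using power_floor_bound[of "1 - p" \<epsilon> "real n"] U by (simp add: L_def d_def)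
      also have "\<dots> \<le> exp d * exp (- \<gamma> * real n)"
        using decay[OF \<gamma>(3)] by (intro mult_left_mono) auto
      finally show "(1 - p) ^ L n \<le> exp d * exp (- \<gamma> * real n)" .
    qed (use freq in auto)
    finally show ?thesis .
  qed
  have A3: "outer_measure_of ?Q (A3 n q') \<le> ennreal (C\<^sub>7 * exp (- \<gamma> * real n))" for n q'
  proof -
    have "outer_measure_of ?Q (A3 n q') \<le> emeasure R (space R) * ennreal (q powr (a * real n) * 2 powr (\<theta>\<^sub>1 * real n))"
      unfolding A3_def q_def
      by (rule many_trials_few_successes[OF R \<rho> closed_ball_centres[OF X] Z(3) Z(1,2) E(1-3)])
    also have "\<dots> \<le> ennreal C\<^sub>7 * ennreal (exp (- \<gamma> * real n))"
    proof (intro mult_mono R_le ennreal_leI)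
      have "q powr (a * real n) * 2 powr (\<theta>\<^sub>1 * real n) \<le> exp (- c * real n)"
        unfolding c_def using q \<theta>\<^sub>1 by (intro powr_decay_bound) (auto simp: c_def)
      with decay[OF \<gamma>(4)] show "q powr (a * real n) * 2 powr (\<theta>\<^sub>1 * real n) \<le> exp (- \<gamma> * real n)"
        by (rule order_trans[rotated])
    qed auto
    also have "\<dots> = ennreal (C\<^sub>7 * exp (- \<gamma> * real n))" using freq(2) by (simp add: ennreal_mult)
    finally show ?thesis .
  qed
  have sub: "Bad n \<subseteq> A1 n \<union> (A2 n \<union> (\<Union>q'\<in>{..<N + 1}. A3 n q'))" if n: "n3 \<le> n" for n
  proof
    fix v assume "v \<in> Bad n"
    then obtain x \<omega> where v: "v = (x, \<omega>)" and x: "x \<in> X" and \<omega>: "\<omega> \<in> ?\<Omega>"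
      and young: "real (card (young_times M \<sigma> g C b \<eta> r N \<delta> \<iota> \<Delta> x \<omega> n)) \<le> \<theta>\<^sub>1 * real n"
      unfolding Bad_def by blast
    show "v \<in> A1 n \<union> (A2 n \<union> (\<Union>q'\<in>{..<N + 1}. A3 n q'))"
    proof (rule ccontr)
      assume not: "v \<notin> A1 n \<union> (A2 n \<union> (\<Union>q'\<in>{..<N + 1}. A3 n q'))"
      then have many: "\<theta>\<^sub>0 * real n < real (card (hyperbolic_times M g C b \<eta> r x \<omega> n))"
        using v x \<omega> by (auto simp: A1_def)
      obtain k where k: "k < L n" "\<omega> k \<in> U" using not v x \<omega> by (auto simp: A2_def)
      let ?G = "{i. trial b \<eta> r N ?Y n i (x, \<omega>)}"
      have "real (L n) \<le> \<epsilon> * real n" using \<epsilon> by (simp add: L_def)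
      moreover have "real (n1 + 1) \<le> \<epsilon> * real n"
        by (rule order_trans[OF n3 mult_left_mono]) (use \<epsilon> n in auto)
      ultimately have "real (L n + n1 + 1) \<le> 2 * \<epsilon> * real n" by simp
      then have "m * (real (card ?G) + real (L n + n1 + 1)) \<le> m * (real (card ?G) + 2 * \<epsilon> * real n)"
        using m by (intro mult_left_mono) auto
      moreover have "\<theta>\<^sub>0 * real n < m * (real (card ?G) + real (L n + n1 + 1))"
        using many trials_from_hyperbolic_times[OF scale \<eta> inv deep(2) n1 \<omega> x k, of n N]
        unfolding m_def by linarith
      ultimately have "\<theta>\<^sub>0 * real n < m * real (card ?G) + m * (2 * \<epsilon> * real n)"
        by (simp add: distrib_left)
      moreover have "m * (2 * \<epsilon> * real n) = \<theta>\<^sub>0 * real n / 2" using m by (simp add: \<epsilon>_def)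
      ultimately have "\<theta>\<^sub>0 * real n / 2 < m * real (card ?G)" by simp
      moreover have "m * (m * (a * real n)) = \<theta>\<^sub>0 * real n / 2" using m by (simp add: a_def power2_eq_square)
      ultimately have "m * (m * (a * real n)) \<le> m * real (card ?G)" by linarith
      then have "real (N + 1) * (a * real n) \<le> real (card ?G)" using m unfolding m_def by (subst (asm) mult_le_cancel_left_pos) auto
      moreover have "?G \<subseteq> {..n}" by (auto simp: trial_def)
      ultimately obtain q' where q': "q' < N + 1" "a * real n \<le> real (card {k. k < Suc n \<and> q' + (N + 1) * k \<in> ?G})"
        using card_residue_classes by blast
      have "real (card {k. k < Suc n \<and> trial b \<eta> r N ?Y n (q' + (N + 1) * k) (x, \<omega>) \<and> success Z V E (q' + (N + 1) * k) (x, \<omega>)})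
          \<le> real (card (young_times M \<sigma> g C b \<eta> r N \<delta> \<iota> \<Delta> x \<omega> n))"
        using successes_le_young_times[OF E(4)] by (simp only: of_nat_le_iff)
      also note young
      finally have "v \<in> A3 n q'" using q'(2) x \<omega> unfolding A3_def v space_Q by simp
      with q'(1) not show False by blast
    qed
  qed
  have "outer_measure_of ?Q (Bad n) \<le> ennreal (C\<^sub>9 * exp (- \<gamma> * real n))" for n
  proof (cases "n3 \<le> n")
    case False
    have "outer_measure_of ?Q (Bad n) \<le> outer_measure_of ?Q (space ?Q)"
      by (intro outer_measure_of_mono) (auto simp: Bad_def space_Q)
    also have "\<dots> \<le> ennreal C\<^sub>7" using total by simp
    also have "\<dots> \<le> ennreal (C\<^sub>9 * exp (- \<gamma> * real n))"
    proof (intro ennreal_leI)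
      have "0 \<le> \<gamma> * real n3 - \<gamma> * real n" using False \<gamma>(1) by simp
      then have "C\<^sub>7 * 1 \<le> D * exp (\<gamma> * real n3 - \<gamma> * real n)"
        using D freq(2) by (intro mult_mono) auto
      then show "C\<^sub>7 \<le> C\<^sub>9 * exp (- \<gamma> * real n)" by (simp add: C\<^sub>9_def exp_add[symmetric] exp_diff exp_minus field_simps)
    qed
    finally show ?thesis .
  next
    case True
    have spaces: "A1 n \<subseteq> space ?Q" "A2 n \<subseteq> space ?Q" "A3 n q' \<subseteq> space ?Q" for q'
      by (auto simp: A1_def A2_def A3_def space_Q)
    let ?e = "exp (- \<gamma> * real n)"
    have "outer_measure_of ?Q (Bad n) \<le> outer_measure_of ?Q (A1 n \<union> (A2 n \<union> (\<Union>q'\<in>{..<N + 1}. A3 n q')))"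
      by (rule outer_measure_of_mono[OF sub[OF True]])
    also have "\<dots> \<le> outer_measure_of ?Q (A1 n) + outer_measure_of ?Q (A2 n \<union> (\<Union>q'\<in>{..<N + 1}. A3 n q'))"
      using spaces by (intro outer_measure_of_Un_le) blast+
    also have "\<dots> \<le> outer_measure_of ?Q (A1 n) + (outer_measure_of ?Q (A2 n) + outer_measure_of ?Q (\<Union>q'\<in>{..<N + 1}. A3 n q'))"
      using spaces by (intro add_left_mono outer_measure_of_Un_le) blast+
    also have "\<dots> \<le> outer_measure_of ?Q (A1 n) + (outer_measure_of ?Q (A2 n) + (\<Sum>q'\<in>{..<N + 1}. outer_measure_of ?Q (A3 n q')))"
      using spaces by (intro add_left_mono outer_measure_of_UN_le) auto
    also have "\<dots> \<le> ennreal (C\<^sub>7 * ?e) + (ennreal (C\<^sub>7 * (exp d * ?e)) + (\<Sum>q'\<in>{..<N + 1}. ennreal (C\<^sub>7 * ?e)))"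
      by (intro add_mono sum_mono A1 A2 A3)
    also have "\<dots> = ennreal (C\<^sub>7 * ?e) + (ennreal (C\<^sub>7 * (exp d * ?e)) + ennreal (\<Sum>q'\<in>{..<N + 1}. C\<^sub>7 * ?e))"
      using freq(2) by (subst sum_ennreal) auto
    also have "\<dots> = ennreal (C\<^sub>7 * ?e + (C\<^sub>7 * (exp d * ?e) + m * (C\<^sub>7 * ?e)))"
      using freq(2) m by (simp add: m_def flip: ennreal_plus)
    also have "C\<^sub>7 * ?e + (C\<^sub>7 * (exp d * ?e) + m * (C\<^sub>7 * ?e)) = D * ?e"
      by (simp add: D_def algebra_simps)
    also have "ennreal (D * ?e) \<le> ennreal (C\<^sub>9 * ?e)"
      using C\<^sub>9 by (intro ennreal_leI mult_right_mono) auto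
    finally show ?thesis .
  qed
  moreover have "1 \<le> C\<^sub>9" using C\<^sub>9 D freq(2) by simp
  ultimately show ?thesis
    using \<gamma>(1) \<theta>\<^sub>1(1,2) unfolding Bad_def by blast
qed

end

section \<open>Application to the support of the stationary measure\<close>

theorem proposition4p7:
  fixes M :: "('a::{metric_space, second_countable_topology}, 'k::finite) manifold"
    and m \<mu> :: "'a measure"
    and g :: "'a \<Rightarrow> real ^ 'k \<Rightarrow> 'a"
    and C :: "real ^ 'k \<Rightarrow> 'a set"
    and \<sigma> \<alpha> \<beta> B b \<eta>\<^sub>0 r\<^sub>0 \<delta>\<^sub>0 \<delta>\<^sub>1 \<delta>\<^sub>2 \<iota> \<rho> :: real
    and A \<Delta> :: "'a set"
    and x\<^sub>b :: 'a
    and \<omega>\<^sub>b :: "nat \<Rightarrow> real ^ 'k"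
    and N :: nat
  assumes manifold: "compact_riemannian_manifold M" "riemannian_volume M m"
    and sigma: "\<sigma> > 0"
    and H1: "H1 M \<sigma> g C \<beta>"
    and H2: "H2 M m \<sigma> g C B \<alpha> \<beta>"
    and H3: "H3 M \<sigma> g \<mu>"
    and H4: "H4 m \<mu> \<sigma> C"
    and b: "0 < b" "b < 1 / 2 * min 1 (\<beta> / \<alpha>)"
    and eta0_r0: "0 < \<eta>\<^sub>0" "\<eta>\<^sub>0 < 1" "0 < r\<^sub>0"
      "hyperbolic_times_frequent M m \<mu> \<sigma> g C b \<eta>\<^sub>0 r\<^sub>0"
    and delta0: "hyperbolic_scale M \<sigma> g C \<beta> b \<eta>\<^sub>0 r\<^sub>0 \<delta>\<^sub>0"
    and A: "open A" "A \<noteq> {}" "A \<subseteq> msupp \<mu>"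
    and reference: "reference_choice \<sigma> g C \<mu> \<delta>\<^sub>0 A x\<^sub>b \<omega>\<^sub>b N \<delta>\<^sub>1 \<delta>\<^sub>2"
    and Delta: "\<Delta> = ball (rmap_iter g N \<omega>\<^sub>b x\<^sub>b) \<delta>\<^sub>2"
    and iota_rho: "reach_likely \<sigma> g C \<mu> N \<delta>\<^sub>0 \<iota> \<rho> \<Delta>"
  shows "\<exists>C\<^sub>9 \<gamma>\<^sub>2 \<theta>\<^sub>1. C\<^sub>9 \<ge> 1 \<and> \<gamma>\<^sub>2 > 0 \<and> 0 < \<theta>\<^sub>1 \<and> \<theta>\<^sub>1 < 1 \<and>
    (\<forall>n\<ge>1. outer_measure_of (ref_measure m \<mu> \<sigma>)
        {(x, \<omega>). x \<in> msupp \<mu> \<and> \<omega> \<in> space (noise_seq \<sigma>) \<and>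
           real (card (young_times M \<sigma> g C b \<eta>\<^sub>0 r\<^sub>0 N \<delta>\<^sub>0 \<iota> \<Delta> x \<omega> n)) \<le> \<theta>\<^sub>1 * real n}
      \<le> ennreal (C\<^sub>9 * exp (- \<gamma>\<^sub>2 * real n)))"
proof -
  let ?X = "msupp \<mu>"
  let ?n = "noise_seq \<sigma> :: (nat \<Rightarrow> real ^ 'k) measure"
  have compact_M: "compact (UNIV :: 'a set)" and atlas: "smooth_atlas M"
    using manifold(1) by (auto simp: compact_riemannian_manifold_def)
  have sets_m: "sets m = sets borel" using manifold(2) by (simp add: riemannian_volume_def)
  have cont_g: "continuous_on (UNIV \<times> noise_cube \<sigma>) (\<lambda>(x, w). g x w)"
    and C_eq: "\<And>w. w \<in> noise_cube \<sigma> \<Longrightarrow> C w = {x. \<not> regular_at M (\<lambda>y. g y w) x}"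
    and diffeo: "\<And>x. noise_diffeo M \<sigma> g x"
    using H1 unfolding H1_def by blast+
  have closed_C: "\<And>w. w \<in> noise_cube \<sigma> \<Longrightarrow> closed (C w)"
    and usc: "\<And>w \<epsilon>. w \<in> noise_cube \<sigma> \<Longrightarrow> 0 < \<epsilon> \<Longrightarrow> \<exists>\<delta>>0. \<forall>w'\<in>noise_cube \<sigma>.
        dist w' w < \<delta> \<longrightarrow> C w' \<subseteq> (\<Union>y\<in>C w. ball y \<epsilon>)"
    and B: "1 < B"
    and expand: "\<And>w x v. w \<in> noise_cube \<sigma> \<Longrightarrow> x \<in> - C w \<Longrightarrow> v \<noteq> 0 \<Longrightarrow>
        (1 / B) * crit_dist x (C w) powr \<alpha> \<le> tnorm M (g x w) (mderiv M (\<lambda>y. g y w) x v) / tnorm M x v"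
    using H2 unfolding H2_def by blast+
  have st: "stationary \<sigma> g \<mu>" using H3 by (simp add: H3_def ergodic_stationary_def)
  have sets_\<mu>: "sets \<mu> = sets borel" using st by (simp add: stationary_def)
  interpret measurable_family \<sigma> C M g
  proof unfold_locales
    show "0 < inv_deriv_norm M (\<lambda>y. g y w) x" if w: "w \<in> noise_cube \<sigma>" "x \<notin> C w" for x w
    proof (rule inv_deriv_norm_pos)
      show "regular_at M (\<lambda>y. g y w) x" using w C_eq by blast
      show "0 < (1 / B) * crit_dist x (C w) powr \<alpha>"
        using B crit_dist_pos[OF closed_C[OF w(1)] w(2)] by simp
      show "(1 / B) * crit_dist x (C w) powr \<alpha> \<le> tnorm M (g x w) (mderiv M (\<lambda>y. g y w) x v) / tnorm M x v" if "v \<noteq> 0" for v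
        using w that by (intro expand) auto
    qed
    \<comment> \<open>Integrability in (H3) contains measurability of the logarithm. It is stated
      for \<mu>, but measurability depends on the sigma-algebra alone, which is the Borel
      one.\<close>
    have "(\<lambda>(x, \<omega>). ln (inv_deriv_norm M (rmap g \<omega>) x)) \<in> borel_measurable (\<mu> \<Otimes>\<^sub>M noise_seq \<sigma>)"
      using H3 unfolding H3_def by (auto dest: borel_measurable_integrable)
    moreover have "sets (\<mu> \<Otimes>\<^sub>M ?n) = sets (borel \<Otimes>\<^sub>M ?n)"
      by (rule sets_pair_measure_cong[OF sets_\<mu> refl])
    ultimately show "(\<lambda>(x, \<omega>). ln (inv_deriv_norm M (rmap g \<omega>) x)) \<in> borel_measurable (borel \<Otimes>\<^sub>M noise_seq \<sigma>)"
      using measurable_cong_sets by blast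
  qed (fact closed_C usc atlas compact_M sigma cont_g C_eq)+
  have inv: "g y w \<in> ?X" if "y \<in> ?X" "w \<in> noise_cube \<sigma>" for y w
    using that by (rule msupp_invariant[OF sigma cont_g st])
  \<comment> \<open>Half the cube stays away from the faces: its compactness gives a uniform depth
    \<kappa>, and the open box inside it has positive noise probability.\<close>
  let ?K = "noise_cube (\<sigma> / 2) :: (real ^ 'k) set"
  let ?U = "box (\<chi> i. - (\<sigma> / 2)) (\<chi> i. \<sigma> / 2) :: (real ^ 'k) set"
  have K_int: "?K \<subseteq> interior (noise_cube \<sigma>)"
  proof
    fix w :: "real ^ 'k" assume "w \<in> ?K"
    then have w: "- (\<sigma> / 2) \<le> w $ i \<and> w $ i \<le> \<sigma> / 2" for i by (simp add: noise_cube_def mem_box_cart)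
    have "- \<sigma> < w $ i \<and> w $ i < \<sigma>" for i using w[of i] sigma by linarith
    then show "w \<in> interior (noise_cube \<sigma>)" by (simp add: noise_cube_def interior_cbox mem_box_cart)
  qed
  have "compact ?X" using compact_Int_closed[OF compact_M closed_msupp[of \<mu>]] by simp
  moreover have "compact ?K" by (simp add: noise_cube_def)
  moreover have "continuous_on (?X \<times> ?K) (\<lambda>(x, w). g x w)"
    using K_int interior_subset[of "noise_cube \<sigma>"] by (intro continuous_on_subset[OF cont_g]) blast
  moreover have "g y w \<in> interior ?X" if "y \<in> ?X" "w \<in> ?K" for y w
    using that K_int inv by (intro noise_value_interior[OF atlas diffeo]) auto
  ultimately have "\<exists>\<kappa>>0. \<forall>y\<in>?X. \<forall>w\<in>?K. ball (g y w) \<kappa> \<subseteq> ?X"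
    by (rule uniform_interior_radius)
  then obtain \<kappa> where \<kappa>: "\<kappa> > 0" "\<And>y w. y \<in> ?X \<Longrightarrow> w \<in> ?K \<Longrightarrow> ball (g y w) \<kappa> \<subseteq> ?X"
    by blast
  have "0 \<in> ?U" "0 \<in> (noise_cube \<sigma> :: (real ^ 'k) set)" using sigma by (auto simp: noise_cube_def mem_box_cart)
  then have "0 < emeasure (noise \<sigma>) (?U \<inter> noise_cube \<sigma>)"
    using sigma by (intro emeasure_noise_open_pos) auto
  then have U_pos: "0 < measure (noise \<sigma>) (?U \<inter> noise_cube \<sigma>)"
    by (simp add: finite_measure.emeasure_eq_measure[OF prob_space.finite_measure[OF prob_space_noise[OF sigma]]])
  obtain \<theta>\<^sub>0 C\<^sub>7 \<gamma>\<^sub>1 where freq: "0 < \<theta>\<^sub>0" "1 \<le> C\<^sub>7" "0 < \<gamma>\<^sub>1"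
    "\<And>n. outer_measure_of (ref_measure m \<mu> \<sigma>)
               {(x, \<omega>). x \<in> msupp \<mu> \<and> \<omega> \<in> space ?n \<and>
                  real (card (hyperbolic_times M g C b \<eta>\<^sub>0 r\<^sub>0 x \<omega> n)) \<le> \<theta>\<^sub>0 * real n}
             \<le> ennreal (C\<^sub>7 * exp (- \<gamma>\<^sub>1 * real n))"
    using eta0_r0(4) unfolding hyperbolic_times_frequent_def by blast
  \<comment> \<open>If no ball of radius at least \<open>\<delta>\<^sub>0\<close> lies in the
    support, the condition on \<rho> is vacuous apart from positivity and \<rho> may exceed 1; the
    cap keeps \<open>1 - \<rho>' / 2\<close> positive.\<close>
  define \<rho>' where "\<rho>' = min \<rho> 1"
  have \<rho>': "0 < \<rho>'" "\<rho>' \<le> 1" and \<iota>: "0 < \<iota>" using iota_rho by (auto simp: reach_likely_def \<rho>'_def)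
  have likely: "\<forall>y. ball y \<delta>\<^sub>0 \<subseteq> ?X \<longrightarrow> \<rho>' < measure ?n (reach_event \<sigma> g C N \<iota> \<Delta> (ball y \<delta>\<^sub>0))"
    using iota_rho unfolding reach_likely_def \<rho>'_def by (blast intro: le_less_trans[OF min.cobounded1])
  have \<Delta>: "\<Delta> \<noteq> {}" using reference Delta by (auto simp: reference_choice_def)
  obtain Z :: "'a set" and V E where Z: "finite Z" "\<forall>z\<in>Z. open (V z)" "{y. ball y \<delta>\<^sub>0 \<subseteq> ?X} \<subseteq> (\<Union>z\<in>Z. V z)"
    and E: "\<forall>z. E z \<in> sets ?n"
    "\<forall>z. \<forall>\<omega>\<in>space ?n. \<forall>\<omega>'\<in>space ?n. (\<forall>j\<le>N. \<omega> j = \<omega>' j) \<longrightarrow> (\<omega> \<in> E z \<longleftrightarrow> \<omega>' \<in> E z)"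
    "\<forall>z\<in>Z. \<rho>' < measure ?n (E z)"
    "\<forall>z\<in>Z. \<forall>y\<in>V z. E z \<subseteq> reach_event \<sigma> g C N \<iota> \<Delta> (ball y \<delta>\<^sub>0)"
    using finite_inner_reach_cover[OF closed_msupp[of \<mu>] \<iota> \<Delta> less_imp_le[OF \<rho>'(1)] likely]
    by (elim exE conjE) (rule that)
  have sets_R: "sets (restrict_space m ?X) = sets (restrict_space borel ?X)"
    by (simp add: sets_restrict_space sets_m)
  \<comment> \<open>Capping the probability of \<open>?U\<close> at 1/2 yields \<open>p < 1\<close>,
    as needed for \<open>ln (1 - p)\<close>, without computing a volume.\<close>
  show ?thesis unfolding ref_measure_def
  proof (rule young_times_frequent[OF closed_msupp sets_R inv freq(1-3) freq(4)[unfolded ref_measure_def] delta0 eta0_r0(1,2) \<kappa>(1),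
        where U = ?U and p = "min (1 / 2) (measure (noise \<sigma>) (?U \<inter> noise_cube \<sigma>))" and \<rho> = \<rho>' and Z = Z and V = V and E = E])
    show "\<omega> \<in> E z \<longleftrightarrow> \<omega>' \<in> E z" if "\<And>j. j \<le> N \<Longrightarrow> \<omega> j = \<omega>' j" "\<omega> \<in> space ?n" "\<omega>' \<in> space ?n" for z \<omega> \<omega>'
      using E(2) that by blast
    show "ball (g y w) \<kappa> \<subseteq> ?X" if "y \<in> ?X" "w \<in> ?U \<inter> noise_cube \<sigma>" for y w
      using that box_subset_cbox[of "\<chi> i. - (\<sigma> / 2)" "\<chi> i. \<sigma> / 2"] by (intro \<kappa>) (auto simp: noise_cube_def)
  qed (use U_pos \<rho>' Z E in auto)
qed

end
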